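(* Let $\alpha,\gamma,\rho,a\in\mathbb{C}$ with $\operatorname{Re}(\alpha)>0$ and $a\ne0$, put $N=[\operatorname{Re}(\alpha)]+1$, and let $\mu$ be a real number, such that $\mu>0$ and $\operatorname{Re}(\rho)-N>\max\{0,\operatorname{Re}(-\alpha-\gamma)\}$. Then the left-sided Caputo-type Erdélyi–Kober fractional derivative ${}^{c}\mathcal{D}_{\gamma,\alpha}^{+}={}^{c}\mathcal{D}_{0+}^{\alpha,0,\gamma}$ satisfies, for every $x>0$, $$\left({}^{c}\mathcal{D}_{\gamma,\alpha}^{+}\left(t^{\rho-1}I^{m,n}_{p,q}\left[at^{\mu}\,\middle|\begin{matrix}(a_i,A_i,\alpha_i)_{1,p}\\(b_j,B_j,\beta_j)_{1,q}\end{matrix}\right]\right)\right)(x)=x^{\rho-1}\,I^{m,n+1}_{p+1,q+1}\left[ax^{\mu}\,\middle|\begin{matrix}(1-\alpha-\gamma-\rho+N,\mu,1),\ (a_i,A_i,\alpha_i)_{1,p}\\(b_j,B_j,\beta_j)_{1,q},\ (1-\gamma-\rho+N,\mu,1)\end{matrix}\right].$$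
   Context: **$I$-function.** Let $m,n,p,q$ be integers with $0\le m\le q$, $0\le n\le p$; let $a_i\in\mathbb{C}$, $A_i,\alpha_i>0$ $(1\le i\le p)$ and $b_j\in\mathbb{C}$, $B_j,\beta_j>0$ $(1\le j\le q)$. For $z\neq0$ (with a chosen value of $\arg z$; $z^{-s}=e^{-s(\log|z|+i\arg z)}$), $$I^{m,n}_{p,q}\left[z\,\middle|\begin{matrix}(a_i,A_i,\alpha_i)_{1,p}\\(b_j,B_j,\beta_j)_{1,q}\end{matrix}\right]=\frac{1}{2\pi i}\int_{C}\chi(s)z^{-s}\,ds,\qquad \chi(s)=\frac{\prod_{j=1}^{m}\Gamma^{\beta_j}(b_j+B_js)\prod_{i=1}^{n}\Gamma^{\alpha_i}(1-a_i-A_is)}{\prod_{j=m+1}^{q}\Gamma^{\beta_j}(1-b_j-B_js)\prod_{i=n+1}^{p}\Gamma^{\alpha_i}(a_i+A_is)}.$$ Here $(a_i,A_i,\alpha_i)_{1,p}$ is the ordered list of triples for $i=1,\dots,p$ (the first $n$ upper triples and the first $m$ lower triples enter the numerator), $\Gamma^{\kappa}(w)=(\Gamma(w))^{\kappa}$, with the branch of non-integer powers fixed along $C$ and the same for the same triple in all $I$-functions considered; empty products equal $1$. The singularities of $\Gamma^{\beta_j}(b_j+B_js)$, $j\le m$, lie to the left of $C$ and those of $\Gamma^{\alpha_i}(1-a_i-A_is)$, $i\le n$, to the right. **Standing assumptions.** The contour $C$ is the imaginary axis $\operatorname{Re}(s)=0$, traversed upwards, and for each $I$-function occurring the following conditions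 for absolute convergence hold: with (computed from the parameters of that $I$-function) $\mu^*=\sum_{j=1}^q\beta_jB_j-\sum_{i=1}^p\alpha_iA_i$, $\Omega=\sum_{i=1}^p(\frac12-\operatorname{Re}(a_i))\alpha_i-\sum_{j=1}^q(\frac12-\operatorname{Re}(b_j))\beta_j$, $\Delta=\sum_{j=1}^m\beta_jB_j-\sum_{j=m+1}^q\beta_jB_j+\sum_{i=1}^n\alpha_iA_i-\sum_{i=n+1}^p\alpha_iA_i$, either $\Delta>0$ and $|\arg z|<\frac{\pi}{2}\Delta$, or $\Delta\ge0$, $|\arg z|=\frac{\pi}{2}\Delta$ and one of: $\mu^*=0$ and $\Omega<-1$; or $\mu^*\ne0$ and $\Omega+\sigma\mu^*<-1$ where $\sigma=\operatorname{Re}(s)$ on $C$ (so $\sigma=0$). For $t>0$, $\arg(at^{\pm\mu})=\arg a$. **Operators.** For $\operatorname{Re}(\alpha)>0$, $x>0$, the left-sided Saigo fractional integral is $$\left(\mathcal{I}_{0+}^{\alpha,\beta,\gamma}f\right)(x)=\frac{x^{-\alpha-\beta}}{\Gamma(\alpha)}\int_0^x(x-t)^{\alpha-1}{}_{2}F_1\left(\alpha+\beta,-\gamma;\alpha;1-\tfrac{t}{x}\right)f(t)\,dt,$$ the left-sided generalized Caputo fractional derivative, applied to functions $f$ that are $N$ times differentiable on $(0,\infty)$, is $$\left({}^{c}\mathcal{D}_{0+}^{\alpha,\beta,\gamma}f\right)(x)=\left(\mathcal{I}_{0+}^{-\alpha+N,-\beta-N,\alpha+\gamma-N}f^{(N)}\right)(x),\qquad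 N=[\operatorname{Re}(\alpha)]+1,$$ with $[\cdot]$ the integer part and $f^{(N)}$ the $N$-th derivative, and ${}^{c}\mathcal{D}_{\gamma,\alpha}^{+}:={}^{c}\mathcal{D}_{0+}^{\alpha,0,\gamma}$. *)

theory Defs
  imports "HOL-Analysis.Analysis"
begin

section \<open>The I-function\<close>

text \<open>A triple \<open>(a, A, \<alpha>)\<close> as it occurs in the upper and lower parameter lists.\<close>

type_synonym I_triple = "complex \<times> real \<times> real"

text \<open>
  The branch of \<open>\<Gamma>(w + c s) powr \<kappa>\<close> along the contour is
  \<open>exp (\<kappa> * br w c \<kappa> s)\<close>, where \<open>br w c \<kappa>\<close> is a continuous logarithm of
  \<open>\<Gamma>(w + c s)\<close> on the imaginary axis.  A triple \<open>(a, A, \<alpha>)\<close> gives rise to the two keys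
  \<open>(a, A, \<alpha>)\<close> and \<open>(1 - a, - A, \<alpha>)\<close>, so that handing the same \<open>br\<close> to several I-functions
  makes them use the same branch for the same triple.
  A factor in the denominator of the integrand may have a pole on the axis (at one point
  at most); there is no logarithm there, and a logarithm is chosen on each side of it.
\<close>

type_synonym log_Gamma_family = "complex \<Rightarrow> real \<Rightarrow> real \<Rightarrow> complex \<Rightarrow> complex"

definition is_log_Gamma_family :: "log_Gamma_family \<Rightarrow> bool" where
  "is_log_Gamma_family br \<longleftrightarrow>
     (\<forall>w c \<kappa>. c \<noteq> 0 \<longrightarrow>
        continuous_on {s. Re s = 0 \<and> w + of_real c * s \<notin> \<int>\<^sub>\<le>\<^sub>0} (br w c \<kappa>) \<and>
        (\<forall>s. Re s = 0 \<and> w + of_real c * s \<notin> \<int>\<^sub>\<le>\<^sub>0 \<longrightarrow>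
           exp (br w c \<kappa> s) = Gamma (w + of_real c * s)))"

text \<open>
  At a pole of the Gamma function the value is \<open>0\<close>, as for the library's \<open>Gamma\<close>.  In a
  denominator this yields \<open>1 / 0 = 0\<close>, which is the correct value of
  \<open>1 / \<Gamma> powr \<kappa>\<close> for \<open>\<kappa> > 0\<close>.
\<close>

definition Gamma_power :: "log_Gamma_family \<Rightarrow> complex \<Rightarrow> real \<Rightarrow> real \<Rightarrow> complex \<Rightarrow> complex" where
  "Gamma_power br w c \<kappa> s =
     (if w + of_real c * s \<in> \<int>\<^sub>\<le>\<^sub>0 then 0 else exp (of_real \<kappa> * br w c \<kappa> s))"

definition I_chi :: "log_Gamma_family \<Rightarrow> nat \<Rightarrow> nat \<Rightarrow> I_triple list \<Rightarrow> I_triple list \<Rightarrow>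
    complex \<Rightarrow> complex" where
  "I_chi br m n us ls s =
     ((\<Prod>(b, B, \<beta>)\<leftarrow>take m ls. Gamma_power br b B \<beta> s) *
      (\<Prod>(a, A, \<alpha>)\<leftarrow>take n us. Gamma_power br (1 - a) (- A) \<alpha> s)) /
     ((\<Prod>(b, B, \<beta>)\<leftarrow>drop m ls. Gamma_power br (1 - b) (- B) \<beta> s) *
      (\<Prod>(a, A, \<alpha>)\<leftarrow>drop n us. Gamma_power br a A \<alpha> s))"

text \<open>
  The contour is the imaginary axis, parametrised by \<open>s = \<i> \<tau>\<close>; the last factor \<open>\<i>\<close> comes from
  \<open>ds = \<i> d\<tau>\<close>.  The number \<open>\<theta>\<close> is the chosen (not necessarily principal) argument of \<open>z\<close>.
\<close>

definition I_function :: "log_Gamma_family \<Rightarrow> nat \<Rightarrow> nat \<Rightarrow> I_triple list \<Rightarrow> I_triple list \<Rightarrow>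
    complex \<Rightarrow> real \<Rightarrow> complex" where
  "I_function br m n us ls z \<theta> =
     1 / (2 * of_real pi * \<i>) *
     (LBINT \<tau>. I_chi br m n us ls (\<i> * of_real \<tau>) *
        exp (- (\<i> * of_real \<tau>) * (of_real (ln (norm z)) + \<i> * of_real \<theta>)) * \<i>)"

text \<open>
  The last two clauses say that the singularities of the numerator factors of the first
  (second) kind lie to the left (right) of the imaginary axis.
\<close>

definition I_parameters :: "nat \<Rightarrow> nat \<Rightarrow> I_triple list \<Rightarrow> I_triple list \<Rightarrow> bool" where
  "I_parameters m n us ls \<longleftrightarrow>
     m \<le> length ls \<and> n \<le> length us \<and>
     (\<forall>(a, A, \<alpha>)\<in>set us. A > 0 \<and> \<alpha> > 0) \<and>
     (\<forall>(b, B, \<beta>)\<in>set ls. B > 0 \<and> \<beta> > 0) \<and>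
     (\<forall>(b, B, \<beta>)\<in>set (take m ls). \<forall>s. b + of_real B * s \<in> \<int>\<^sub>\<le>\<^sub>0 \<longrightarrow> Re s < 0) \<and>
     (\<forall>(a, A, \<alpha>)\<in>set (take n us). \<forall>s. 1 - a - of_real A * s \<in> \<int>\<^sub>\<le>\<^sub>0 \<longrightarrow> Re s > 0)"

definition I_mu :: "I_triple list \<Rightarrow> I_triple list \<Rightarrow> real" where
  "I_mu us ls = (\<Sum>(b, B, \<beta>)\<leftarrow>ls. \<beta> * B) - (\<Sum>(a, A, \<alpha>)\<leftarrow>us. \<alpha> * A)"

definition I_Omega :: "I_triple list \<Rightarrow> I_triple list \<Rightarrow> real" where
  "I_Omega us ls =
     (\<Sum>(a, A, \<alpha>)\<leftarrow>us. (1/2 - Re a) * \<alpha>) - (\<Sum>(b, B, \<beta>)\<leftarrow>ls. (1/2 - Re b) * \<beta>)"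

definition I_Delta :: "nat \<Rightarrow> nat \<Rightarrow> I_triple list \<Rightarrow> I_triple list \<Rightarrow> real" where
  "I_Delta m n us ls =
     (\<Sum>(b, B, \<beta>)\<leftarrow>take m ls. \<beta> * B) - (\<Sum>(b, B, \<beta>)\<leftarrow>drop m ls. \<beta> * B) +
     (\<Sum>(a, A, \<alpha>)\<leftarrow>take n us. \<alpha> * A) - (\<Sum>(a, A, \<alpha>)\<leftarrow>drop n us. \<alpha> * A)"

text \<open>
  Conditions for absolute convergence when \<open>z\<close> has argument \<open>\<theta>\<close>; \<open>\<sigma>\<close> is the real part of
  the points of the contour, which is \<open>0\<close> here.
\<close>

definition I_convergent :: "nat \<Rightarrow> nat \<Rightarrow> I_triple list \<Rightarrow> I_triple list \<Rightarrow> real \<Rightarrow> bool" where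
  "I_convergent m n us ls \<theta> \<longleftrightarrow>
     (let \<Delta> = I_Delta m n us ls; \<Omega> = I_Omega us ls; \<mu> = I_mu us ls; \<sigma> = 0 in
        \<Delta> > 0 \<and> \<bar>\<theta>\<bar> < pi / 2 * \<Delta> \<or>
        \<Delta> \<ge> 0 \<and> \<bar>\<theta>\<bar> = pi / 2 * \<Delta> \<and>
          (\<mu> = 0 \<and> \<Omega> < -1 \<or> \<mu> \<noteq> 0 \<and> \<Omega> + \<sigma> * \<mu> < -1))"


section \<open>Fractional operators\<close>

definition hypergeom_2F1 :: "complex \<Rightarrow> complex \<Rightarrow> complex \<Rightarrow> complex \<Rightarrow> complex" where
  "hypergeom_2F1 a b c z = eval_fps (fps_hypergeo [a, b] [c] 1) z"

lemma hypergeom_2F1_eq_suminf: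
  "hypergeom_2F1 a b c z =
     (\<Sum>k. pochhammer a k * pochhammer b k / (pochhammer c k * fact k) * z ^ k)"
  by (simp add: hypergeom_2F1_def eval_fps_def)

definition saigo_integrand ::
    "complex \<Rightarrow> complex \<Rightarrow> complex \<Rightarrow> (real \<Rightarrow> complex) \<Rightarrow> real \<Rightarrow> real \<Rightarrow> complex" where
  "saigo_integrand \<alpha> \<beta> \<gamma> f x t =
     of_real (x - t) powr (\<alpha> - 1) *
     hypergeom_2F1 (\<alpha> + \<beta>) (- \<gamma>) \<alpha> (1 - of_real t / of_real x) * f t"

text \<open>
  The integral is the Henstock-Kurzweil one.  It agrees with the Lebesgue integral
  whenever the integrand is absolutely integrable, and with the improper Riemann
  integral whenever that converges.
\<close>

definition saigo_integral ::
    "complex \<Rightarrow> complex \<Rightarrow> complex \<Rightarrow> (real \<Rightarrow> complex) \<Rightarrow> real \<Rightarrow> complex" where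
  "saigo_integral \<alpha> \<beta> \<gamma> f x =
     of_real x powr (- \<alpha> - \<beta>) / Gamma \<alpha> *
     integral {0<..<x} (saigo_integrand \<alpha> \<beta> \<gamma> f x)"

definition nth_derivative :: "nat \<Rightarrow> (real \<Rightarrow> complex) \<Rightarrow> real \<Rightarrow> complex" where
  "nth_derivative k f = ((\<lambda>g t. vector_derivative g (at t)) ^^ k) f"

definition times_differentiable :: "nat \<Rightarrow> (real \<Rightarrow> complex) \<Rightarrow> bool" where
  "times_differentiable N f \<longleftrightarrow> (\<forall>k<N. \<forall>t>0. nth_derivative k f differentiable (at t))"

definition caputo_order :: "complex \<Rightarrow> nat" where
  "caputo_order \<alpha> = nat \<lfloor>Re \<alpha>\<rfloor> + 1"

definition caputo_derivative ::
    "complex \<Rightarrow> complex \<Rightarrow> complex \<Rightarrow> (real \<Rightarrow> complex) \<Rightarrow> real \<Rightarrow> complex" where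
  "caputo_derivative \<alpha> \<beta> \<gamma> f =
     (let N = caputo_order \<alpha> in
        saigo_integral (- \<alpha> + of_nat N) (- \<beta> - of_nat N) (\<alpha> + \<gamma> - of_nat N)
          (nth_derivative N f))"

text \<open>
  The operator is defined at \<open>f\<close> and \<open>x\<close>: \<open>f\<close> is sufficiently often differentiable on
  \<open>{0<..}\<close>, and the integral exists.
\<close>

definition caputo_defined ::
    "complex \<Rightarrow> complex \<Rightarrow> complex \<Rightarrow> (real \<Rightarrow> complex) \<Rightarrow> real \<Rightarrow> bool" where
  "caputo_defined \<alpha> \<beta> \<gamma> f x \<longleftrightarrow>
     (let N = caputo_order \<alpha> in
        times_differentiable N f \<and>
        saigo_integrand (- \<alpha> + of_nat N) (- \<beta> - of_nat N) (\<alpha> + \<gamma> - of_nat N)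
          (nth_derivative N f) x integrable_on {0<..<x})"

text \<open>The left-sided Caputo-type Erdelyi-Kober derivative.\<close>

abbreviation caputo_EK :: "complex \<Rightarrow> complex \<Rightarrow> (real \<Rightarrow> complex) \<Rightarrow> real \<Rightarrow> complex" where
  "caputo_EK \<gamma> \<alpha> \<equiv> caputo_derivative \<alpha> 0 \<gamma>"

abbreviation caputo_EK_defined :: "complex \<Rightarrow> complex \<Rightarrow> (real \<Rightarrow> complex) \<Rightarrow> real \<Rightarrow> bool" where
  "caputo_EK_defined \<gamma> \<alpha> \<equiv> caputo_defined \<alpha> 0 \<gamma>"

end

theory Submission
  imports Defs "HOL-Real_Asymp.Real_Asymp" "HOL-Complex_Analysis.Complex_Analysis"
begin

text \<open>
  By definition the I-function at \<open>a t\<^sup>\<mu>\<close>, multiplied by \<open>t powr (\<rho> - 1)\<close>, is a superposition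
  of powers: \<open>f t = (\<integral>\<tau>. h \<tau> * t powr (\<rho> - 1 - \<i> \<mu> \<tau>))\<close>, where \<open>h\<close> is the Mellin-Barnes
  integrand divided by \<open>2 \<pi>\<close> (\<open>powr_times_I_function\<close>).  Applied to a single power,
  the \<open>N\<close>-th derivative yields a Pochhammer symbol and the Saigo integral yields a quotient of Gamma
  values.  With \<open>r \<tau> = \<rho> - N - \<i> \<mu> \<tau>\<close> everything collapses to
  \<open>Gamma (r \<tau> + \<alpha> + \<gamma>) / Gamma (r \<tau> + \<gamma>)\<close>, and these are the two factors that the two additional
  triples contribute to the integrand on the right-hand side (\<open>I_chi_extend\<close>).

  The Saigo integral of a power (\<open>saigo_kernel_integral\<close>) is obtained by integrating the
  hypergeometric series termwise, which leaves complex Beta integrals and a hypergeometric series at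
  \<open>1\<close>.  The latter is summed by Gauss's theorem (\<open>Gauss_hypergeom\<close>); the complex Beta
  integral follows from Gauss's theorem too, by expanding one of its two factors into a binomial series.

  The analytic work is the exchange of the Saigo operator with the integral over \<open>\<tau>\<close>.  If
  \<open>\<bar>\<theta>\<bar> < \<pi> \<Delta> / 2\<close>, the integrand decays exponentially. On the boundary
  \<open>\<bar>\<theta>\<bar> = \<pi> \<Delta> / 2\<close> it decays only like \<open>\<bar>\<tau>\<bar> powr \<Omega>\<close>, and the two convergence
  conditions give \<open>\<Omega> + Re \<alpha> < -1\<close>.  This allows \<open>N - 1\<close> differentiations under the integral sign, but not \<open>N\<close>: the
  last derivative exists by assumption only, and no integral formula is available for it.  It is
  therefore never computed.  Instead, a primitive of the Saigo integrand is written down,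
  \<open>\<Phi> t = (\<integral>\<tau>. H \<tau> * r \<tau> * (\<integral>s\<in>{0<..<t}. k s * s powr (r \<tau> - 1)))\<close>, where \<open>k\<close> is the kernel and
  \<open>g t = (\<integral>\<tau>. H \<tau> * t powr r \<tau>)\<close> is the derivative of order \<open>N - 1\<close>.  Formally integrating by parts inside, the
  function \<open>\<Phi> - k g\<close> has the harmless derivative \<open>- k' g\<close>, so \<open>\<Phi>\<close> has the derivative \<open>k g'\<close> as soon as
  \<open>g'\<close> exists, and the fundamental theorem of calculus for the Henstock-Kurzweil integral gives both the
  existence of the integral of \<open>k g'\<close> and its value \<open>\<Phi> 1\<close> (\<open>saigo_kernel_mellin_integral\<close>).

  For \<open>\<Phi>\<close> to be defined and continuous up to the end points, the inner integral times \<open>r \<tau>\<close> must be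
  bounded by \<open>(1 + \<bar>\<tau>\<bar>) powr \<delta>\<close> uniformly in \<open>t\<close>, with \<open>\<delta>\<close> arbitrarily close to
  \<open>Re \<alpha> + 1 - N\<close>.  This is an oscillatory integral estimate (\<open>saigo_kernel_oscillation\<close>).
  The same estimate for the pure Beta kernel yields the growth of the Gamma function on vertical lines up to
  constant factors (\<open>Gamma_decay\<close>, \<open>rGamma_growth\<close>): it bounds quotients of Gamma values at points
  that differ by a real number in \<open>{0<..<1}\<close>, the functional equation takes care of integer
  steps, and the reflection formula gives the exact modulus on the line \<open>Re s = 1/2\<close>.
\<close>

section \<open>Growth of Pochhammer symbols\<close>

text \<open>
  Euler's limit \<open>pochhammer z (n + 1) / (fact n * n powr z) \<longlonglongrightarrow> rGamma z\<close>, with a comparison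
  sequence that does not vanish at small indices. The quotient and, off the poles, its reciprocal are
  therefore bounded over all indices.
\<close>

lemma pochhammer_asymptotics:
  fixes z :: complex
  shows "(\<lambda>k. norm (pochhammer z (k+1)) / (fact (k+1) * real (k+2) powr (Re z - 1))) \<longlonglongrightarrow> norm (rGamma z)"
    (is "?u \<longlonglongrightarrow> _")
proof -
  have "(\<lambda>n. norm (rGamma_series z n) *
          (real n powr Re z / (real (n+2) powr (Re z - 1) * real (n+1)))) \<longlonglongrightarrow> norm (rGamma z) * 1"
    by (intro tendsto_mult tendsto_norm rGamma_series_LIMSEQ) real_asymp
  moreover have "eventually (\<lambda>n. norm (rGamma_series z n) *
          (real n powr Re z / (real (n+2) powr (Re z - 1) * real (n+1))) = ?u n) sequentially"
    using eventually_gt_at_top[of 0]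
  proof eventually_elim
    case (elim n)
    have "norm (rGamma_series z n) = norm (pochhammer z (n+1)) / (fact n * real n powr Re z)"
      using elim by (simp add: rGamma_series_def norm_divide norm_mult powr_def)
    moreover have "P / (F * X) * (X / (Y * N)) = P / ((N * F) * Y)" if "X > 0" for P F X Y N :: real
      using that by (simp add: field_simps)
    ultimately show ?case using elim by simp
  qed
  ultimately have "?u \<longlonglongrightarrow> norm (rGamma z) * 1"
    by (rule Lim_transform_eventually)
  then show ?thesis by simp
qed

lemma pochhammer_growth_upper:
  fixes z :: complex
  obtains C where "C > 0" "\<And>k. norm (pochhammer z k) \<le> C * fact k * (real k + 1) powr (Re z - 1)"
proof -
  define u where "u = (\<lambda>k. norm (pochhammer z (k+1)) / (fact (k+1) * real (k+2) powr (Re z - 1)))"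
  have "u \<longlonglongrightarrow> norm (rGamma z)" unfolding u_def by (rule pochhammer_asymptotics)
  then have "Bseq u" by (rule convergentI[THEN convergent_imp_Bseq])
  then obtain C where C: "C > 0" "\<And>n. norm (u n) \<le> C" by (auto simp: Bseq_def)
  show ?thesis
  proof (rule that[of "max 1 C"])
    fix k show "norm (pochhammer z k) \<le> max 1 C * fact k * (real k + 1) powr (Re z - 1)"
    proof (cases k)
      case (Suc n)
      have "u n \<ge> 0" by (simp add: u_def)
      then have "u n \<le> max 1 C" using C(2)[of n] by simp
      then show ?thesis using Suc unfolding u_def by (simp add: pos_divide_le_eq mult_ac add_ac del: pochhammer_Suc)
    qed simp
  qed simp
qed

lemma pochhammer_growth_lower:
  fixes z :: complex
  assumes "z \<notin> \<int>\<^sub>\<le>\<^sub>0"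
  obtains C where "C > 0" "\<And>k. inverse (norm (pochhammer z k)) \<le> C * (real k + 1) powr (1 - Re z) / fact k"
proof -
  define u where "u = (\<lambda>k. (fact (k+1) * real (k+2) powr (Re z - 1)) / norm (pochhammer z (k+1)))"
  have "(\<lambda>k. inverse (norm (pochhammer z (k+1)) / (fact (k+1) * real (k+2) powr (Re z - 1)))) \<longlonglongrightarrow>
      inverse (norm (rGamma z))"
    using assms by (intro tendsto_inverse pochhammer_asymptotics) (simp add: rGamma_eq_zero_iff)
  then have "u \<longlonglongrightarrow> inverse (norm (rGamma z))" unfolding u_def inverse_divide .
  then have "Bseq u" by (rule convergentI[THEN convergent_imp_Bseq])
  then obtain C where C: "C > 0" "\<And>n. norm (u n) \<le> C" by (auto simp: Bseq_def)
  show ?thesis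
  proof (rule that[of "max 1 C"])
    fix k show "inverse (norm (pochhammer z k)) \<le> max 1 C * (real k + 1) powr (1 - Re z) / fact k"
    proof (cases k)
      case (Suc n)
      have "u n \<ge> 0" by (simp add: u_def)
      then have 1: "u n \<le> max 1 C" using C(2)[of n] by simp
      have 2: "u n = (fact k * (real k + 1) powr (Re z - 1)) * inverse (norm (pochhammer z k))"
        unfolding u_def Suc by (simp add: field_simps)
      have 3: "(real k + 1) powr (1 - Re z) * (real k + 1) powr (Re z - 1) = 1"
        by (subst powr_add[symmetric]) simp
      have "inverse (norm (pochhammer z k)) = u n * (real k + 1) powr (1 - Re z) / fact k"
        unfolding 2 using 3 by (simp add: field_simps)
      also have "\<dots> \<le> max 1 C * (real k + 1) powr (1 - Re z) / fact k"
        using 1 by (intro divide_right_mono mult_right_mono) auto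
      finally show ?thesis .
    qed simp
  qed simp
qed

lemma summable_Suc_powr:
  assumes "e < -1" shows "summable (\<lambda>k. (real k + 1) powr e)"
proof -
  have "summable (\<lambda>k. real (Suc k) powr e)"
    using assms summable_real_powr_iff[of e] by (subst summable_Suc_iff) simp
  then show ?thesis by (simp add: add_ac)
qed

section \<open>Gauss's summation theorem\<close>

definition hypergeom_coeff :: "complex \<Rightarrow> complex \<Rightarrow> complex \<Rightarrow> nat \<Rightarrow> complex" where
  "hypergeom_coeff a b c k = pochhammer a k * pochhammer b k / (pochhammer c k * fact k)"

lemma hypergeom_coeff_growth:
  assumes "c \<notin> \<int>\<^sub>\<le>\<^sub>0"
  obtains C where "C > 0" "\<And>k. norm (hypergeom_coeff a b c k) \<le> C * (real k + 1) powr (Re (a + b - c) - 1)"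
proof -
  obtain Ca where Ca: "Ca > 0" "\<And>k. norm (pochhammer a k) \<le> Ca * fact k * (real k + 1) powr (Re a - 1)"
    using pochhammer_growth_upper by blast
  obtain Cb where Cb: "Cb > 0" "\<And>k. norm (pochhammer b k) \<le> Cb * fact k * (real k + 1) powr (Re b - 1)"
    using pochhammer_growth_upper by blast
  obtain Cc where Cc: "Cc > 0" "\<And>k. inverse (norm (pochhammer c k)) \<le> Cc * (real k + 1) powr (1 - Re c) / fact k"
    using pochhammer_growth_lower[OF assms] by blast
  show ?thesis
  proof (rule that[of "Ca * Cb * Cc"])
    fix k
    have "norm (hypergeom_coeff a b c k) =
        norm (pochhammer a k) * norm (pochhammer b k) * inverse (norm (pochhammer c k)) / fact k"
      by (simp add: hypergeom_coeff_def norm_mult norm_divide field_simps)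
    also have "\<dots> \<le> (Ca * fact k * (real k + 1) powr (Re a - 1)) * (Cb * fact k * (real k + 1) powr (Re b - 1))
        * (Cc * (real k + 1) powr (1 - Re c) / fact k) / fact k"
      using Ca Cb Cc by (intro divide_right_mono mult_mono) auto
    also have "\<dots> = Ca * Cb * Cc * ((real k + 1) powr (Re a - 1) * (real k + 1) powr (Re b - 1) * (real k + 1) powr (1 - Re c))"
      by (simp add: field_simps)
    also have "(real k + 1) powr (Re a - 1) * (real k + 1) powr (Re b - 1) * (real k + 1) powr (1 - Re c)
        = (real k + 1) powr (Re (a + b - c) - 1)"
      by (simp add: powr_add[symmetric] algebra_simps)
    finally show "norm (hypergeom_coeff a b c k) \<le> Ca * Cb * Cc * (real k + 1) powr (Re (a + b - c) - 1)" .
  qed (use Ca Cb Cc in auto)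
qed

lemma summable_hypergeom_coeff:
  assumes "c \<notin> \<int>\<^sub>\<le>\<^sub>0" "Re (c - a - b) > 0"
  shows "summable (\<lambda>k. norm (hypergeom_coeff a b c k))"
proof -
  obtain C where C: "C > 0" "\<And>k. norm (hypergeom_coeff a b c k) \<le> C * (real k + 1) powr (Re (a + b - c) - 1)"
    using hypergeom_coeff_growth[OF assms(1)] by blast
  show ?thesis
  proof (rule summable_comparison_test')
    show "summable (\<lambda>k. C * (real k + 1) powr (Re (a + b - c) - 1))"
      using assms(2) by (intro summable_mult summable_Suc_powr) simp
  qed (use C in auto)
qed

lemma Re_pos_notin_nonpos_Ints: "Re z > 0 \<Longrightarrow> z \<notin> \<int>\<^sub>\<le>\<^sub>0"
  by (auto elim!: nonpos_Ints_cases)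

text \<open>
  The contiguous relation between \<open>c\<close> and \<open>c + 1\<close> for the series at \<open>1\<close>, with the difference of the
  two sides written as a telescoping term.
\<close>

lemma hypergeom_coeff_contiguous:
  assumes "c \<notin> \<int>\<^sub>\<le>\<^sub>0"
  shows "c * (c - a - b) * hypergeom_coeff a b c k - (c - a) * (c - b) * hypergeom_coeff a b (c + 1) k =
    c * (of_nat k * hypergeom_coeff a b c k - of_nat (Suc k) * hypergeom_coeff a b c (Suc k))"
proof -
  have nz: "c + of_nat k \<noteq> 0" for k
    using assms plus_of_nat_eq_0_imp by blast
  have c0: "c \<noteq> 0" using nz[of 0] by simp
  have c1: "pochhammer (c + 1) k \<noteq> 0"
    using nz[of "Suc _"] by (auto simp: pochhammer_eq_0_iff add_ac eq_neg_iff_add_eq_0)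
  define P where "P = hypergeom_coeff a b c k"
  have pk: "pochhammer c k \<noteq> 0"
    using assms pochhammer_eq_0_imp_nonpos_Int by blast
  have "pochhammer (c + 1) k * c = pochhammer c k * (c + of_nat k)"
    using pochhammer_rec[of c k] pochhammer_rec'[of c k] by (simp add: mult_ac)
  then have "pochhammer (c + 1) k = pochhammer c k * (c + of_nat k) / c"
    using c0 by (simp add: field_simps)
  then have 1: "hypergeom_coeff a b (c + 1) k = P * c / (c + of_nat k)"
    using c0 pk nz[of k] c1
    by (auto simp add: P_def hypergeom_coeff_def divide_simps mult_ac)
  have 2: "of_nat (Suc k) * hypergeom_coeff a b c (Suc k) = P * ((a + of_nat k) * (b + of_nat k)) / (c + of_nat k)"
  proof -
    have "of_nat (Suc k) / (fact (Suc k) :: complex) = 1 / fact k"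
      by (simp add: fact_Suc del: of_nat_Suc)
    then show ?thesis
      using pk nz[of k] unfolding P_def hypergeom_coeff_def pochhammer_rec' 
      by (simp add: mult_ac divide_simps del: of_nat_Suc fact_Suc)
  qed
  show ?thesis unfolding 1 2 unfolding P_def[symmetric] using nz[of k]
    by (simp add: field_simps)
qed

text \<open>
  The telescoping sum contributes nothing since \<open>k * hypergeom_coeff a b c k\<close> tends to \<open>0\<close>, which is what
  \<open>Re (c - a - b) > 0\<close> means for the growth of the coefficients.
\<close>

lemma hypergeom_contiguous_at_1:
  assumes "Re c > 0" "Re (c - a - b) > 0"
  shows "c * (c - a - b) * suminf (hypergeom_coeff a b c) =
         (c - a) * (c - b) * suminf (hypergeom_coeff a b (c + 1))"
proof -
  define A where "A = hypergeom_coeff a b c"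
  define B where "B = hypergeom_coeff a b (c + 1)"
  have c: "c \<notin> \<int>\<^sub>\<le>\<^sub>0" "c + 1 \<notin> \<int>\<^sub>\<le>\<^sub>0"
    using assms by (auto intro!: Re_pos_notin_nonpos_Ints)
  have sA: "summable A" and sB: "summable B"
    unfolding A_def B_def using c assms by (auto intro!: summable_norm_cancel[OF summable_hypergeom_coeff])
  obtain C where C: "C > 0" "\<And>k. norm (A k) \<le> C * (real k + 1) powr (Re (a + b - c) - 1)"
    using hypergeom_coeff_growth[OF c(1)] unfolding A_def by blast
  have lim: "(\<lambda>k. of_nat k * A k) \<longlonglongrightarrow> 0"
  proof (rule Lim_null_comparison)
    show "(\<lambda>k. C * (real k * (real k + 1) powr (- Re (c - a - b) - 1))) \<longlonglongrightarrow> 0"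
      using assms(2) by (intro tendsto_mult_right_zero) real_asymp
    have "norm (of_nat k * A k) \<le> C * (real k * (real k + 1) powr (- Re (c - a - b) - 1))" for k
    proof -
      have "Re (a + b - c) - 1 = - Re (c - a - b) - 1" by simp
      then have "norm (A k) \<le> C * (real k + 1) powr (- Re (c - a - b) - 1)"
        using C(2)[of k] by metis
      then have "real k * norm (A k) \<le> real k * (C * (real k + 1) powr (- Re (c - a - b) - 1))"
        by (rule mult_left_mono) simp
      then show ?thesis by (simp only: norm_mult norm_of_nat) (simp only: mult_ac)
    qed
    then show "\<forall>\<^sub>F k in sequentially. norm (of_nat k * A k) \<le> C * (real k * (real k + 1) powr (- Re (c - a - b) - 1))"
      by simp
  qed
  have "(\<lambda>k. of_nat k * A k - of_nat (Suc k) * A (Suc k)) sums (of_nat 0 * A 0 - 0)"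
    using telescope_sums'[OF lim] .
  then have "(\<lambda>k. c * (of_nat k * A k - of_nat (Suc k) * A (Suc k))) sums (c * 0)"
    by (intro sums_mult) simp
  moreover have "(\<lambda>k. c * (c - a - b) * A k - (c - a) * (c - b) * B k) sums
      (c * (c - a - b) * suminf A - (c - a) * (c - b) * suminf B)"
    using sA sB by (intro sums_diff sums_mult summable_sums)
  ultimately have "c * 0 = c * (c - a - b) * suminf A - (c - a) * (c - b) * suminf B"
    unfolding A_def B_def hypergeom_coeff_contiguous[OF c(1)] by (rule sums_unique2)
  then show ?thesis unfolding A_def B_def by simp
qed

lemma norm_pochhammer_ge:
  assumes "Re z \<ge> x" "x > 0"
  shows "pochhammer x k \<le> norm (pochhammer z k)"
proof -
  have "(\<Prod>i<k. x + real i) \<le> (\<Prod>i<k. norm (z + of_nat i))"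
  proof (rule prod_mono)
    fix i 
    have "x + real i \<le> Re (z + of_nat i)" using assms by simp
    also have "\<dots> \<le> norm (z + of_nat i)" by (rule complex_Re_le_cmod)
    finally show "0 \<le> x + real i \<and> x + real i \<le> norm (z + of_nat i)" using assms by simp
  qed
  then show ?thesis by (simp add: pochhammer_prod prod_norm atLeast0LessThan)
qed

text \<open>
  Iterating the contiguous relation moves \<open>c\<close> to \<open>c + n\<close>, where the series tends to its first term \<open>1\<close>.
  The accumulated Pochhammer symbols form Euler's products for the four Gamma values: the powers of
  \<open>n\<close> in them cancel because \<open>c + (c - a - b) = (c - a) + (c - b)\<close>.
\<close>

theorem Gauss_hypergeom:
  assumes c: "Re c > 0" and cab: "Re (c - a - b) > 0"
  shows "hypergeom_coeff a b c sums (Gamma c * Gamma (c - a - b) * rGamma (c - a) * rGamma (c - b))"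
proof -
  define S where "S = (\<lambda>c. suminf (hypergeom_coeff a b c))"
  have rec: "S c * (pochhammer c n * pochhammer (c - a - b) n) =
      pochhammer (c - a) n * pochhammer (c - b) n * S (c + of_nat n)" for n
  proof (induction n)
    case (Suc n)
    have "(c + of_nat n) * (c + of_nat n - a - b) * S (c + of_nat n) =
         (c + of_nat n - a) * (c + of_nat n - b) * S (c + of_nat n + 1)"
      unfolding S_def using c cab by (intro hypergeom_contiguous_at_1) auto
    then show ?case using Suc unfolding pochhammer_rec' by (simp add: algebra_simps) algebra
  qed simp
  have lim1: "(\<lambda>n. S (c + of_nat n)) \<longlonglongrightarrow> 1"
  proof -
    have dom: "norm (hypergeom_coeff a b (c + of_nat n) k) \<le> norm (hypergeom_coeff a b (of_real (Re c)) k)" for n k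
    proof -
      have "pochhammer (Re c) k \<le> norm (pochhammer (c + of_nat n) k)"
        by (rule norm_pochhammer_ge) (use c in auto)
      moreover have "pochhammer (Re c) k > 0" using c by (intro pochhammer_pos)
      moreover have "norm (pochhammer (complex_of_real (Re c)) k) = pochhammer (Re c) k"
        using c by (simp add: pochhammer_of_real pochhammer_nonneg)
      ultimately show ?thesis
        unfolding hypergeom_coeff_def norm_divide norm_mult
        by (intro divide_left_mono mult_right_mono mult_pos_pos mult_nonneg_nonneg) auto
    qed
    have "(\<lambda>n. \<Sum>k. hypergeom_coeff a b (c + of_nat n) k) \<longlonglongrightarrow> (\<Sum>k. if k = 0 then 1 else 0 :: complex)"
    proof (rule conjunct2[OF conjunct2[OF tannerys_theorem[where M = "\<lambda>k. norm (hypergeom_coeff a b (of_real (Re c)) k)"]]])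
      show "\<forall>\<^sub>F (k, n) in at_top \<times>\<^sub>F sequentially.
          norm (hypergeom_coeff a b (c + of_nat n) k) \<le> norm (hypergeom_coeff a b (of_real (Re c)) k)"
        using dom by (simp add: case_prod_unfold)
      show "summable (\<lambda>k. norm (hypergeom_coeff a b (of_real (Re c)) k))"
        using c cab by (intro summable_hypergeom_coeff Re_pos_notin_nonpos_Ints) auto
      show "(\<lambda>n. hypergeom_coeff a b (c + of_nat n) k) \<longlonglongrightarrow> (if k = 0 then 1 else 0)" for k
      proof (cases k)
        case (Suc j)
        have "(\<lambda>n. hypergeom_coeff a b (c + of_nat n) k) \<longlonglongrightarrow> 0"
        proof (rule Lim_null_comparison)
          define M where "M = norm (pochhammer a k * pochhammer b k) / (pochhammer (Re c + 1) j * fact k)"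
          show "(\<lambda>n. M / (Re c + real n)) \<longlonglongrightarrow> 0" by real_asymp
          have "norm (hypergeom_coeff a b (c + of_nat n) k) \<le> M / (Re c + real n)" for n
          proof -
            have 1: "(Re c + real n) * pochhammer (Re c + 1) j \<le> norm (pochhammer (c + of_nat n) k)"
              unfolding Suc pochhammer_rec norm_mult
            proof (intro mult_mono)
              show "Re c + real n \<le> norm (c + of_nat n)"
                using complex_Re_le_cmod[of "c + of_nat n"] by simp
              show "pochhammer (Re c + 1) j \<le> norm (pochhammer (c + of_nat n + 1) j)"
                by (rule norm_pochhammer_ge) (use c in auto)
            qed (use c in \<open>auto intro!: pochhammer_nonneg\<close>)
            have p: "pochhammer (Re c + 1) j > 0" using c by (intro pochhammer_pos) simp
            have "norm (hypergeom_coeff a b (c + of_nat n) k) = norm (pochhammer a k * pochhammer b k) /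
               (norm (pochhammer (c + of_nat n) k) * fact k)"
              by (simp add: hypergeom_coeff_def norm_divide norm_mult)
            also have "\<dots> \<le> norm (pochhammer a k * pochhammer b k) / ((Re c + real n) * pochhammer (Re c + 1) j * fact k)"
              using 1 p c less_le_trans[OF mult_pos_pos[OF _ p] 1]
              by (intro divide_left_mono mult_right_mono mult_pos_pos) auto
            also have "\<dots> = M / (Re c + real n)" by (simp add: M_def field_simps)
            finally show ?thesis .
          qed
          then show "\<forall>\<^sub>F n in sequentially. norm (hypergeom_coeff a b (c + of_nat n) k) \<le> M / (Re c + real n)"
            by simp
        qed
        then show ?thesis using Suc by simp
      qed (simp add: hypergeom_coeff_def)
    qed simp
    also have "(\<Sum>k. if k = 0 then 1 else 0 :: complex) = 1"
      using suminf_finite[of "{0}" "\<lambda>k. if k = 0 then 1 else 0 :: complex"] by simp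
    finally show ?thesis by (simp add: S_def)
  qed
  have "(\<lambda>n. S c * (rGamma_series c n * rGamma_series (c - a - b) n)) \<longlonglongrightarrow> S c * (rGamma c * rGamma (c - a - b))"
    by (intro tendsto_intros)
  moreover have "(\<lambda>n. S c * (rGamma_series c n * rGamma_series (c - a - b) n)) =
      (\<lambda>n. rGamma_series (c - a) n * rGamma_series (c - b) n * S (c + of_nat (n + 1)))"
  proof
    fix n
    define L where "L = complex_of_real (ln (real n))"
    have "exp (c * L) * exp ((c - a - b) * L) = exp ((c - a) * L) * exp ((c - b) * L)"
      by (simp add: exp_add[symmetric] algebra_simps)
    then have e: "(fact n * exp (c * L)) * (fact n * exp ((c - a - b) * L)) =
        (fact n * exp ((c - a) * L)) * (fact n * exp ((c - b) * L))" by (simp add: mult_ac)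
    have "S c * (rGamma_series c n * rGamma_series (c - a - b) n) =
       (S c * (pochhammer c (n+1) * pochhammer (c - a - b) (n+1))) / ((fact n * exp (c * L)) * (fact n * exp ((c - a - b) * L)))"
      unfolding rGamma_series_def L_def by simp
    also have "\<dots> = rGamma_series (c - a) n * rGamma_series (c - b) n * S (c + of_nat (n + 1))"
      unfolding rec e unfolding rGamma_series_def L_def by simp
    finally show "S c * (rGamma_series c n * rGamma_series (c - a - b) n) =
       rGamma_series (c - a) n * rGamma_series (c - b) n * S (c + of_nat (n + 1))" .
  qed
  moreover have "(\<lambda>n. rGamma_series (c - a) n * rGamma_series (c - b) n * S (c + of_nat (n + 1))) \<longlonglongrightarrow>
     rGamma (c - a) * rGamma (c - b) * 1"
    using LIMSEQ_ignore_initial_segment[OF lim1, of 1] by (intro tendsto_mult rGamma_series_LIMSEQ)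
  ultimately have "S c * (rGamma c * rGamma (c - a - b)) = rGamma (c - a) * rGamma (c - b) * 1"
    using LIMSEQ_unique by metis
  moreover have "rGamma c \<noteq> 0" "rGamma (c - a - b) \<noteq> 0"
    using Re_pos_notin_nonpos_Ints[OF c] Re_pos_notin_nonpos_Ints[OF cab] by (auto simp: rGamma_eq_zero_iff)
  ultimately have "S c = Gamma c * Gamma (c - a - b) * rGamma (c - a) * rGamma (c - b)"
    by (simp add: Gamma_def field_simps)
  moreover have "summable (hypergeom_coeff a b c)"
    using Re_pos_notin_nonpos_Ints[OF c] cab by (intro summable_norm_cancel[OF summable_hypergeom_coeff])
  ultimately show ?thesis unfolding S_def by (simp add: sums_iff)
qed

section \<open>The complex Beta integral\<close>

lemma set_integral_sums:
  fixes \<phi> :: "nat \<Rightarrow> 'a \<Rightarrow> 'b :: {banach, second_countable_topology}"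
  assumes int: "\<And>k. set_integrable M S (\<phi> k)"
    and sm: "\<And>s. s \<in> S \<Longrightarrow> summable (\<lambda>k. norm (\<phi> k s))"
    and bd: "\<And>k. (LINT s:S|M. norm (\<phi> k s)) \<le> b k" "summable b"
    and F: "\<And>s. s \<in> S \<Longrightarrow> (\<lambda>k. \<phi> k s) sums F s"
  shows "set_integrable M S F" "(\<lambda>k. LINT s:S|M. \<phi> k s) sums (LINT s:S|M. F s)"
proof -
  let ?f = "\<lambda>k s. indicator S s *\<^sub>R \<phi> k s"
  have 1: "integrable M (?f k)" for k using int[of k] by (simp add: set_integrable_def)
  have 2: "AE s in M. summable (\<lambda>k. norm (?f k s))"
    by (intro AE_I2) (auto simp: indicator_def sm)
  have 3: "summable (\<lambda>k. (\<integral>s. norm (?f k s) \<partial>M))"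
  proof (rule summable_comparison_test'[OF bd(2)])
    fix k
    have "(\<integral>s. norm (?f k s) \<partial>M) = (LINT s:S|M. norm (\<phi> k s))"
      unfolding set_lebesgue_integral_def by (intro Bochner_Integration.integral_cong) (auto simp: indicator_def)
    moreover have "0 \<le> (\<integral>s. norm (?f k s) \<partial>M)" by (intro integral_nonneg_AE AE_I2 norm_ge_zero)
    ultimately show "norm (\<integral>s. norm (?f k s) \<partial>M) \<le> b k" using bd(1)[of k]
      by (simp only: real_norm_def abs_of_nonneg)
  qed
  have eq: "(\<lambda>s. \<Sum>k. ?f k s) = (\<lambda>s. indicator S s *\<^sub>R F s)"
  proof
    fix s show "(\<Sum>k. ?f k s) = indicator S s *\<^sub>R F s"
      using F[of s] by (cases "s \<in> S") (auto simp: sums_iff)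
  qed
  show "set_integrable M S F" 
    using integrable_suminf[OF 1 2 3] unfolding eq set_integrable_def .
  show "(\<lambda>k. LINT s:S|M. \<phi> k s) sums (LINT s:S|M. F s)"
    using sums_integral[OF 1 2 3] unfolding eq set_lebesgue_integral_def .
qed

lemma norm_of_real_powr:
  assumes "x \<ge> 0" shows "norm (of_real x powr z :: complex) = x powr Re z"
  using assms by (subst norm_powr_real_powr) auto

text \<open>
  The first parameter is the exponent at the end point \<open>1\<close>, where the Saigo kernel is singular; the second
  one, attached to the end point \<open>0\<close>, is the Mellin variable.
\<close>

definition beta_kernel :: "complex \<Rightarrow> complex \<Rightarrow> real \<Rightarrow> complex" where
  "beta_kernel c r s = of_real (1 - s) powr (c - 1) * of_real s powr (r - 1)"

lemma norm_beta_kernel: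
  "s \<in> {0<..<1} \<Longrightarrow> norm (beta_kernel c r s) = s powr (Re r - 1) * (1 - s) powr (Re c - 1)"
  unfolding beta_kernel_def norm_mult by (subst (1 2) norm_of_real_powr) auto

lemma continuous_on_beta_kernel: "continuous_on {0<..<1} (beta_kernel c r)"
  unfolding beta_kernel_def
  by (intro continuous_intros) (auto simp: complex_nonpos_Reals_iff)

lemma set_integral_Beta_real:
  assumes "R > 0" "P > (0::real)"
  shows "set_integrable lborel {0<..<1} (\<lambda>s. s powr (R - 1) * (1 - s) powr (P - 1))"
    and "(LINT s:{0<..<1}|lborel. s powr (R - 1) * (1 - s) powr (P - 1)) = Beta R P"
proof -
  show i: "set_integrable lborel {0<..<1} (\<lambda>s. s powr (R - 1) * (1 - s) powr (P - 1))"
    by (rule set_integrable_subset[OF integrable_Beta[OF assms]]) auto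
  have "((\<lambda>s. s powr (R - 1) * (1 - s) powr (P - 1)) has_integral Beta R P) {0<..<1}"
    using has_integral_Beta_real[OF assms] by (simp add: has_integral_Icc_iff_Ioo)
  then show "(LINT s:{0<..<1}|lborel. s powr (R - 1) * (1 - s) powr (P - 1)) = Beta R P"
    using set_borel_integral_eq_integral(2)[OF i] by (simp add: has_integral_iff)
qed

lemma beta_kernel_integrable:
  assumes "Re c > 0" "Re r > 0"
  shows "set_integrable lborel {0<..<1} (beta_kernel c r)"
    and "(LINT s:{0<..<1}|lborel. norm (beta_kernel c r s)) = Beta (Re r) (Re c)"
proof -
  have m: "set_borel_measurable lborel {0<..<1} (beta_kernel c r)"
    unfolding set_borel_measurable_def
    using borel_measurable_continuous_on_indicator[OF _ continuous_on_beta_kernel] by auto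
  show "set_integrable lborel {0<..<1} (beta_kernel c r)"
    by (rule set_integrable_bound[OF set_integral_Beta_real(1)[OF assms(2,1)] m])
       (auto simp: norm_beta_kernel)
  have "(LINT s:{0<..<1}|lborel. norm (beta_kernel c r s)) =
     (LINT s:{0<..<1}|lborel. s powr (Re r - 1) * (1 - s) powr (Re c - 1))"
    by (rule set_lebesgue_integral_cong) (auto simp: norm_beta_kernel)
  then show "(LINT s:{0<..<1}|lborel. norm (beta_kernel c r s)) = Beta (Re r) (Re c)"
    using set_integral_Beta_real(2)[OF assms(2,1)] by simp
qed

lemma has_vector_derivative_of_real_powr:
  assumes "s > 0"
  shows "((\<lambda>s. of_real s powr z :: complex) has_vector_derivative (z * of_real s powr (z - 1))) (at s)"
proof -
  have "((\<lambda>w. w powr z) has_field_derivative (z * of_real s powr (z - 1))) (at (complex_of_real s))"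
    using assms by (intro has_field_derivative_powr) (auto simp: complex_nonpos_Reals_iff)
  from field_vector_diff_chain_at[OF has_vector_derivative_of_real[OF DERIV_ident] this]
  show ?thesis by (simp add: o_def)
qed

lemma continuous_on_of_real_powr:
  assumes "Re z > 0" shows "continuous_on {0..} (\<lambda>s. of_real s powr z :: complex)"
  unfolding continuous_on_eq_continuous_within
proof
  fix s :: real assume s: "s \<in> {0..}"
  show "continuous (at s within {0..}) (\<lambda>s. of_real s powr z :: complex)"
  proof (cases "s = 0")
    case True
    have "((\<lambda>s. of_real s powr z :: complex) \<longlongrightarrow> 0) (at 0 within {0..})"
    proof (rule Lim_null_comparison)
      show "((\<lambda>s. s powr Re z) \<longlongrightarrow> 0) (at 0 within {0..})"
        using assms by (intro tendsto_eq_intros) (auto simp: eventually_at_filter)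
      show "\<forall>\<^sub>F s in at 0 within {0..}. norm (of_real s powr z :: complex) \<le> s powr Re z"
        by (auto simp: eventually_at_filter norm_of_real_powr)
    qed
    then show ?thesis using True assms by (simp add: continuous_within)
  next
    case False
    with s have "s > 0" by auto
    from has_vector_derivative_continuous[OF has_vector_derivative_of_real_powr[OF this, of z]]
    show ?thesis by (rule continuous_at_imp_continuous_within)
  qed
qed

lemma has_vector_derivative_one_minus_powr:
  assumes "s < 1"
  shows "((\<lambda>s. of_real (1 - s) powr z :: complex) has_vector_derivative (- z * of_real (1 - s) powr (z - 1))) (at s)"
proof -
  have "((\<lambda>s. 1 - s) has_vector_derivative (0 - 1)) (at s)"
    by (intro derivative_intros)
  from vector_diff_chain_at[OF this has_vector_derivative_of_real_powr[of "1 - s" z]] assms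
  show ?thesis by (simp add: o_def)
qed

lemma set_integral_powr:
  assumes "Re z > 0"
  shows "set_integrable lborel {0<..<1} (\<lambda>s. of_real s powr (z - 1) :: complex)"
    and "(LINT s:{0<..<1}|lborel. of_real s powr (z - 1)) = 1 / z"
    and "(LINT s:{0<..<1}|lborel. norm (of_real s powr (z - 1) :: complex)) = 1 / Re z"
proof -
  have [simp]: "z \<noteq> 0" using assms by auto
  have eq: "of_real s powr (z - 1) = beta_kernel 1 z s" if "s \<in> {0<..<1}" for s
    using that by (auto simp: beta_kernel_def)
  have i: "set_integrable lborel {0<..<1} (beta_kernel 1 z)"
    using assms by (intro beta_kernel_integrable) auto
  then show j: "set_integrable lborel {0<..<1} (\<lambda>s. of_real s powr (z - 1) :: complex)"
    by (subst set_integrable_cong[OF refl refl eq]) auto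
  have "((\<lambda>s. of_real s powr (z - 1)) has_integral (of_real 1 powr z / z - of_real 0 powr z / z)) {0..1}"
  proof (rule fundamental_theorem_of_calculus_interior)
    show "continuous_on {0..1} (\<lambda>s. complex_of_real s powr z / z)"
      using assms by (intro continuous_intros continuous_on_subset[OF continuous_on_of_real_powr]) auto
    fix s :: real assume "s \<in> {0<..<1}"
    then have "((\<lambda>s. of_real s powr z * (1 / z) :: complex) has_vector_derivative (z * of_real s powr (z - 1) * (1 / z))) (at s)"
      by (intro has_vector_derivative_mult_left has_vector_derivative_of_real_powr) auto
    then show "((\<lambda>s. of_real s powr z / z :: complex) has_vector_derivative (of_real s powr (z - 1))) (at s)"
      by simp
  qed simp
  then have "((\<lambda>s. of_real s powr (z - 1)) has_integral 1 / z) {0<..<1}"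
    by (simp add: has_integral_Icc_iff_Ioo)
  then show "(LINT s:{0<..<1}|lborel. of_real s powr (z - 1)) = 1 / z"
    using set_borel_integral_eq_integral(2)[OF j] by (simp add: has_integral_iff)
  have "(LINT s:{0<..<1}|lborel. norm (of_real s powr (z - 1) :: complex)) =
     (LINT s:{0<..<1}|lborel. norm (beta_kernel 1 z s))"
    by (rule set_lebesgue_integral_cong) (auto simp: eq)
  also have "\<dots> = Beta (Re z) 1" using assms by (subst beta_kernel_integrable) auto
  also have "\<dots> = 1 / Re z"
  proof -
    have "Re z \<notin> \<int>\<^sub>\<le>\<^sub>0" using assms by (auto elim!: nonpos_Ints_cases)
    moreover have "Gamma (Re z) \<noteq> 0" using Gamma_real_pos[OF assms] by simp
    ultimately show ?thesis
      using assms Gamma_plus1[of "Re z"] by (auto simp: Beta_def add_ac)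
  qed
  finally show "(LINT s:{0<..<1}|lborel. norm (of_real s powr (z - 1) :: complex)) = 1 / Re z" .
qed

text \<open>
  Expand \<open>(1 - s) powr (c - 1)\<close> into its binomial series and integrate termwise: the result is \<open>1 / r\<close> times the
  hypergeometric series with parameters \<open>1 - c\<close>, \<open>r\<close>, \<open>r + 1\<close> at \<open>1\<close>, to which Gauss's theorem applies.
\<close>

theorem set_integral_Beta_complex:
  assumes c: "Re c > 0" and r: "Re r > 0"
  shows "(LINT s:{0<..<1}|lborel. beta_kernel c r s) = Beta r c"
proof -
  define \<phi> where "\<phi> = (\<lambda>k s. (pochhammer (1 - c) k / fact k) * complex_of_real s powr (r + of_nat k - 1))"
  define b where "b = (\<lambda>k. norm (pochhammer (1 - c) k / fact k) / (Re r + real k))"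
  have rk: "Re (r + of_nat k) > 0" for k using r by simp
  have phi_int: "set_integrable lborel {0<..<1} (\<phi> k)" for k
    unfolding \<phi>_def by (intro set_integrable_mult_right set_integral_powr rk)
  have powr_split: "complex_of_real s powr (r + of_nat k - 1) = of_real s ^ k * of_real s powr (r - 1)"
    if "s \<in> {0<..<1}" for s k
  proof -
    have "complex_of_real s powr (r + of_nat k - 1) = of_real s powr (of_nat k + (r - 1))"
      by (simp add: algebra_simps)
    then show ?thesis using that by (simp add: powr_add powr_nat')
  qed
  have sums: "(\<lambda>k. \<phi> k s) sums beta_kernel c r s" and sm: "summable (\<lambda>k. norm (\<phi> k s))" if s: "s \<in> {0<..<1}" for s
  proof -
    have g: "((c - 1) gchoose k) * (- w) ^ k = (pochhammer (1 - c) k / fact k) * w ^ k" for k and w :: complex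
      by (simp add: gbinomial_pochhammer power_mult_distrib[symmetric])
    have binom: "(\<lambda>k. (pochhammer (1 - c) k / fact k) * w ^ k) sums (1 - w) powr (c - 1)" if "norm w < 1" for w :: complex
      using gen_binomial_complex[of "- w" "c - 1"] that unfolding g by simp
    have "(\<lambda>k. (pochhammer (1 - c) k / fact k) * of_real s ^ k * of_real s powr (r - 1)) sums
        ((1 - of_real s) powr (c - 1) * of_real s powr (r - 1))"
      using s by (intro sums_mult2 binom) auto
    then show "(\<lambda>k. \<phi> k s) sums beta_kernel c r s"
      using s by (simp add: \<phi>_def powr_split beta_kernel_def mult_ac)
    have "summable (\<lambda>k. norm ((pochhammer (1 - c) k / fact k) * of_real s ^ k))"
    proof (rule powser_insidea)
      show "summable (\<lambda>k. (pochhammer (1 - c) k / fact k) * complex_of_real ((s + 1) / 2) ^ k)"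
        using s by (intro sums_summable[OF binom]) auto
    qed (use s in \<open>auto simp del: of_real_divide of_real_add\<close>)
    then have "summable (\<lambda>k. norm ((pochhammer (1 - c) k / fact k) * of_real s ^ k) * norm (of_real s powr (r - 1) :: complex))"
      by (rule summable_mult2)
    then show "summable (\<lambda>k. norm (\<phi> k s))"
      by (simp only: \<phi>_def powr_split[OF s] norm_mult mult.assoc)
  qed
  have bd: "(LINT s:{0<..<1}|lborel. norm (\<phi> k s)) \<le> b k" for k
    using set_integral_powr(3)[OF rk[of k]] unfolding \<phi>_def b_def norm_mult by simp
  have sb: "summable b"
  proof -
    obtain C where C: "C > 0" "\<And>k. norm (pochhammer (1 - c) k) \<le> C * fact k * (real k + 1) powr (Re (1 - c) - 1)"
      using pochhammer_growth_upper by blast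
    define M where "M = max 1 (1 / Re r)"
    show ?thesis
    proof (rule summable_comparison_test')
      show "summable (\<lambda>k. C * M * (real k + 1) powr (- Re c - 1))"
        using c by (intro summable_mult summable_Suc_powr) simp
      fix k
      have "1 \<le> M * Re r" using r by (auto simp: M_def max_def field_simps)
      moreover have "real k \<le> M * real k" using mult_right_mono[of 1 M "real k"] by (auto simp: M_def)
      ultimately have "real k + 1 \<le> M * (Re r + real k)" by (simp add: algebra_simps)
      then have "1 / (Re r + real k) \<le> M / (real k + 1)"
        using rk[of k] by (simp add: field_simps)
      moreover have "norm (pochhammer (1 - c) k / fact k) \<le> C * (real k + 1) powr (- Re c)"
        using C(2)[of k] by (simp add: norm_divide field_simps)
      ultimately have "norm (pochhammer (1 - c) k / fact k) * (1 / (Re r + real k)) \<le>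
         (C * (real k + 1) powr (- Re c)) * (M / (real k + 1))"
        using r C(1) by (intro mult_mono) auto
      also have "\<dots> = C * M * ((real k + 1) powr (- Re c) / (real k + 1))"
        by simp
      also have "(real k + 1) powr (- Re c) / (real k + 1) = (real k + 1) powr (- Re c - 1)"
        by (subst powr_diff) auto
      finally show "norm (b k) \<le> C * M * (real k + 1) powr (- Re c - 1)"
        using r by (simp add: b_def)
    qed
  qed
  have I1: "(\<lambda>k. LINT s:{0<..<1}|lborel. \<phi> k s) sums (LINT s:{0<..<1}|lborel. beta_kernel c r s)"
    by (rule set_integral_sums(2)[OF phi_int sm bd sb sums])
  have val: "(LINT s:{0<..<1}|lborel. \<phi> k s) = (1 / r) * hypergeom_coeff (1 - c) r (r + 1) k" for k
  proof -
    have nz: "r + of_nat j \<noteq> 0" for j using rk[of j] by (metis less_irrefl zero_complex.simps(1))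
    have "r * pochhammer (r + 1) k = pochhammer r k * (r + of_nat k)"
      using pochhammer_rec[of r k] pochhammer_rec'[of r k] by (simp add: mult_ac)
    moreover have "pochhammer (r + 1) k \<noteq> 0"
      using nz[of "Suc _"] by (auto simp: pochhammer_eq_0_iff add_ac eq_neg_iff_add_eq_0)
    ultimately have q: "pochhammer r k / pochhammer (r + 1) k = r / (r + of_nat k)"
      using nz[of k] by (simp add: field_simps)
    have "(1 / r) * hypergeom_coeff (1 - c) r (r + 1) k =
        (pochhammer (1 - c) k / fact k) * ((1 / r) * (pochhammer r k / pochhammer (r + 1) k))"
      unfolding hypergeom_coeff_def by simp
    then have "(1 / r) * hypergeom_coeff (1 - c) r (r + 1) k = (pochhammer (1 - c) k / fact k) * (1 / (r + of_nat k))"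
      using nz[of 0] unfolding q by simp
    moreover have "(LINT s:{0<..<1}|lborel. \<phi> k s) = (pochhammer (1 - c) k / fact k) * (1 / (r + of_nat k))"
      unfolding \<phi>_def using set_integral_powr(2)[OF rk[of k]] by simp
    ultimately show ?thesis by simp
  qed
  have "hypergeom_coeff (1 - c) r (r + 1) sums
     (Gamma (r + 1) * Gamma (r + 1 - (1 - c) - r) * rGamma (r + 1 - (1 - c)) * rGamma (r + 1 - r))"
    using c r by (intro Gauss_hypergeom) auto
  then have "(\<lambda>k. (1 / r) * hypergeom_coeff (1 - c) r (r + 1) k) sums
     ((1 / r) * (Gamma (r + 1) * Gamma (r + 1 - (1 - c) - r) * rGamma (r + 1 - (1 - c)) * rGamma (r + 1 - r)))"
    by (rule sums_mult)
  with I1 have "(LINT s:{0<..<1}|lborel. beta_kernel c r s) =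
     (1 / r) * (Gamma (r + 1) * Gamma (r + 1 - (1 - c) - r) * rGamma (r + 1 - (1 - c)) * rGamma (r + 1 - r))"
    unfolding val by (rule sums_unique2)
  also have "\<dots> = Beta r c"
  proof -
    have "r \<noteq> 0" "r \<notin> \<int>\<^sub>\<le>\<^sub>0" using r Re_pos_notin_nonpos_Ints[OF r] by auto
    then show ?thesis using Gamma_plus1[of r] by (simp add: Beta_altdef algebra_simps)
  qed
  finally show ?thesis .
qed

text \<open>
  In the applications the Beta value bounds the integral of the \<open>k\<close>-th term of a hypergeometric
  series in \<open>1 - s\<close>; its decay in \<open>k\<close> makes the termwise integrals summable.
\<close>

lemma Beta_growth:
  assumes "P > 0" "R > (0::real)"
  obtains C where "C > 0" "\<And>k. Beta R (P + real k) \<le> C * (real k + 1) powr (- R)"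
proof -
  obtain C1 where C1: "C1 > 0" "\<And>k. norm (pochhammer (complex_of_real P) k) \<le> C1 * fact k * (real k + 1) powr (P - 1)"
    using pochhammer_growth_upper[of "complex_of_real P"] by auto
  have "complex_of_real (P + R) \<notin> \<int>\<^sub>\<le>\<^sub>0"
    using assms by (intro Re_pos_notin_nonpos_Ints) auto
  then obtain C2 where C2: "C2 > 0" "\<And>k. inverse (norm (pochhammer (complex_of_real (P + R)) k)) \<le> C2 * (real k + 1) powr (1 - (P + R)) / fact k"
    using pochhammer_growth_lower[of "complex_of_real (P + R)"] by auto
  define D where "D = Gamma R * Gamma P / Gamma (P + R)"
  have D: "D > 0" using assms by (simp add: D_def)
  show ?thesis
  proof (rule that[of "D * C1 * C2"])
    fix k
    have np: "P \<notin> \<int>\<^sub>\<le>\<^sub>0" "P + R \<notin> \<int>\<^sub>\<le>\<^sub>0" using assms by (auto elim!: nonpos_Ints_cases)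
    have "Gamma P > 0" "Gamma (P + R) > 0" using assms by auto
    then have "Beta R (P + real k) = D * (pochhammer P k * inverse (pochhammer (P + R) k))"
      using pochhammer_Gamma[OF np(1), of k] pochhammer_Gamma[OF np(2), of k]
      by (simp add: Beta_def D_def field_simps)
    also have "pochhammer P k * inverse (pochhammer (P + R) k) \<le>
        (C1 * fact k * (real k + 1) powr (P - 1)) * (C2 * (real k + 1) powr (1 - (P + R)) / fact k)"
    proof (rule mult_mono)
      show "pochhammer P k \<le> C1 * fact k * (real k + 1) powr (P - 1)"
        using C1(2)[of k] assms by (simp add: pochhammer_of_real pochhammer_nonneg)
      show "inverse (pochhammer (P + R) k) \<le> C2 * (real k + 1) powr (1 - (P + R)) / fact k"
        using C2(2)[of k] assms by (simp only: pochhammer_of_real norm_of_real) (simp add: pochhammer_nonneg)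
    qed (use assms C1 C2 in \<open>auto intro!: mult_nonneg_nonneg pochhammer_nonneg\<close>)
    also have "\<dots> = C1 * C2 * ((real k + 1) powr (P - 1) * (real k + 1) powr (1 - (P + R)))" by simp
    also have "(real k + 1) powr (P - 1) * (real k + 1) powr (1 - (P + R)) = (real k + 1) powr (- R)"
      by (simp add: powr_add[symmetric])
    finally show "Beta R (P + real k) \<le> D * C1 * C2 * (real k + 1) powr (- R)"
      using D by (simp add: mult_ac)
  qed (use D C1 C2 in auto)
qed

section \<open>The Mellin transform of the Saigo kernel\<close>

lemma summable_powr_times_power:
  fixes w :: real
  assumes "0 \<le> w" "w < 1"
  shows "summable (\<lambda>k. (real k + 1) powr e * w ^ k)"
proof (cases "w = 0")
  case True
  then show ?thesis by (intro summable_finite[of "{0}"]) auto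
next
  case False
  define d where "d = - ln w"
  have d: "d > 0" using assms False by (simp add: d_def)
  have w: "w ^ k = exp (- d * real k)" for k
    using assms False by (simp add: d_def exp_of_nat2_mult)
  have "(\<lambda>k. (real k + 1) powr e * exp (- d * real k)) \<in> O(\<lambda>k. real k powr (-2))"
    using d by real_asymp
  moreover have "summable (\<lambda>k. norm (real k powr (-2)))"
    by (simp add: summable_real_powr_iff)
  ultimately have "summable (\<lambda>k. (real k + 1) powr e * exp (- d * real k))"
    by (rule summable_comparison_test_bigo[rotated])
  then show ?thesis by (simp add: w)
qed

lemma summable_hypergeom_powser:
  assumes "c \<notin> \<int>\<^sub>\<le>\<^sub>0" "norm w < 1"
  shows "summable (\<lambda>k. norm (hypergeom_coeff a b c k * w ^ k))"
proof -
  obtain C where C: "C > 0" "\<And>k. norm (hypergeom_coeff a b c k) \<le> C * (real k + 1) powr (Re (a + b - c) - 1)"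
    using hypergeom_coeff_growth[OF assms(1)] by blast
  show ?thesis
  proof (rule summable_comparison_test')
    show "summable (\<lambda>k. C * ((real k + 1) powr (Re (a + b - c) - 1) * norm w ^ k))"
      using assms by (intro summable_mult summable_powr_times_power) auto
    show "norm (norm (hypergeom_coeff a b c k * w ^ k)) \<le> C * ((real k + 1) powr (Re (a + b - c) - 1) * norm w ^ k)" for k
      using mult_right_mono[OF C(2)[of k], of "norm w ^ k"] by (simp add: norm_mult norm_power mult_ac)
  qed
qed

lemma hypergeom_2F1_sums:
  assumes "c \<notin> \<int>\<^sub>\<le>\<^sub>0" "norm w < 1"
  shows "(\<lambda>k. hypergeom_coeff a b c k * w ^ k) sums hypergeom_2F1 a b c w"
  unfolding hypergeom_2F1_eq_suminf hypergeom_coeff_def[symmetric]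
  by (intro summable_sums summable_norm_cancel[OF summable_hypergeom_powser] assms)

lemma hypergeom_2F1_holomorphic:
  assumes "c \<notin> \<int>\<^sub>\<le>\<^sub>0"
  shows "hypergeom_2F1 a b c holomorphic_on ball 0 1"
  by (rule power_series_holomorphic[where a = "hypergeom_coeff a b c"])
     (use hypergeom_2F1_sums[OF assms] in auto)

text \<open>
  The kernel of the Saigo integral for \<open>x = 1\<close>; other values of \<open>x\<close> are reduced to it by scaling.
\<close>

definition saigo_kernel :: "complex \<Rightarrow> complex \<Rightarrow> complex \<Rightarrow> real \<Rightarrow> complex" where
  "saigo_kernel a b c s = of_real (1 - s) powr (c - 1) * hypergeom_2F1 a b c (1 - of_real s)"

lemma beta_kernel_shift:
  assumes "s \<in> {0<..<1}"
  shows "beta_kernel (c + of_nat k) r s = (1 - of_real s) ^ k * beta_kernel c r s"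
proof -
  have "complex_of_real (1 - s) powr (c + of_nat k - 1) = of_real (1 - s) powr (of_nat k + (c - 1))"
    by (simp add: algebra_simps)
  also have "\<dots> = (1 - of_real s) ^ k * of_real (1 - s) powr (c - 1)"
    using assms by (simp add: powr_add powr_nat')
  finally show ?thesis by (simp add: beta_kernel_def)
qed

lemma saigo_kernel_sums:
  assumes "Re c > 0" "s \<in> {0<..<1}"
  shows "(\<lambda>k. hypergeom_coeff a b c k * beta_kernel (c + of_nat k) r s) sums
            (saigo_kernel a b c s * of_real s powr (r - 1))"
    and "summable (\<lambda>k. norm (hypergeom_coeff a b c k * beta_kernel (c + of_nat k) r s))"
proof -
  have c: "c \<notin> \<int>\<^sub>\<le>\<^sub>0" using assms by (intro Re_pos_notin_nonpos_Ints)
  have w: "norm (1 - complex_of_real s) < 1"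
  proof -
    have "norm (1 - complex_of_real s) = norm (complex_of_real (1 - s))"
      by (simp only: of_real_diff of_real_1)
    then show ?thesis using assms by (simp only: norm_of_real) auto
  qed
  have "(\<lambda>k. hypergeom_coeff a b c k * (1 - of_real s) ^ k * beta_kernel c r s) sums
      (hypergeom_2F1 a b c (1 - of_real s) * beta_kernel c r s)"
    by (intro sums_mult2 hypergeom_2F1_sums c w)
  then show "(\<lambda>k. hypergeom_coeff a b c k * beta_kernel (c + of_nat k) r s) sums
            (saigo_kernel a b c s * of_real s powr (r - 1))"
    by (simp only: beta_kernel_shift[OF assms(2)] mult.assoc)
       (simp add: saigo_kernel_def beta_kernel_def mult_ac)
  have "summable (\<lambda>k. norm (hypergeom_coeff a b c k * (1 - of_real s) ^ k) * norm (beta_kernel c r s))"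
    by (intro summable_mult2 summable_hypergeom_powser c w)
  then show "summable (\<lambda>k. norm (hypergeom_coeff a b c k * beta_kernel (c + of_nat k) r s))"
    by (simp only: beta_kernel_shift[OF assms(2)] norm_mult mult.assoc)
qed

lemma summable_hypergeom_Beta:
  assumes "Re c > 0" "R > 0" "R + Re (c - a - b) > 0"
  shows "summable (\<lambda>k. norm (hypergeom_coeff a b c k) * Beta R (Re c + real k))"
proof -
  have c: "c \<notin> \<int>\<^sub>\<le>\<^sub>0" using assms by (intro Re_pos_notin_nonpos_Ints)
  obtain C where C: "C > 0" "\<And>k. norm (hypergeom_coeff a b c k) \<le> C * (real k + 1) powr (Re (a + b - c) - 1)"
    using hypergeom_coeff_growth[OF c] by blast
  obtain D where D: "D > 0" "\<And>k. Beta R (Re c + real k) \<le> D * (real k + 1) powr (- R)"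
    using Beta_growth[OF assms(1,2)] by blast
  show ?thesis
  proof (rule summable_comparison_test')
    show "summable (\<lambda>k. (C * D) * (real k + 1) powr (Re (a + b - c) - 1 - R))"
      using assms by (intro summable_mult summable_Suc_powr) simp
    fix k
    have B: "Beta R (Re c + real k) \<ge> 0" using assms by (auto simp: Beta_def)
    have "norm (hypergeom_coeff a b c k) * Beta R (Re c + real k) \<le>
       (C * (real k + 1) powr (Re (a + b - c) - 1)) * (D * (real k + 1) powr (- R))"
      using C D B by (intro mult_mono) auto
    also have "\<dots> = (C * D) * ((real k + 1) powr (Re (a + b - c) - 1) * (real k + 1) powr (- R))"
      by simp
    also have "(real k + 1) powr (Re (a + b - c) - 1) * (real k + 1) powr (- R) = (real k + 1) powr (Re (a + b - c) - 1 - R)"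
      by (subst powr_add[symmetric]) simp
    finally show "norm (norm (hypergeom_coeff a b c k) * Beta R (Re c + real k)) \<le> (C * D) * (real k + 1) powr (Re (a + b - c) - 1 - R)"
      using B by (simp add: abs_mult)
  qed
qed

lemma set_integral_subset_le:
  fixes g :: "'a \<Rightarrow> real"
  assumes "set_integrable M B g" "A \<in> sets M" "A \<subseteq> B" "\<And>x. x \<in> B \<Longrightarrow> g x \<ge> 0"
  shows "(LINT x:A|M. g x) \<le> (LINT x:B|M. g x)"
  using set_integrable_subset[OF assms(1-3)] assms unfolding set_lebesgue_integral_def set_integrable_def
  by (intro integral_mono) (auto simp: indicator_def)

text \<open>
  The truncation at \<open>t\<close> is needed for the primitive \<open>\<Phi>\<close>. Absolute convergence near \<open>0\<close>, where the
  hypergeometric function may blow up like \<open>s powr (c - a - b)\<close>, is encoded in the summability of the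
  Beta values.
\<close>

lemma saigo_kernel_termwise:
  assumes c: "Re c > 0" and r: "Re r > 0" and s: "Re (r + c - a - b) > 0" and t: "t \<in> {0..1}"
  shows "set_integrable lborel {0<..<t} (\<lambda>s. saigo_kernel a b c s * of_real s powr (r - 1))"
    and "(\<lambda>k. hypergeom_coeff a b c k * (LINT s:{0<..<t}|lborel. beta_kernel (c + of_nat k) r s)) sums
         (LINT s:{0<..<t}|lborel. saigo_kernel a b c s * of_real s powr (r - 1))"
proof -
  define \<phi> where "\<phi> = (\<lambda>k s. hypergeom_coeff a b c k * beta_kernel (c + of_nat k) r s)"
  define b' where "b' = (\<lambda>k. norm (hypergeom_coeff a b c k) * Beta (Re r) (Re c + real k))"
  have ck: "Re (c + of_nat k) > 0" for k using c by simp
  have sub: "{0<..<t} \<subseteq> {0<..<1}" using t by auto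
  have i1: "set_integrable lborel {0<..<1} (beta_kernel (c + of_nat k) r)" for k
    by (intro beta_kernel_integrable ck r)
  have i: "set_integrable lborel {0<..<t} (beta_kernel (c + of_nat k) r)" for k
    by (rule set_integrable_subset[OF i1 _ sub]) auto
  have \<phi>: "set_integrable lborel {0<..<t} (\<phi> k)" for k
    unfolding \<phi>_def by (intro set_integrable_mult_right i)
  have bd: "(LINT s:{0<..<t}|lborel. norm (\<phi> k s)) \<le> b' k" for k
  proof -
    have "(LINT s:{0<..<t}|lborel. norm (beta_kernel (c + of_nat k) r s)) \<le>
       (LINT s:{0<..<1}|lborel. norm (beta_kernel (c + of_nat k) r s))"
      by (rule set_integral_subset_le[OF set_integrable_norm[OF i1[of k]] _ sub]) auto
    also have "\<dots> = Beta (Re r) (Re c + real k)"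
      using beta_kernel_integrable(2)[OF ck r] by simp
    finally show ?thesis
      unfolding \<phi>_def b'_def norm_mult by (simp add: mult_left_mono)
  qed
  have sb: "summable b'" unfolding b'_def using s
    by (intro summable_hypergeom_Beta c r) simp
  note ss = set_integral_sums[of lborel "{0<..<t}" \<phi> b' "\<lambda>s. saigo_kernel a b c s * of_real s powr (r - 1)",
      OF \<phi> _ bd sb]
  have sm: "summable (\<lambda>k. norm (\<phi> k s))"
    and su: "(\<lambda>k. \<phi> k s) sums (saigo_kernel a b c s * of_real s powr (r - 1))" if "s \<in> {0<..<t}" for s
    using saigo_kernel_sums[OF c, of s a b r] that sub unfolding \<phi>_def by auto
  show "set_integrable lborel {0<..<t} (\<lambda>s. saigo_kernel a b c s * of_real s powr (r - 1))"
    using ss(1) sm su by blast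
  show "(\<lambda>k. hypergeom_coeff a b c k * (LINT s:{0<..<t}|lborel. beta_kernel (c + of_nat k) r s)) sums
         (LINT s:{0<..<t}|lborel. saigo_kernel a b c s * of_real s powr (r - 1))"
    using ss(2) sm su unfolding \<phi>_def by simp
qed

text \<open>
  The Beta integral of the \<open>k\<close>-th term turns the denominator parameter \<open>c\<close> of the
  hypergeometric coefficient into \<open>r + c\<close>, so that Gauss's theorem sums the series.
\<close>

theorem saigo_kernel_integral:
  assumes c: "Re c > 0" and r: "Re r > 0" and s: "Re (r + c - a - b) > 0"
  shows "(LINT s:{0<..<1}|lborel. saigo_kernel a b c s * of_real s powr (r - 1)) =
     Gamma c * Gamma r * Gamma (r + c - a - b) * rGamma (r + c - a) * rGamma (r + c - b)"
proof -
  have nc: "c \<notin> \<int>\<^sub>\<le>\<^sub>0" "r + c \<notin> \<int>\<^sub>\<le>\<^sub>0" using c r by (auto intro!: Re_pos_notin_nonpos_Ints)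
  have "hypergeom_coeff a b c k * (LINT s:{0<..<1}|lborel. beta_kernel (c + of_nat k) r s) =
     Beta r c * hypergeom_coeff a b (r + c) k" for k
  proof -
    have "Beta r (c + of_nat k) = Beta r c * (pochhammer c k / pochhammer (r + c) k)"
      using nc by (simp add: Beta_def pochhammer_Gamma Gamma_eq_zero_iff add.assoc)
    moreover have "pochhammer c k \<noteq> 0" using nc pochhammer_eq_0_imp_nonpos_Int by blast
    ultimately show ?thesis
      using set_integral_Beta_complex[of "c + of_nat k" r] c r by (simp add: hypergeom_coeff_def mult_ac)
  qed
  then have "(\<lambda>k. Beta r c * hypergeom_coeff a b (r + c) k) sums
     (LINT s:{0<..<1}|lborel. saigo_kernel a b c s * of_real s powr (r - 1))"
    using saigo_kernel_termwise(2)[OF c r s, of 1] by simp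
  moreover have "(\<lambda>k. Beta r c * hypergeom_coeff a b (r + c) k) sums
     (Beta r c * (Gamma (r + c) * Gamma (r + c - a - b) * rGamma (r + c - a) * rGamma (r + c - b)))"
    using c r s by (intro sums_mult Gauss_hypergeom) auto
  ultimately have "(LINT s:{0<..<1}|lborel. saigo_kernel a b c s * of_real s powr (r - 1)) =
     Beta r c * (Gamma (r + c) * Gamma (r + c - a - b) * rGamma (r + c - a) * rGamma (r + c - b))"
    by (rule sums_unique2)
  then show ?thesis using nc by (simp add: Beta_def Gamma_eq_zero_iff)
qed

lemma beta_kernel_integrable_below_1:
  assumes "Re r > 0" "0 \<le> t" "t < 1"
  shows "set_integrable lborel {0<..<t} (beta_kernel c r)"
proof -
  define M where "M = max 1 ((1 - t) powr (Re c - 1))"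
  have i: "set_integrable lborel {0<..<t} (\<lambda>s. complex_of_real M * of_real s powr (r - 1))"
    by (intro set_integrable_mult_right set_integrable_subset[OF set_integral_powr(1)[OF assms(1)]])
       (use assms in auto)
  show ?thesis
  proof (rule set_integrable_bound[OF i])
    have "set_borel_measurable borel {0<..<t} (beta_kernel c r)"
      unfolding set_borel_measurable_def using assms
      by (intro borel_measurable_continuous_on_indicator continuous_on_subset[OF continuous_on_beta_kernel]) auto
    then show "set_borel_measurable lborel {0<..<t} (beta_kernel c r)" by (simp add: set_borel_measurable_def)
    have "norm (beta_kernel c r s) \<le> norm (complex_of_real M * of_real s powr (r - 1))" if s: "s \<in> {0<..<t}" for s
    proof -
      have "(1 - s) powr (Re c - 1) \<le> M"
      proof (cases "Re c \<ge> 1")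
        case True
        then have "(1 - s) powr (Re c - 1) \<le> 1" using s assms by (intro powr_le1) auto
        then show ?thesis by (simp add: M_def)
      next
        case False
        then have "(1 - s) powr (Re c - 1) \<le> (1 - t) powr (Re c - 1)"
          using s assms by (intro powr_mono2') auto
        then show ?thesis by (simp add: M_def)
      qed
      then show ?thesis
        using s assms norm_beta_kernel[of s c r] mult_left_mono[of "(1 - s) powr (Re c - 1)" M "s powr (Re r - 1)"]
        by (simp add: norm_mult norm_of_real_powr M_def mult_ac)
    qed
    then show "AE s in lborel. s \<in> {0<..<t} \<longrightarrow> norm (beta_kernel c r s) \<le> norm (complex_of_real M * of_real s powr (r - 1))"
      by auto
  qed
qed

text \<open>
  Integration by parts gains the factor \<open>1 / r\<close> at the price of one power of \<open>1 - s\<close>; hence either \<open>t\<close>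
  stays away from \<open>1\<close>, or that power is still integrable.
\<close>

lemma beta_kernel_by_parts:
  assumes r: "Re r > 0" and t: "0 \<le> t" "t \<le> 1" and q: "t < 1 \<or> Re q > 0"
  shows "r * (LINT s:{0<..<t}|lborel. beta_kernel (q + 1) r s) =
    of_real (1 - t) powr q * of_real t powr r + q * (LINT s:{0<..<t}|lborel. beta_kernel q (r + 1) s)"
proof -
  have "set_integrable lborel {0<..<t} (beta_kernel (q + 1) r) \<and>
      set_integrable lborel {0<..<t} (beta_kernel q (r + 1))"
  proof (cases "t < 1")
    case True
    then show ?thesis using r t by (intro conjI beta_kernel_integrable_below_1) auto
  next
    case False
    have *: "{0<..<t} \<subseteq> {0<..<1}" using t by auto
    show ?thesis using False q r
      by (intro conjI set_integrable_subset[OF _ _ *] beta_kernel_integrable) auto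
  qed
  then have i1: "set_integrable lborel {0<..<t} (beta_kernel (q + 1) r)"
    and i2: "set_integrable lborel {0<..<t} (beta_kernel q (r + 1))" by auto
  define G where "G = (\<lambda>s. complex_of_real (1 - s) powr q * of_real s powr r)"
  have "((\<lambda>s. r * beta_kernel (q + 1) r s - q * beta_kernel q (r + 1) s) has_integral (G t - G 0)) {0..t}"
  proof (rule fundamental_theorem_of_calculus_interior)
    have "continuous_on {0..t} (\<lambda>s. complex_of_real (1 - s) powr q)"
    proof (cases "Re q > 0")
      case True
      have "continuous_on {0..t} ((\<lambda>u. complex_of_real u powr q) \<circ> (\<lambda>s. 1 - s))"
        using t True by (intro continuous_on_compose continuous_intros continuous_on_subset[OF continuous_on_of_real_powr]) auto
      then show ?thesis by (simp add: o_def)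
    next
      case False
      then show ?thesis using t q
        by (intro continuous_intros) (auto simp: complex_nonpos_Reals_iff)
    qed
    then show "continuous_on {0..t} G" unfolding G_def
      by (rule continuous_on_mult) (rule continuous_on_subset[OF continuous_on_of_real_powr[OF r]], auto)
    fix s assume s: "s \<in> {0<..<t}"
    have "(G has_vector_derivative (of_real (1 - s) powr q * (r * of_real s powr (r - 1)) +
        (- q * of_real (1 - s) powr (q - 1)) * of_real s powr r)) (at s)"
      unfolding G_def using s t
      by (intro has_vector_derivative_mult has_vector_derivative_one_minus_powr has_vector_derivative_of_real_powr) auto
    then show "(G has_vector_derivative (r * beta_kernel (q + 1) r s - q * beta_kernel q (r + 1) s)) (at s)"
      by (simp add: beta_kernel_def algebra_simps)
  qed (use t in auto)
  moreover have "G 0 = 0" by (simp add: G_def)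
  ultimately have h: "((\<lambda>s. r * beta_kernel (q + 1) r s - q * beta_kernel q (r + 1) s) has_integral G t) {0<..<t}"
    by (simp add: has_integral_Icc_iff_Ioo)
  have i3: "set_integrable lborel {0<..<t} (\<lambda>s. r * beta_kernel (q + 1) r s - q * beta_kernel q (r + 1) s)"
    by (intro set_integral_diff(1) set_integrable_mult_right i1 i2)
  have "(LINT s:{0<..<t}|lborel. r * beta_kernel (q + 1) r s - q * beta_kernel q (r + 1) s) = G t"
    using set_borel_integral_eq_integral(2)[OF i3] h by (simp add: has_integral_iff)
  also have "(LINT s:{0<..<t}|lborel. r * beta_kernel (q + 1) r s - q * beta_kernel q (r + 1) s) =
     r * (LINT s:{0<..<t}|lborel. beta_kernel (q + 1) r s) - q * (LINT s:{0<..<t}|lborel. beta_kernel q (r + 1) s)"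
    by (subst set_integral_diff(2)) (auto intro!: set_integrable_mult_right i1 i2)
  finally show ?thesis by (simp add: G_def algebra_simps)
qed

text \<open>
  Bounds the boundary term of the integration by parts by the same Beta value that bounds the
  remaining integral: write \<open>(1 - t) powr P\<close> as the integral of \<open>P * (1 - s) powr (P - 1)\<close> over
  \<open>{t..1}\<close> and use \<open>t \<le> s\<close>.
\<close>

lemma powr_times_one_minus_powr_le_Beta:
  assumes "P > 0" "R > (0::real)" "t \<in> {0..1}"
  shows "(1 - t) powr P * t powr R \<le> P * Beta (R + 1) P"
proof -
  have "((\<lambda>s. P * (1 - s) powr (P - 1)) has_integral (- ((1 - 1) powr P) - (- ((1 - t) powr P)))) {t..1}"
  proof (rule fundamental_theorem_of_calculus_interior)
    show "continuous_on {t..1} (\<lambda>s. - ((1 - s) powr P))"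
      using assms by (intro continuous_intros continuous_on_powr') auto
    show "((\<lambda>s. - ((1 - s) powr P)) has_vector_derivative P * (1 - s) powr (P - 1)) (at s)" if "s \<in> {t<..<1}" for s
      using that by (auto intro!: derivative_eq_intros simp flip: has_real_derivative_iff_has_vector_derivative)
  qed (use assms in auto)
  then have h: "((\<lambda>s. P * (1 - s) powr (P - 1) * t powr R) has_integral ((1 - t) powr P * t powr R)) {t..1}"
    by (auto dest: has_integral_mult_left[where c = "t powr R"])
  have b: "((\<lambda>s. P * (s powr R * (1 - s) powr (P - 1))) has_integral P * Beta (R + 1) P) {0..1}"
    using has_integral_Beta_real[of "R + 1" P] assms by (intro has_integral_mult_right) simp
  then have "(\<lambda>s. P * (s powr R * (1 - s) powr (P - 1))) integrable_on {0..1}" by blast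
  then have i: "(\<lambda>s. P * (s powr R * (1 - s) powr (P - 1))) integrable_on {t..1}"
    by (rule integrable_on_subinterval) (use assms in auto)
  have "(1 - t) powr P * t powr R \<le> integral {t..1} (\<lambda>s. P * (s powr R * (1 - s) powr (P - 1)))"
  proof (rule has_integral_le[OF h integrable_integral[OF i]])
    fix s assume "s \<in> {t..1}"
    then have "t powr R \<le> s powr R" using assms by (intro powr_mono2) auto
    then have "(P * (1 - s) powr (P - 1)) * t powr R \<le> (P * (1 - s) powr (P - 1)) * s powr R"
      using assms by (intro mult_left_mono) auto
    then show "P * (1 - s) powr (P - 1) * t powr R \<le> P * (s powr R * (1 - s) powr (P - 1))" by (simp add: mult_ac)
  qed
  also have "\<dots> \<le> integral {0..1} (\<lambda>s. P * (s powr R * (1 - s) powr (P - 1)))"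
    using assms b i by (intro integral_subset_le) auto
  also have "\<dots> = P * Beta (R + 1) P" using b by (rule integral_unique)
  finally show ?thesis .
qed

section \<open>Oscillation of truncated kernel integrals\<close>

lemma one_minus_powr_FTC:
  fixes e :: real
  assumes "e \<noteq> -1" "a \<le> b" "b < 1 \<or> b \<le> 1 \<and> e > -1"
  shows "((\<lambda>s. (1 - s) powr e) has_integral ((1 - a) powr (e + 1) - (1 - b) powr (e + 1)) / (e + 1)) {a..b}"
proof -
  have "((\<lambda>s. (1 - s) powr e) has_integral (- ((1 - b) powr (e + 1) / (e + 1)) - (- ((1 - a) powr (e + 1) / (e + 1))))) {a..b}"
  proof (rule fundamental_theorem_of_calculus_interior)
    show "continuous_on {a..b} (\<lambda>s. - ((1 - s) powr (e + 1) / (e + 1)))"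
      using assms by (intro continuous_intros continuous_on_powr') auto
    show "((\<lambda>s. - ((1 - s) powr (e + 1) / (e + 1))) has_vector_derivative (1 - s) powr e) (at s)" if "s \<in> {a<..<b}" for s
      using that assms by (auto intro!: derivative_eq_intros simp flip: has_real_derivative_iff_has_vector_derivative)
  qed (use assms in auto)
  then show ?thesis by (simp add: diff_divide_distrib)
qed

text \<open>
  The singularity \<open>(1 - s) powr (c - 1)\<close> forbids integrating by parts up to \<open>1\<close>. Split at
  distance \<open>\<epsilon> = 1 / (2 * (1 + \<bar>v\<bar>))\<close> from \<open>1\<close>, the scale of the oscillation of \<open>s powr (\<i> v)\<close>: the
  short piece contributes little even in absolute value, and on the long piece integration by
  parts costs \<open>\<epsilon> powr (- \<delta>)\<close>. The slack \<open>1 - \<delta> \<le> Re c\<close> with \<open>0 < \<delta>\<close> avoids the logarithm that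
  would occur for \<open>Re c = 1\<close>.
\<close>

lemma beta_kernel_oscillation:
  assumes R: "R > 0" and \<delta>: "0 < \<delta>" "\<delta> < 1" and c: "1 - \<delta> \<le> Re c"
  obtains C where "C \<ge> 0" "\<And>v t. t \<in> {0..1} \<Longrightarrow>
     norm (Complex R v * (LINT s:{0<..<t}|lborel. beta_kernel c (Complex R v) s)) \<le> C * (1 + \<bar>v\<bar>) powr \<delta>"
proof (rule that[of "2 * (R + 1) / (1 - \<delta>) + 2 + 2 * norm (c - 1) / \<delta>"])
  let ?C = "2 * (R + 1) / (1 - \<delta>) + 2 + 2 * norm (c - 1) / \<delta>"
  show "0 \<le> ?C" using R \<delta> by simp
  fix v t :: real assume t: "t \<in> {0..1}"
  define r where "r = Complex R v"
  define w where "w = 1 + \<bar>v\<bar>"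
  define \<epsilon> where "\<epsilon> = 1 / (2 * w)"
  define z where "z = 1 - \<epsilon>"
  define t0 where "t0 = min t z"
  have w: "w \<ge> 1" by (simp add: w_def)
  have \<epsilon>: "0 < \<epsilon>" "\<epsilon> \<le> 1/2" using w by (auto simp: \<epsilon>_def)
  have z: "1/2 \<le> z" "z < 1" using \<epsilon> by (auto simp: z_def)
  have t0: "0 \<le> t0" "t0 \<le> t" "t0 \<le> z" "t0 < 1" "\<epsilon> \<le> 1 - t0" using t z by (auto simp: t0_def z_def)
  have r: "Re r > 0" "Re r = R" using R by (auto simp: r_def)
  have normr: "norm r \<le> (R + 1) * w"
  proof -
    have "norm r \<le> \<bar>R\<bar> + \<bar>v\<bar>" unfolding r_def by (metis cmod_le complex.sel)
    also have "\<dots> \<le> (R + 1) * w"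
      using R mult_nonneg_nonneg[of R "\<bar>v\<bar>"] by (simp add: w_def algebra_simps)
    finally show ?thesis .
  qed
  have \<epsilon>1: "\<epsilon> powr (- \<delta>) \<le> 2 * w powr \<delta>"
  proof -
    have "\<epsilon> powr (- \<delta>) = (2 * w) powr \<delta>" using w by (simp add: \<epsilon>_def powr_minus powr_divide field_simps)
    also have "\<dots> = 2 powr \<delta> * w powr \<delta>" using w by (simp add: powr_mult)
    also have "2 powr \<delta> \<le> (2::real) powr 1" using \<delta> by (intro powr_mono) auto
    finally show ?thesis using w by simp
  qed
  have \<epsilon>2: "w * \<epsilon> powr (1 - \<delta>) \<le> w powr \<delta>"
  proof -
    have "\<epsilon> powr (1 - \<delta>) \<le> (1 / w) powr (1 - \<delta>)" using w \<delta> by (intro powr_mono2) (auto simp: \<epsilon>_def field_simps)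
    also have "\<dots> = w powr (\<delta> - 1)" using w by (simp add: powr_divide powr_diff)
    finally have "w * \<epsilon> powr (1 - \<delta>) \<le> w powr 1 * w powr (\<delta> - 1)" using w by simp
    also have "\<dots> = w powr \<delta>" by (subst powr_add[symmetric]) simp
    finally show ?thesis .
  qed
  have low: "(1 - s) powr (Re c - 1) \<le> (1 - s) powr (- \<delta>)" if "0 \<le> s" "s \<le> 1" for s
    using that c by (intro powr_mono') auto
  have Icc: "(LINT s:{0<..<t'}|lborel. f s) = integral {0..t'} f" "f integrable_on {0..t'}"
    if "set_integrable lborel {0<..<t'} f" for f :: "real \<Rightarrow> complex" and t'
    using set_borel_integral_eq_integral[OF that]
    by (auto simp: integral_open_interval_real integrable_on_Icc_iff_Ioo)
  have "{0<..<t} \<subseteq> {0<..<1}" using t by auto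
  then have i: "set_integrable lborel {0<..<t} (beta_kernel c r)"
    using set_integrable_subset[OF beta_kernel_integrable(1), of c r "{0<..<t}"] c r \<delta> by auto
  have i0: "set_integrable lborel {0<..<t0} (beta_kernel c r)"
    by (rule set_integrable_subset[OF i]) (use t0 in auto)
  have split: "(LINT s:{0<..<t}|lborel. beta_kernel c r s) =
      (LINT s:{0<..<t0}|lborel. beta_kernel c r s) + integral {t0..t} (beta_kernel c r)"
    unfolding Icc(1)[OF i] Icc(1)[OF i0]
    by (rule Henstock_Kurzweil_Integration.integral_combine[symmetric]) (use t0 Icc(2)[OF i] in auto)
  have tail: "norm (integral {t0..t} (beta_kernel c r)) \<le> 2 * \<epsilon> powr (1 - \<delta>) / (1 - \<delta>)"
  proof (cases "t \<le> z")
    case True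
    then show ?thesis using \<delta> by (simp add: t0_def)
  next
    case False
    then have tz: "t0 = z" "z < t" by (auto simp: t0_def)
    have h: "((\<lambda>s. 2 * (1 - s) powr (- \<delta>)) has_integral
        2 * (((1 - z) powr (- \<delta> + 1) - (1 - t) powr (- \<delta> + 1)) / (- \<delta> + 1))) {z..t}"
      using t tz \<delta> by (intro has_integral_mult_right one_minus_powr_FTC) auto
    have "norm (integral {z..t} (beta_kernel c r)) \<le> integral {z..t} (\<lambda>s. 2 * (1 - s) powr (- \<delta>))"
    proof (rule Henstock_Kurzweil_Integration.integral_norm_bound_integral)
      show "beta_kernel c r integrable_on {z..t}"
        using Icc(2)[OF i] by (rule integrable_on_subinterval) (use z in auto)
      show "(\<lambda>s. 2 * (1 - s) powr (- \<delta>)) integrable_on {z..t}" using h by blast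
      fix s assume s: "s \<in> {z..t}"
      show "norm (beta_kernel c r s) \<le> 2 * (1 - s) powr (- \<delta>)"
      proof (cases "s = 1")
        case False
        then have s1: "s \<in> {0<..<1}" "s \<ge> 1/2" using s t z by auto
        have "s powr (R - 1) \<le> s powr (-1)" using s1 R by (intro powr_mono') auto
        also have "\<dots> \<le> 2" using s1 by (simp add: powr_minus field_simps)
        finally show ?thesis
          using norm_beta_kernel[OF s1(1), of c r] low[of s] s1 r
          by (auto intro!: mult_mono)
      qed (simp add: beta_kernel_def)
    qed
    also have "\<dots> = 2 * (((1 - z) powr (- \<delta> + 1) - (1 - t) powr (- \<delta> + 1)) / (- \<delta> + 1))"
      using h by (rule integral_unique)
    also have "\<dots> \<le> 2 * ((1 - z) powr (- \<delta> + 1) / (- \<delta> + 1))"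
      using \<delta> by (intro mult_left_mono divide_right_mono) auto
    finally show ?thesis using tz by (simp add: z_def)
  qed
  have main: "norm (r * (LINT s:{0<..<t0}|lborel. beta_kernel c r s)) \<le> \<epsilon> powr (- \<delta>) + norm (c - 1) * (\<epsilon> powr (- \<delta>) / \<delta>)"
  proof -
    have eq: "r * (LINT s:{0<..<t0}|lborel. beta_kernel c r s) =
      of_real (1 - t0) powr (c - 1) * of_real t0 powr r + (c - 1) * (LINT s:{0<..<t0}|lborel. beta_kernel (c - 1) (r + 1) s)"
      using beta_kernel_by_parts[of r t0 "c - 1"] r t0 by simp
    have p: "(1 - t0) powr (- \<delta>) \<le> \<epsilon> powr (- \<delta>)" using t0 \<epsilon> \<delta> by (intro powr_mono2') auto
    have "norm (of_real (1 - t0) powr (c - 1) * of_real t0 powr r :: complex) = (1 - t0) powr (Re c - 1) * t0 powr R"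
      using t0 r norm_of_real_powr[of "1 - t0" "c - 1"] norm_of_real_powr[of t0 r] by (simp add: norm_mult)
    also have "\<dots> \<le> \<epsilon> powr (- \<delta>) * 1"
      using t0 R low[of t0] p by (intro mult_mono powr_le1) auto
    finally have A: "norm (of_real (1 - t0) powr (c - 1) * of_real t0 powr r :: complex) \<le> \<epsilon> powr (- \<delta>)" by simp
    have i2: "set_integrable lborel {0<..<t0} (beta_kernel (c - 1) (r + 1))"
      using r t0 by (intro beta_kernel_integrable_below_1) auto
    have h: "((\<lambda>s. (1 - s) powr (- \<delta> - 1)) has_integral
        (((1 - 0) powr (- \<delta> - 1 + 1) - (1 - t0) powr (- \<delta> - 1 + 1)) / (- \<delta> - 1 + 1))) {0..t0}"
      using t0 \<delta> by (intro one_minus_powr_FTC) auto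
    have "norm (integral {0..t0} (beta_kernel (c - 1) (r + 1))) \<le> integral {0..t0} (\<lambda>s. (1 - s) powr (- \<delta> - 1))"
    proof (rule Henstock_Kurzweil_Integration.integral_norm_bound_integral)
      show "beta_kernel (c - 1) (r + 1) integrable_on {0..t0}" by (rule Icc(2)[OF i2])
      show "(\<lambda>s. (1 - s) powr (- \<delta> - 1)) integrable_on {0..t0}" using h by blast
      fix s assume s: "s \<in> {0..t0}"
      show "norm (beta_kernel (c - 1) (r + 1) s) \<le> (1 - s) powr (- \<delta> - 1)"
      proof (cases "s = 0")
        case True
        then show ?thesis using R r by (simp add: beta_kernel_def)
      next
        case False
        then have s1: "s \<in> {0<..<1}" using s t0 by auto
        have "s powr R \<le> 1" using s1 R by (intro powr_le1) auto
        moreover have "(1 - s) powr (Re c - 2) \<le> (1 - s) powr (- \<delta> - 1)" using s1 c by (intro powr_mono') auto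
        ultimately have "s powr R * (1 - s) powr (Re c - 2) \<le> 1 * (1 - s) powr (- \<delta> - 1)"
          by (intro mult_mono) auto
        then show ?thesis
          using norm_beta_kernel[OF s1(1), of "c - 1" "r + 1"] r by simp
      qed
    qed
    also have "\<dots> = ((1 - t0) powr (- \<delta>) - 1) / \<delta>"
      using integral_unique[OF h] \<delta> by (simp add: divide_simps)
    also have "\<dots> \<le> \<epsilon> powr (- \<delta>) / \<delta>" using p \<delta> by (intro divide_right_mono) auto
    finally have "norm (LINT s:{0<..<t0}|lborel. beta_kernel (c - 1) (r + 1) s) \<le> \<epsilon> powr (- \<delta>) / \<delta>"
      unfolding Icc(1)[OF i2] .
    then have B: "norm ((c - 1) * (LINT s:{0<..<t0}|lborel. beta_kernel (c - 1) (r + 1) s)) \<le> norm (c - 1) * (\<epsilon> powr (- \<delta>) / \<delta>)"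
      unfolding norm_mult by (rule mult_left_mono) simp
    show ?thesis unfolding eq by (rule order_trans[OF norm_triangle_ineq add_mono[OF A B]])
  qed
  have "norm (r * (LINT s:{0<..<t}|lborel. beta_kernel c r s)) \<le>
     norm (r * (LINT s:{0<..<t0}|lborel. beta_kernel c r s)) + norm r * norm (integral {t0..t} (beta_kernel c r))"
    unfolding split distrib_left norm_mult[symmetric] by (rule norm_triangle_ineq)
  also have "\<dots> \<le> (\<epsilon> powr (- \<delta>) + norm (c - 1) * (\<epsilon> powr (- \<delta>) / \<delta>)) + (R + 1) * w * (2 * \<epsilon> powr (1 - \<delta>) / (1 - \<delta>))"
    using R w \<delta> by (intro add_mono main mult_mono normr tail) auto
  also have "\<dots> = (\<epsilon> powr (- \<delta>) + norm (c - 1) * (\<epsilon> powr (- \<delta>) / \<delta>)) + (2 * (R + 1) / (1 - \<delta>)) * (w * \<epsilon> powr (1 - \<delta>))"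
    by simp
  also have "\<dots> \<le> (2 * w powr \<delta> + norm (c - 1) * (2 * w powr \<delta> / \<delta>)) + (2 * (R + 1) / (1 - \<delta>)) * w powr \<delta>"
    using R \<delta> by (intro add_mono \<epsilon>1 mult_left_mono divide_right_mono \<epsilon>2) auto
  also have "\<dots> = ?C * w powr \<delta>"
    by (simp add: algebra_simps)
  finally show "norm (Complex R v * (LINT s:{0<..<t}|lborel. beta_kernel c (Complex R v) s)) \<le> ?C * (1 + \<bar>v\<bar>) powr \<delta>"
    by (simp only: r_def w_def)
qed

text \<open>
  For the terms of the hypergeometric series of positive index the exponent of \<open>1 - s\<close> has positive real
  part, and one integration by parts over the whole interval suffices; the bound
  depends on \<open>r\<close> through \<open>Re r\<close> only.
\<close>

lemma beta_kernel_bound: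
  assumes R: "Re r > 0" and p: "Re p > 0" and t: "t \<in> {0..1}"
  shows "norm (r * (LINT s:{0<..<t}|lborel. beta_kernel (p + 1) r s)) \<le> 2 * norm p * Beta (Re r + 1) (Re p)"
proof -
  have eq: "r * (LINT s:{0<..<t}|lborel. beta_kernel (p + 1) r s) =
      of_real (1 - t) powr p * of_real t powr r + p * (LINT s:{0<..<t}|lborel. beta_kernel p (r + 1) s)"
    using beta_kernel_by_parts[of r t p] R p t by simp
  have B: "Beta (Re r + 1) (Re p) \<ge> 0" using R p by (auto simp: Beta_def)
  have "norm (of_real (1 - t) powr p * of_real t powr r :: complex) = (1 - t) powr Re p * t powr Re r"
    using t norm_of_real_powr[of "1 - t" p] norm_of_real_powr[of t r] by (simp add: norm_mult)
  also have "\<dots> \<le> Re p * Beta (Re r + 1) (Re p)"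
    by (intro powr_times_one_minus_powr_le_Beta R p t)
  also have "\<dots> \<le> norm p * Beta (Re r + 1) (Re p)"
    using B by (intro mult_right_mono complex_Re_le_cmod)
  finally have 1: "norm (of_real (1 - t) powr p * of_real t powr r :: complex) \<le> norm p * Beta (Re r + 1) (Re p)" .
  have sub: "{0<..<t} \<subseteq> {0<..<1}" using t by auto
  have i1: "set_integrable lborel {0<..<1} (beta_kernel p (r + 1))"
    using R p by (intro beta_kernel_integrable) auto
  have "norm (LINT s:{0<..<t}|lborel. beta_kernel p (r + 1) s) \<le> (LINT s:{0<..<t}|lborel. norm (beta_kernel p (r + 1) s))"
    by (intro set_integral_norm_bound set_integrable_subset[OF i1 _ sub]) auto
  also have "\<dots> \<le> (LINT s:{0<..<1}|lborel. norm (beta_kernel p (r + 1) s))"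
    by (rule set_integral_subset_le[OF set_integrable_norm[OF i1] _ sub]) auto
  also have "\<dots> = Beta (Re r + 1) (Re p)"
    using beta_kernel_integrable(2)[of p "r + 1"] R p by simp
  finally have 2: "norm (p * (LINT s:{0<..<t}|lborel. beta_kernel p (r + 1) s)) \<le> norm p * Beta (Re r + 1) (Re p)"
    unfolding norm_mult by (rule mult_left_mono) simp
  show ?thesis unfolding eq using norm_triangle_ineq order_trans add_mono[OF 1 2] by fastforce
qed

text \<open>
  Only the leading term of the kernel at \<open>s = 1\<close> needs the oscillation estimate; the others are bounded
  uniformly in \<open>v\<close>, with summable bounds.
\<close>

theorem saigo_kernel_oscillation:
  assumes R: "R > 0" and \<delta>: "0 < \<delta>" "\<delta> < 1" and c: "1 - \<delta> \<le> Re c"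
    and s: "R + Re (c - a - b) > 0"
  obtains C where "C \<ge> 0" "\<And>v t. t \<in> {0..1} \<Longrightarrow>
     norm (Complex R v * (LINT s:{0<..<t}|lborel. saigo_kernel a b c s * of_real s powr (Complex R v - 1)))
       \<le> C * (1 + \<bar>v\<bar>) powr \<delta>"
proof -
  have c0: "Re c > 0" using c \<delta> by simp
  have nc: "c \<notin> \<int>\<^sub>\<le>\<^sub>0" using c0 by (rule Re_pos_notin_nonpos_Ints)
  define A where "A = hypergeom_coeff a b c"
  obtain C0 where C0: "C0 \<ge> 0" "\<And>v t. t \<in> {0..1} \<Longrightarrow>
     norm (Complex R v * (LINT s:{0<..<t}|lborel. beta_kernel c (Complex R v) s)) \<le> C0 * (1 + \<bar>v\<bar>) powr \<delta>"
    using beta_kernel_oscillation[OF R \<delta> c] by blast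
  define B where "B = (\<lambda>k. norm (A (Suc k)) * (2 * norm (c + of_nat k) * Beta (R + 1) (Re c + real k)))"
  have sB: "summable B"
  proof -
    obtain CA where CA: "CA > 0" "\<And>k. norm (A k) \<le> CA * (real k + 1) powr (Re (a + b - c) - 1)"
      using hypergeom_coeff_growth[OF nc] unfolding A_def by blast
    obtain D where D: "D > 0" "\<And>k. Beta (R + 1) (Re c + real k) \<le> D * (real k + 1) powr (- (R + 1))"
      using Beta_growth[OF c0, of "R + 1"] R by auto
    define e where "e = Re (a + b - c) - 1"
    have "(\<lambda>k. (real (Suc k) + 1) powr e * ((real k + 1) * (real k + 1) powr (- (R + 1))))
        \<in> O(\<lambda>k. real k powr (e - R))"
      by real_asymp
    moreover have "summable (\<lambda>k. norm (real k powr (e - R)))"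
      using s by (simp add: summable_real_powr_iff e_def)
    ultimately have S: "summable (\<lambda>k. (real (Suc k) + 1) powr e * ((real k + 1) * (real k + 1) powr (- (R + 1))))"
      by (rule summable_comparison_test_bigo[rotated])
    show ?thesis
    proof (rule summable_comparison_test')
      show "summable (\<lambda>k. (CA * (2 * (norm c + 1)) * D) * ((real (Suc k) + 1) powr e * ((real k + 1) * (real k + 1) powr (- (R + 1)))))"
        by (intro summable_mult S)
      fix k
      have n: "norm (c + of_nat k) \<le> (norm c + 1) * (real k + 1)"
      proof -
        have "norm (c + of_nat k) \<le> norm c + real k" using norm_triangle_ineq[of c "of_nat k"] by simp
        moreover have "(norm c + 1) * (real k + 1) = norm c * real k + norm c + real k + 1"
          by (simp add: algebra_simps)
        ultimately show ?thesis
          using mult_nonneg_nonneg[OF norm_ge_zero[of c] of_nat_0_le_iff[of k]] by linarith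
      qed
      have Bp: "Beta (R + 1) (Re c + real k) \<ge> 0" using R c0 by (auto simp: Beta_def)
      have "B k \<le> (CA * (real (Suc k) + 1) powr e) * (2 * ((norm c + 1) * (real k + 1)) * (D * (real k + 1) powr (- (R + 1))))"
        unfolding B_def e_def using CA(1) D(1) n Bp
        by (intro mult_mono CA(2) D(2) mult_nonneg_nonneg powr_ge_zero) auto
      moreover have "B k \<ge> 0" unfolding B_def using Bp by auto
      ultimately show "norm (B k) \<le> (CA * (2 * (norm c + 1)) * D) * ((real (Suc k) + 1) powr e * ((real k + 1) * (real k + 1) powr (- (R + 1))))"
        by (simp only: real_norm_def abs_of_nonneg mult_ac)
    qed
  qed
  have B0: "B k \<ge> 0" for k unfolding B_def using R c0 by (auto simp: Beta_def)
  show ?thesis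
  proof (rule that[of "norm (A 0) * C0 + suminf B"])
    show "norm (A 0) * C0 + suminf B \<ge> 0" using C0 B0 by (simp add: suminf_nonneg sB)
    fix v t :: real assume t: "t \<in> {0..1}"
    define r where "r = Complex R v"
    have r: "Re r > 0" "Re r = R" using R by (auto simp: r_def)
    define J where "J = (\<lambda>k. LINT s:{0<..<t}|lborel. beta_kernel (c + of_nat k) r s)"
    define I where "I = (LINT s:{0<..<t}|lborel. saigo_kernel a b c s * of_real s powr (r - 1))"
    have "(\<lambda>k. A k * J k) sums I"
      unfolding A_def J_def I_def using r s by (intro saigo_kernel_termwise c0 t) auto
    then have "(\<lambda>k. A k * (r * J k)) sums (r * I)"
      using sums_mult[of "\<lambda>k. A k * J k" I r] by (simp add: mult_ac)
    then have 1: "(\<lambda>k. A (Suc k) * (r * J (Suc k))) sums (r * I - A 0 * (r * J 0))"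
      by (subst sums_Suc_iff) simp
    have 2: "norm (A (Suc k) * (r * J (Suc k))) \<le> B k" for k
      using beta_kernel_bound[OF r(1), of "c + of_nat k" t] t c0 r
      by (auto simp: B_def J_def norm_mult add_ac intro!: mult_left_mono)
    have "norm (r * I - A 0 * (r * J 0)) \<le> suminf B"
      using 1 norm_suminf_le[OF 2 sB] by (simp add: sums_iff)
    moreover have "norm (A 0 * (r * J 0)) \<le> norm (A 0) * (C0 * (1 + \<bar>v\<bar>) powr \<delta>)"
      using C0(2)[OF t, of v] by (auto simp: norm_mult J_def r_def intro!: mult_left_mono)
    ultimately have "norm (r * I) \<le> norm (A 0) * (C0 * (1 + \<bar>v\<bar>) powr \<delta>) + suminf B"
      using norm_triangle_ineq[of "A 0 * (r * J 0)" "r * I - A 0 * (r * J 0)"] by simp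
    also have "suminf B \<le> suminf B * (1 + \<bar>v\<bar>) powr \<delta>"
    proof -
      have "1 \<le> (1 + \<bar>v\<bar>) powr \<delta>" using \<delta> by (intro ge_one_powr_ge_zero) auto
      then show ?thesis using mult_left_mono[of 1 "(1 + \<bar>v\<bar>) powr \<delta>" "suminf B"] suminf_nonneg[OF sB B0] by simp
    qed
    finally show "norm (Complex R v * (LINT s:{0<..<t}|lborel. saigo_kernel a b c s * of_real s powr (Complex R v - 1)))
       \<le> (norm (A 0) * C0 + suminf B) * (1 + \<bar>v\<bar>) powr \<delta>"
      by (simp add: I_def r_def algebra_simps)
  qed
qed

section \<open>Growth of the Gamma function on vertical lines\<close>

text \<open>
  Polynomial order \<open>e\<close> times exponential decay of rate \<open>d\<close>. The form \<open>1 + \<bar>\<tau>\<bar>\<close> makes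
  the bound meaningful on the whole line, so that no large-\<open>\<tau>\<close> bookkeeping is needed, and both
  orders add up under products.
\<close>

definition vertical_bound :: "(real \<Rightarrow> complex) \<Rightarrow> real \<Rightarrow> real \<Rightarrow> bool" where
  "vertical_bound h e d \<longleftrightarrow> (\<exists>C\<ge>0. \<forall>\<tau>. norm (h \<tau>) \<le> C * ((1 + \<bar>\<tau>\<bar>) powr e * exp (- (d * \<bar>\<tau>\<bar>))))"

lemma vertical_bound_1: "vertical_bound (\<lambda>_. 1) 0 0"
  unfolding vertical_bound_def by (intro exI[of _ 1]) auto

lemma vertical_bound_mult:
  assumes "vertical_bound g e d" "vertical_bound h e' d'"
  shows "vertical_bound (\<lambda>\<tau>. g \<tau> * h \<tau>) (e + e') (d + d')"
proof -
  from assms obtain C D where C: "C \<ge> 0" "\<And>\<tau>. norm (g \<tau>) \<le> C * ((1 + \<bar>\<tau>\<bar>) powr e * exp (- (d * \<bar>\<tau>\<bar>)))"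
    and D: "D \<ge> 0" "\<And>\<tau>. norm (h \<tau>) \<le> D * ((1 + \<bar>\<tau>\<bar>) powr e' * exp (- (d' * \<bar>\<tau>\<bar>)))"
    unfolding vertical_bound_def by blast
  show ?thesis unfolding vertical_bound_def
  proof (intro exI[of _ "C * D"] conjI allI)
    fix \<tau> :: real
    have "norm (g \<tau> * h \<tau>) \<le> (C * ((1 + \<bar>\<tau>\<bar>) powr e * exp (- (d * \<bar>\<tau>\<bar>)))) * (D * ((1 + \<bar>\<tau>\<bar>) powr e' * exp (- (d' * \<bar>\<tau>\<bar>))))"
      unfolding norm_mult by (intro mult_mono C D) (use C in auto)
    also have "\<dots> = C * D * (((1 + \<bar>\<tau>\<bar>) powr e * (1 + \<bar>\<tau>\<bar>) powr e') * (exp (- (d * \<bar>\<tau>\<bar>)) * exp (- (d' * \<bar>\<tau>\<bar>))))"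
      by (simp only: mult_ac)
    also have "\<dots> = C * D * ((1 + \<bar>\<tau>\<bar>) powr (e + e') * exp (- ((d + d') * \<bar>\<tau>\<bar>)))"
      unfolding powr_add[symmetric] mult_exp_exp by (simp add: algebra_simps)
    finally show "norm (g \<tau> * h \<tau>) \<le> C * D * ((1 + \<bar>\<tau>\<bar>) powr (e + e') * exp (- ((d + d') * \<bar>\<tau>\<bar>)))" .
  qed (use C D in simp)
qed

lemma vertical_bound_prod_list:
  assumes "\<And>x. x \<in> set xs \<Longrightarrow> vertical_bound (g x) (e x) (d x)"
  shows "vertical_bound (\<lambda>\<tau>. \<Prod>x\<leftarrow>xs. g x \<tau>) (\<Sum>x\<leftarrow>xs. e x) (\<Sum>x\<leftarrow>xs. d x)"
  using assms
proof (induction xs)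
  case (Cons x xs)
  then show ?case
    using vertical_bound_mult[of "g x" "e x" "d x" "\<lambda>\<tau>. \<Prod>x\<leftarrow>xs. g x \<tau>"] by simp
qed (simp add: vertical_bound_1)

lemma vertical_bound_powr:
  assumes "vertical_bound g e d" "\<kappa> \<ge> 0" "\<And>\<tau>. norm (h \<tau>) = norm (g \<tau>) powr \<kappa>"
  shows "vertical_bound h (\<kappa> * e) (\<kappa> * d)"
proof -
  from assms obtain C where C: "C \<ge> 0" "\<And>\<tau>. norm (g \<tau>) \<le> C * ((1 + \<bar>\<tau>\<bar>) powr e * exp (- (d * \<bar>\<tau>\<bar>)))"
    unfolding vertical_bound_def by blast
  show ?thesis unfolding vertical_bound_def
  proof (intro exI[of _ "C powr \<kappa>"] conjI allI)
    fix \<tau> :: real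
    have "norm (h \<tau>) \<le> (C * ((1 + \<bar>\<tau>\<bar>) powr e * exp (- (d * \<bar>\<tau>\<bar>)))) powr \<kappa>"
      unfolding assms(3) by (intro powr_mono2 C assms) auto
    also have "\<dots> = C powr \<kappa> * ((1 + \<bar>\<tau>\<bar>) powr (\<kappa> * e) * exp (- (\<kappa> * d * \<bar>\<tau>\<bar>)))"
      using C by (simp add: powr_mult powr_powr exp_powr_real mult_ac)
    finally show "norm (h \<tau>) \<le> C powr \<kappa> * ((1 + \<bar>\<tau>\<bar>) powr (\<kappa> * e) * exp (- (\<kappa> * d * \<bar>\<tau>\<bar>)))" .
  qed simp
qed

lemma vertical_bound_cong:
  assumes "vertical_bound g e d" "\<And>\<tau>. h \<tau> = g \<tau>" "e' = e" "d' = d"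
  shows "vertical_bound h e' d'"
  using assms by (simp add: vertical_bound_def)

text \<open>
  \<open>1 + \<bar>y + c \<tau>\<bar>\<close> and \<open>1 + \<bar>\<tau>\<bar>\<close> bound each other up to constants; the sign of \<open>e\<close> decides which of
  the two directions is needed.
\<close>

lemma one_plus_abs_affine_powr:
  assumes "c \<noteq> (0::real)"
  obtains C where "C \<ge> 0" "\<And>\<tau>. (1 + \<bar>y + c * \<tau>\<bar>) powr e \<le> C * (1 + \<bar>\<tau>\<bar>) powr e"
proof (cases "e \<ge> 0")
  case True
  define M where "M = 1 + \<bar>y\<bar> + \<bar>c\<bar>"
  show ?thesis
  proof (rule that[of "M powr e"])
    fix \<tau>
    have "\<bar>y + c * \<tau>\<bar> \<le> \<bar>y\<bar> + \<bar>c\<bar> * \<bar>\<tau>\<bar>" by (metis abs_mult abs_triangle_ineq)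
    moreover have "M * (1 + \<bar>\<tau>\<bar>) = 1 + \<bar>y\<bar> + \<bar>c\<bar> + \<bar>\<tau>\<bar> + \<bar>y\<bar> * \<bar>\<tau>\<bar> + \<bar>c\<bar> * \<bar>\<tau>\<bar>"
      by (simp add: M_def algebra_simps)
    moreover have "0 \<le> \<bar>y\<bar> * \<bar>\<tau>\<bar>" by simp
    ultimately have "1 + \<bar>y + c * \<tau>\<bar> \<le> M * (1 + \<bar>\<tau>\<bar>)" by linarith
    then have "(1 + \<bar>y + c * \<tau>\<bar>) powr e \<le> (M * (1 + \<bar>\<tau>\<bar>)) powr e"
      using True by (intro powr_mono2) auto
    then show "(1 + \<bar>y + c * \<tau>\<bar>) powr e \<le> M powr e * (1 + \<bar>\<tau>\<bar>) powr e"
      by (simp add: powr_mult M_def)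
  qed simp
next
  case False
  define M where "M = 1 + (1 + \<bar>y\<bar>) / \<bar>c\<bar>"
  have M: "M > 0" by (auto simp: M_def intro!: add_pos_nonneg)
  show ?thesis
  proof (rule that[of "M powr (- e)"])
    fix \<tau>
    define Y where "Y = \<bar>y + c * \<tau>\<bar>"
    have Y: "Y \<ge> 0" by (simp add: Y_def)
    have "\<bar>c\<bar> * \<bar>\<tau>\<bar> \<le> Y + \<bar>y\<bar>" unfolding Y_def abs_mult[symmetric] by simp
    then have "\<bar>\<tau>\<bar> \<le> (Y + \<bar>y\<bar>) / \<bar>c\<bar>" using assms by (simp add: field_simps)
    also have "\<dots> \<le> (1 + \<bar>y\<bar>) * (1 + Y) / \<bar>c\<bar>"
      using Y mult_nonneg_nonneg[OF abs_ge_zero[of y] Y] by (intro divide_right_mono) (auto simp: algebra_simps)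
    finally have "1 + \<bar>\<tau>\<bar> \<le> M * (1 + Y)"
      using Y by (simp add: M_def algebra_simps add_divide_distrib)
    then have "(M * (1 + Y)) powr e \<le> (1 + \<bar>\<tau>\<bar>) powr e"
      using False by (intro powr_mono2') auto
    then have "M powr e * (1 + Y) powr e \<le> (1 + \<bar>\<tau>\<bar>) powr e"
      using M Y by (simp add: powr_mult)
    then have "M powr (- e) * (M powr e * (1 + Y) powr e) \<le> M powr (- e) * (1 + \<bar>\<tau>\<bar>) powr e"
      by (rule mult_left_mono) simp
    moreover have "M powr (- e) * M powr e = 1" using M by (simp add: powr_add[symmetric])
    ultimately show "(1 + \<bar>y + c * \<tau>\<bar>) powr e \<le> M powr (- e) * (1 + \<bar>\<tau>\<bar>) powr e"
      by (simp add: mult.assoc[symmetric] Y_def)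
  qed simp
qed

lemma vertical_bound_affine:
  assumes "vertical_bound h e d" "c \<noteq> 0"
  shows "vertical_bound (\<lambda>\<tau>. h (y + c * \<tau>)) e (d * \<bar>c\<bar>)"
proof -
  from assms(1) obtain C where C: "C \<ge> 0" "\<And>\<tau>. norm (h \<tau>) \<le> C * ((1 + \<bar>\<tau>\<bar>) powr e * exp (- (d * \<bar>\<tau>\<bar>)))"
    unfolding vertical_bound_def by blast
  obtain D where D: "D \<ge> 0" "\<And>\<tau>. (1 + \<bar>y + c * \<tau>\<bar>) powr e \<le> D * (1 + \<bar>\<tau>\<bar>) powr e"
    using one_plus_abs_affine_powr[OF assms(2)] by blast
  show ?thesis unfolding vertical_bound_def
  proof (intro exI[of _ "C * (D * exp (\<bar>d\<bar> * \<bar>y\<bar>))"] conjI allI)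
    fix \<tau>
    have "\<bar>\<bar>y + c * \<tau>\<bar> - \<bar>c\<bar> * \<bar>\<tau>\<bar>\<bar> \<le> \<bar>y\<bar>" unfolding abs_mult[symmetric] by arith
    then have "\<bar>d * (\<bar>y + c * \<tau>\<bar> - \<bar>c\<bar> * \<bar>\<tau>\<bar>)\<bar> \<le> \<bar>d\<bar> * \<bar>y\<bar>"
      unfolding abs_mult by (intro mult_left_mono) auto
    from abs_le_D2[OF this] have "- (d * \<bar>y + c * \<tau>\<bar>) \<le> \<bar>d\<bar> * \<bar>y\<bar> + - (d * \<bar>c\<bar> * \<bar>\<tau>\<bar>)" by (simp add: algebra_simps)
    then have E: "exp (- (d * \<bar>y + c * \<tau>\<bar>)) \<le> exp (\<bar>d\<bar> * \<bar>y\<bar>) * exp (- (d * \<bar>c\<bar> * \<bar>\<tau>\<bar>))"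
      unfolding exp_add[symmetric] by (subst exp_le_cancel_iff)
    have "norm (h (y + c * \<tau>)) \<le>
       C * ((D * (1 + \<bar>\<tau>\<bar>) powr e) * (exp (\<bar>d\<bar> * \<bar>y\<bar>) * exp (- (d * \<bar>c\<bar> * \<bar>\<tau>\<bar>))))"
      by (rule order_trans[OF C(2)], intro mult_left_mono mult_mono D E) (use C D in auto)
    then show "norm (h (y + c * \<tau>)) \<le> C * (D * exp (\<bar>d\<bar> * \<bar>y\<bar>)) * ((1 + \<bar>\<tau>\<bar>) powr e * exp (- (d * \<bar>c\<bar> * \<bar>\<tau>\<bar>)))"
      by (simp only: mult_ac)
  qed (use C D in simp)
qed

lemma norm_ge_half_sum:
  assumes "\<sigma> > 0"
  shows "min 1 \<sigma> / 2 * (1 + \<bar>v\<bar>) \<le> norm (Complex \<sigma> v)"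
proof -
  have "\<sigma> \<le> norm (Complex \<sigma> v)" using complex_Re_le_cmod[of "Complex \<sigma> v"] by simp
  moreover have "\<bar>v\<bar> \<le> norm (Complex \<sigma> v)" using abs_Im_le_cmod[of "Complex \<sigma> v"] by simp
  moreover have "min 1 \<sigma> * (1 + \<bar>v\<bar>) \<le> \<sigma> + \<bar>v\<bar>"
    using mult_right_mono[of "min 1 \<sigma>" 1 "\<bar>v\<bar>"] by (simp add: distrib_left)
  ultimately show ?thesis by simp
qed

lemma norm_le_sum: "norm (Complex \<sigma> v) \<le> (1 + \<bar>\<sigma>\<bar>) * (1 + \<bar>v\<bar>)"
proof -
  have "norm (Complex \<sigma> v) \<le> \<bar>\<sigma>\<bar> + \<bar>v\<bar>" by (metis cmod_le complex.sel)
  moreover have "0 \<le> \<bar>\<sigma>\<bar> * \<bar>v\<bar>" by simp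
  moreover have "(1 + \<bar>\<sigma>\<bar>) * (1 + \<bar>v\<bar>) = 1 + \<bar>\<sigma>\<bar> + \<bar>v\<bar> + \<bar>\<sigma>\<bar> * \<bar>v\<bar>" by (simp add: algebra_simps)
  ultimately show ?thesis by linarith
qed

text \<open>
  The quotient is \<open>Beta r \<kappa> / Gamma \<kappa>\<close> with \<open>r = Complex \<sigma> v\<close>, and the oscillation estimate for the full
  Beta integral bounds \<open>r * Beta r \<kappa>\<close> by \<open>(1 + \<bar>v\<bar>) powr (1 - \<kappa>)\<close>.
\<close>

lemma Gamma_vertical_ratio:
  assumes \<kappa>: "0 < \<kappa>" "\<kappa> < 1" and \<sigma>: "\<sigma> > 0"
  shows "vertical_bound (\<lambda>v. Gamma (Complex \<sigma> v) * rGamma (Complex (\<sigma> + \<kappa>) v)) (- \<kappa>) 0"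
proof -
  obtain C where C: "C \<ge> 0" "\<And>v t. t \<in> {0..1} \<Longrightarrow>
     norm (Complex \<sigma> v * (LINT s:{0<..<t}|lborel. beta_kernel (of_real \<kappa>) (Complex \<sigma> v) s)) \<le> C * (1 + \<bar>v\<bar>) powr (1 - \<kappa>)"
    using beta_kernel_oscillation[of \<sigma> "1 - \<kappa>" "of_real \<kappa>"] assms by auto
  have G: "Gamma \<kappa> > 0" using \<kappa> by simp
  define m where "m = min 1 \<sigma> / 2"
  have m: "m > 0" using \<sigma> by (simp add: m_def)
  show ?thesis unfolding vertical_bound_def
  proof (intro exI[of _ "C / (m * Gamma \<kappa>)"] conjI allI)
    fix v :: real
    define r where "r = Complex \<sigma> v"
    define w where "w = 1 + \<bar>v\<bar>"
    define X where "X = norm (Gamma r) * norm (rGamma (Complex (\<sigma> + \<kappa>) v))"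
    have w: "w > 0" by (simp add: w_def add_pos_nonneg)
    have r\<kappa>: "r + of_real \<kappa> = Complex (\<sigma> + \<kappa>) v" by (simp add: r_def complex_eq_iff)
    have "norm (LINT s:{0<..<1}|lborel. beta_kernel (of_real \<kappa>) r s) = X * Gamma \<kappa>"
      using set_integral_Beta_complex[of "of_real \<kappa>" r] assms G
      by (simp add: Beta_altdef norm_mult X_def flip: r\<kappa>) (simp add: r_def Gamma_complex_of_real norm_mult)
    then have "norm r * (X * Gamma \<kappa>) \<le> C * w powr (1 - \<kappa>)"
      using C(2)[of 1 v] by (simp add: norm_mult r_def w_def)
    moreover have "m * w * (X * Gamma \<kappa>) \<le> norm r * (X * Gamma \<kappa>)"
      unfolding m_def w_def r_def using G \<sigma> by (intro mult_right_mono norm_ge_half_sum) (auto simp: X_def)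
    ultimately have "w * (X * (m * Gamma \<kappa>)) \<le> C * w powr (1 - \<kappa>)" by (simp add: mult_ac)
    also have "w powr (1 - \<kappa>) = w * w powr (- \<kappa>)"
      using w by (subst powr_mult_base) auto
    finally have "w * (X * (m * Gamma \<kappa>)) \<le> w * (C * w powr (- \<kappa>))" by (simp add: mult_ac)
    then have "X * (m * Gamma \<kappa>) \<le> C * w powr (- \<kappa>)" using w by simp
    then have "X \<le> C / (m * Gamma \<kappa>) * w powr (- \<kappa>)"
      using m G by (simp add: field_simps)
    then show "norm (Gamma (Complex \<sigma> v) * rGamma (Complex (\<sigma> + \<kappa>) v)) \<le>
        C / (m * Gamma \<kappa>) * ((1 + \<bar>v\<bar>) powr (- \<kappa>) * exp (- (0 * \<bar>v\<bar>)))"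
      by (simp add: X_def r_def w_def norm_mult)
  qed (use C G m in simp)
qed

lemma norm_Gamma_half:
  "norm (Gamma (Complex (1/2) v)) ^ 2 = pi / cosh (pi * v)"
proof -
  define z where "z = Complex (1/2) v"
  have "complex_of_real (norm (Gamma z) ^ 2) = Gamma z * cnj (Gamma z)"
    by (rule complex_norm_square)
  also have "\<dots> = Gamma z * Gamma (1 - z)"
  proof -
    have "cnj z = 1 - z" by (simp add: z_def complex_eq_iff)
    then show ?thesis by (simp add: cnj_Gamma)
  qed
  also have "\<dots> = of_real pi / sin (of_real pi * z)" by (rule Gamma_reflection_complex)
  also have "of_real pi * z = of_real (pi / 2) + \<i> * of_real (pi * v)"
    by (simp add: z_def complex_eq_iff)
  also have "sin (of_real (pi / 2) + \<i> * of_real (pi * v)) = cos (\<i> * of_real (pi * v))"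
    unfolding sin_add by (simp add: sin_of_real cos_of_real del: of_real_divide of_real_mult)
  also have "\<dots> = of_real (cosh (pi * v))"
    using cosh_real[of "pi * v"] by (simp only: cosh_field_def exp_minus)
  finally have "complex_of_real (norm (Gamma z) ^ 2) = of_real (pi / cosh (pi * v))" by simp
  then show ?thesis unfolding z_def of_real_eq_iff .
qed

lemma vertical_bound_Complex: "vertical_bound (Complex \<sigma>) 1 0"
  unfolding vertical_bound_def
  by (intro exI[of _ "1 + \<bar>\<sigma>\<bar>"] conjI allI) (use norm_le_sum in auto)

lemma vertical_bound_inverse_Complex:
  assumes "\<sigma> > 0" shows "vertical_bound (\<lambda>v. inverse (Complex \<sigma> v)) (-1) 0"
  unfolding vertical_bound_def
proof (intro exI[of _ "inverse (min 1 \<sigma> / 2)"] conjI allI)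
  fix v
  have "min 1 \<sigma> / 2 * (1 + \<bar>v\<bar>) > 0" using assms by (intro mult_pos_pos) auto
  then have "norm (inverse (Complex \<sigma> v)) \<le> inverse (min 1 \<sigma> / 2 * (1 + \<bar>v\<bar>))"
    unfolding norm_inverse using norm_ge_half_sum[OF assms] by (intro le_imp_inverse_le)
  then show "norm (inverse (Complex \<sigma> v)) \<le> inverse (min 1 \<sigma> / 2) * ((1 + \<bar>v\<bar>) powr -1 * exp (- (0 * \<bar>v\<bar>)))"
    by (simp add: powr_minus divide_simps mult_ac)
qed (use assms in simp)

text \<open>
  The orders are those of Stirling's formula
  \<open>\<bar>Gamma (\<sigma> + \<i> v)\<bar> \<sim> sqrt (2 * \<pi>) * \<bar>v\<bar> powr (\<sigma> - 1/2) * exp (- \<pi> * \<bar>v\<bar> / 2)\<close>. Lower bounds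
  for \<open>Gamma\<close> are stated as upper bounds for the entire function \<open>rGamma\<close>, for which poles are no
  exception.
\<close>

abbreviation Gamma_decay :: "real \<Rightarrow> bool" where
  "Gamma_decay \<sigma> \<equiv> vertical_bound (\<lambda>v. Gamma (Complex \<sigma> v)) (\<sigma> - 1/2) (pi / 2)"

abbreviation rGamma_growth :: "real \<Rightarrow> bool" where
  "rGamma_growth \<sigma> \<equiv> vertical_bound (\<lambda>v. rGamma (Complex \<sigma> v)) (1/2 - \<sigma>) (- (pi / 2))"

lemma cosh_bounds: "exp \<bar>x\<bar> / 2 \<le> cosh (x::real)" "cosh x \<le> exp \<bar>x\<bar>"
  by (auto simp: cosh_field_def abs_if field_simps)

lemma Gamma_decay_half: "Gamma_decay (1/2)"
  unfolding vertical_bound_def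
proof (intro exI[of _ "sqrt (2 * pi)"] conjI allI)
  fix v :: real
  have "norm (Gamma (Complex (1/2) v)) ^ 2 \<le> pi / (exp \<bar>pi * v\<bar> / 2)"
    unfolding norm_Gamma_half using cosh_bounds(1)[of "pi * v"] by (intro divide_left_mono) auto
  also have "\<dots> = (sqrt (2 * pi) * exp (- (pi / 2 * \<bar>v\<bar>))) ^ 2"
  proof -
    have "exp (- (pi / 2 * \<bar>v\<bar>)) ^ 2 = exp (- (pi * \<bar>v\<bar>))"
      unfolding power2_eq_square mult_exp_exp by simp
    then show ?thesis
      unfolding power_mult_distrib by (simp add: abs_mult exp_minus field_simps)
  qed
  finally have "norm (Gamma (Complex (1/2) v)) \<le> sqrt (2 * pi) * exp (- (pi / 2 * \<bar>v\<bar>))"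
    by (rule power2_le_imp_le) simp
  then show "norm (Gamma (Complex (1/2) v)) \<le> sqrt (2 * pi) * ((1 + \<bar>v\<bar>) powr (1/2 - 1/2) * exp (- (pi / 2 * \<bar>v\<bar>)))"
    by simp
qed simp

lemma rGamma_growth_half: "rGamma_growth (1/2)"
  unfolding vertical_bound_def
proof (intro exI[of _ "1"] conjI allI)
  fix v :: real
  have "norm (rGamma (Complex (1/2) v)) ^ 2 = inverse (norm (Gamma (Complex (1/2) v)) ^ 2)"
    by (simp add: rGamma_inverse_Gamma norm_inverse power_inverse)
  also have "\<dots> = cosh (pi * v) / pi" by (simp add: norm_Gamma_half)
  also have "\<dots> \<le> exp \<bar>pi * v\<bar> / 1"
    using cosh_bounds(2)[of "pi * v"] pi_ge_two by (intro frac_le) auto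
  also have "\<dots> = exp (pi / 2 * \<bar>v\<bar>) ^ 2"
    unfolding power2_eq_square mult_exp_exp by (simp add: abs_mult)
  finally have "norm (rGamma (Complex (1/2) v)) \<le> exp (pi / 2 * \<bar>v\<bar>)"
    by (rule power2_le_imp_le) simp
  then show "norm (rGamma (Complex (1/2) v)) \<le> 1 * ((1 + \<bar>v\<bar>) powr (1/2 - 1/2) * exp (- (- (pi / 2) * \<bar>v\<bar>)))"
    by simp
qed simp

lemma Complex_plus_1: "Complex (\<sigma> + 1) v = Complex \<sigma> v + 1"
  by (simp add: complex_eq_iff)

lemma Gamma_rGamma_Complex: "\<sigma> > 0 \<Longrightarrow> Gamma (Complex \<sigma> v) * rGamma (Complex \<sigma> v) = 1"
  using Re_pos_notin_nonpos_Ints[of "Complex \<sigma> v"] by (simp add: Gamma_def rGamma_eq_zero_iff)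

lemma Gamma_decay_plus1:
  assumes "Gamma_decay \<sigma>" "\<sigma> > 0" shows "Gamma_decay (\<sigma> + 1)"
  using assms(2) Re_pos_notin_nonpos_Ints[of "Complex \<sigma> _"]
  by (intro vertical_bound_cong[OF vertical_bound_mult[OF vertical_bound_Complex[of \<sigma>] assms(1)]])
     (auto simp: Complex_plus_1 Gamma_plus1)

lemma Gamma_decay_minus:
  assumes "Gamma_decay (\<sigma> + \<kappa>)" "\<sigma> > 0" "0 < \<kappa>" "\<kappa> < 1" shows "Gamma_decay \<sigma>"
proof (rule vertical_bound_cong[OF vertical_bound_mult[OF Gamma_vertical_ratio[OF assms(3,4,2)] assms(1)]])
  fix v show "Gamma (Complex \<sigma> v) = Gamma (Complex \<sigma> v) * rGamma (Complex (\<sigma> + \<kappa>) v) * Gamma (Complex (\<sigma> + \<kappa>) v)"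
    using Gamma_rGamma_Complex[of "\<sigma> + \<kappa>" v] assms by (simp add: mult_ac)
qed auto

lemma rGamma_growth_plus1:
  assumes "rGamma_growth \<sigma>" "\<sigma> > 0" shows "rGamma_growth (\<sigma> + 1)"
proof (rule vertical_bound_cong[OF vertical_bound_mult[OF vertical_bound_inverse_Complex[OF assms(2)] assms(1)]])
  fix v show "rGamma (Complex (\<sigma> + 1) v) = inverse (Complex \<sigma> v) * rGamma (Complex \<sigma> v)"
    using assms rGamma_plus1[of "Complex \<sigma> v", symmetric] by (simp add: Complex_plus_1 Complex_eq_0)
qed auto

lemma rGamma_growth_minus1:
  assumes "rGamma_growth (\<sigma> + 1)" shows "rGamma_growth \<sigma>"
  by (rule vertical_bound_cong[OF vertical_bound_mult[OF vertical_bound_Complex[of \<sigma>] assms]])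
     (auto simp: Complex_plus_1 rGamma_plus1)

lemma rGamma_growth_add:
  assumes "rGamma_growth \<sigma>" "\<sigma> > 0" "0 < \<kappa>" "\<kappa> < 1" shows "rGamma_growth (\<sigma> + \<kappa>)"
proof (rule vertical_bound_cong[OF vertical_bound_mult[OF Gamma_vertical_ratio[OF assms(3,4,2)] assms(1)]])
  fix v show "rGamma (Complex (\<sigma> + \<kappa>) v) = Gamma (Complex \<sigma> v) * rGamma (Complex (\<sigma> + \<kappa>) v) * rGamma (Complex \<sigma> v)"
    using Gamma_rGamma_Complex[of \<sigma> v] assms by (simp add: mult_ac)
qed auto

lemma Gamma_decay_half_plus: "Gamma_decay (1/2 + real n)"
proof (induction n)
  case (Suc n)
  then show ?case using Gamma_decay_plus1[of "1/2 + real n"] by (simp add: add_ac)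
qed (use Gamma_decay_half in simp)

lemma rGamma_growth_half_plus: "rGamma_growth (1/2 + real n)"
proof (induction n)
  case (Suc n)
  then show ?case using rGamma_growth_plus1[of "1/2 + real n"] by (simp add: add_ac)
qed (use rGamma_growth_half in simp)

text \<open>
  From a half-integer line \<open>1/2 + n\<close> to the right of \<open>\<sigma>\<close>, at distance less than \<open>1\<close>, the quotient bound
  leads back to \<open>\<sigma>\<close>.
\<close>

theorem Gamma_decay: 
  assumes "\<sigma> > 0" shows "Gamma_decay \<sigma>"
proof -
  define n where "n = nat \<lceil>\<sigma> - 1/2\<rceil>"
  have n: "\<sigma> \<le> 1/2 + real n" "1/2 + real n < \<sigma> + 1"
    using assms unfolding n_def by linarith+
  show ?thesis
  proof (cases "\<sigma> = 1/2 + real n")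
    case False
    then show ?thesis
      using n assms Gamma_decay_half_plus[of n] by (intro Gamma_decay_minus[of \<sigma> "1/2 + real n - \<sigma>"]) auto
  qed (use Gamma_decay_half_plus in simp)
qed

text \<open>
  For \<open>\<sigma> \<ge> 1/2\<close> the starting line is now the half-integer to the left of \<open>\<sigma>\<close>; for smaller \<open>\<sigma>\<close> the
  functional equation \<open>rGamma z = z * rGamma (z + 1)\<close> applies without exceptional points.
\<close>

theorem rGamma_growth: "rGamma_growth \<sigma>"
proof -
  have ge: "rGamma_growth \<sigma>" if "\<sigma> \<ge> 1/2" for \<sigma>
  proof -
    define n where "n = nat \<lfloor>\<sigma> - 1/2\<rfloor>"
    have n: "1/2 + real n \<le> \<sigma>" "\<sigma> < 1/2 + real n + 1"
      using that unfolding n_def by linarith+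
    show ?thesis
    proof (cases "\<sigma> = 1/2 + real n")
      case False
      then show ?thesis
        using n rGamma_growth_add[of "1/2 + real n" "\<sigma> - (1/2 + real n)"] rGamma_growth_half_plus[of n] by auto
    qed (use rGamma_growth_half_plus in simp)
  qed
  have "rGamma_growth (\<sigma> + real n) \<Longrightarrow> rGamma_growth \<sigma>" for n
  proof (induction n)
    case (Suc n)
    then show ?case using rGamma_growth_minus1[of "\<sigma> + real n"] by (simp add: add_ac)
  qed simp
  moreover obtain n where "1/2 - \<sigma> \<le> real n" using real_arch_simple by blast
  ultimately show ?thesis using ge[of "\<sigma> + real n"] by simp
qed

section \<open>Growth of the integrand of the I-function\<close>

lemma vertical_line_eq_Complex:
  "w + of_real c * (\<i> * of_real \<tau>) = Complex (Re w) (Im w + c * \<tau>)"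
  by (simp add: complex_eq_iff)

lemma vertical_bound_Gamma:
  assumes "Re w > 0" "c \<noteq> 0"
  shows "vertical_bound (\<lambda>\<tau>. Gamma (w + of_real c * (\<i> * of_real \<tau>))) (Re w - 1/2) (pi / 2 * \<bar>c\<bar>)"
  by (rule vertical_bound_cong[OF vertical_bound_affine[OF Gamma_decay[OF assms(1)] assms(2), of "Im w"]])
     (simp_all add: vertical_line_eq_Complex)

lemma vertical_bound_rGamma:
  assumes "c \<noteq> 0"
  shows "vertical_bound (\<lambda>\<tau>. rGamma (w + of_real c * (\<i> * of_real \<tau>))) (1/2 - Re w) (- (pi / 2 * \<bar>c\<bar>))"
  by (rule vertical_bound_cong[OF vertical_bound_affine[OF rGamma_growth[of "Re w"] assms, of "Im w"]])
     (simp_all add: vertical_line_eq_Complex)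

text \<open>
  The modulus of \<open>\<Gamma> powr \<kappa>\<close> does not depend on the branch of the logarithm. The conventions at the
  poles agree: both sides vanish there, by \<open>Gamma z = 0\<close> or \<open>rGamma z = 0\<close> and \<open>0 powr \<kappa> = 0\<close>.
\<close>

lemma norm_Gamma_power:
  assumes "is_log_Gamma_family br" "c \<noteq> 0" "Re s = 0"
  shows "norm (Gamma_power br w c \<kappa> s) = norm (Gamma (w + of_real c * s)) powr \<kappa>"
    and "norm (inverse (Gamma_power br w c \<kappa> s)) = norm (rGamma (w + of_real c * s)) powr \<kappa>"
proof -
  show 1: "norm (Gamma_power br w c \<kappa> s) = norm (Gamma (w + of_real c * s)) powr \<kappa>"
  proof (cases "w + of_real c * s \<in> \<int>\<^sub>\<le>\<^sub>0")
    case False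
    then have "exp (br w c \<kappa> s) = Gamma (w + of_real c * s)"
      using assms unfolding is_log_Gamma_family_def by blast
    then have "norm (Gamma (w + of_real c * s)) = exp (Re (br w c \<kappa> s))" by (metis norm_exp_eq_Re)
    then show ?thesis using False by (simp add: Gamma_power_def exp_powr_real mult.commute)
  qed (simp add: Gamma_power_def Gamma_eq_zero_iff)
  show "norm (inverse (Gamma_power br w c \<kappa> s)) = norm (rGamma (w + of_real c * s)) powr \<kappa>"
    unfolding norm_inverse 1 by (simp add: rGamma_inverse_Gamma norm_inverse inverse_powr)
qed

lemma vertical_bound_Gamma_power:
  assumes "is_log_Gamma_family br" "c \<noteq> 0" "\<kappa> > 0"
  shows "Re w > 0 \<Longrightarrow> vertical_bound (\<lambda>\<tau>. Gamma_power br w c \<kappa> (\<i> * of_real \<tau>)) (\<kappa> * (Re w - 1/2)) (\<kappa> * (pi / 2 * \<bar>c\<bar>))"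
    and "vertical_bound (\<lambda>\<tau>. inverse (Gamma_power br w c \<kappa> (\<i> * of_real \<tau>))) (\<kappa> * (1/2 - Re w)) (\<kappa> * - (pi / 2 * \<bar>c\<bar>))"
  using assms norm_Gamma_power[OF assms(1,2)]
  by (intro vertical_bound_powr[OF vertical_bound_Gamma] vertical_bound_powr[OF vertical_bound_rGamma]; simp)+

lemma inverse_prod_list: "inverse (prod_list xs) = (\<Prod>x\<leftarrow>xs. inverse (x :: 'a :: field))"
  by (induction xs) auto

text \<open>
  The contour separates the poles exactly when the arguments of the numerator Gamma functions have positive
  real part at \<open>s = 0\<close>; evaluate the condition at the rightmost (leftmost) pole.
\<close>

lemma I_parametersD:
  assumes "I_parameters m n us ls"
  shows "(a, A, \<alpha>) \<in> set us \<Longrightarrow> A > 0 \<and> \<alpha> > 0" "(b, B, \<beta>) \<in> set ls \<Longrightarrow> B > 0 \<and> \<beta> > 0"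
    and "(b, B, \<beta>) \<in> set (take m ls) \<Longrightarrow> Re b > 0"
    and "(a, A, \<alpha>) \<in> set (take n us) \<Longrightarrow> Re (1 - a) > 0"
proof -
  show u: "A > 0 \<and> \<alpha> > 0" if "(a, A, \<alpha>) \<in> set us" for a A \<alpha>
    using assms that unfolding I_parameters_def by blast
  show l: "B > 0 \<and> \<beta> > 0" if "(b, B, \<beta>) \<in> set ls" for b B \<beta>
    using assms that unfolding I_parameters_def by blast
  show "Re b > 0" if h: "(b, B, \<beta>) \<in> set (take m ls)"
  proof -
    have B: "B > 0" using l[OF in_set_takeD[OF h]] by simp
    have "\<forall>s. b + of_real B * s \<in> \<int>\<^sub>\<le>\<^sub>0 \<longrightarrow> Re s < 0"
      using assms h unfolding I_parameters_def by blast
    moreover have "b + of_real B * (- b / of_real B) \<in> \<int>\<^sub>\<le>\<^sub>0" using B by simp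
    ultimately have "Re (- b / of_real B) < 0" by blast
    then show ?thesis using B by (simp add: zero_less_divide_iff)
  qed
  show "Re (1 - a) > 0" if h: "(a, A, \<alpha>) \<in> set (take n us)"
  proof -
    have A: "A > 0" using u[OF in_set_takeD[OF h]] by simp
    have "\<forall>s. 1 - a - of_real A * s \<in> \<int>\<^sub>\<le>\<^sub>0 \<longrightarrow> Re s > 0"
      using assms h unfolding I_parameters_def by blast
    moreover have "1 - a - of_real A * ((1 - a) / of_real A) \<in> \<int>\<^sub>\<le>\<^sub>0" using A by simp
    ultimately have "Re ((1 - a) / of_real A) > 0" by blast
    then show ?thesis using A by (simp add: zero_less_divide_iff)
  qed
qed

lemma sum_list_take_drop: "sum_list (map f (take k xs)) + sum_list (map f (drop k xs)) = (sum_list (map f xs) :: real)"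
  by (metis append_take_drop_id map_append sum_list_append)

text \<open>
  Adding up the orders of the individual factors produces the two numbers in the convergence conditions.
\<close>

theorem I_chi_vertical_bound:
  assumes br: "is_log_Gamma_family br" and par: "I_parameters m n us ls"
  shows "vertical_bound (\<lambda>\<tau>. I_chi br m n us ls (\<i> * of_real \<tau>)) (I_Omega us ls) (pi / 2 * I_Delta m n us ls)"
proof -
  note P = I_parametersD[OF par]
  let ?s = "\<lambda>\<tau>. \<i> * complex_of_real \<tau>"
  have 1: "vertical_bound (\<lambda>\<tau>. \<Prod>x\<leftarrow>take m ls. (case x of (b, B, \<beta>) \<Rightarrow> Gamma_power br b B \<beta> (?s \<tau>)))
      (\<Sum>x\<leftarrow>take m ls. (case x of (b, B, \<beta>) \<Rightarrow> \<beta> * (Re b - 1/2)))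
      (\<Sum>x\<leftarrow>take m ls. (case x of (b, B, \<beta>) \<Rightarrow> pi / 2 * (\<beta> * B)))"
  proof (rule vertical_bound_prod_list, goal_cases)
    case x: (1 x)
    obtain b B \<beta> where [simp]: "x = (b, B, \<beta>)" by (cases x)
    show ?case
      using vertical_bound_Gamma_power(1)[OF br, of B \<beta> b] P(2)[of b B \<beta>] P(3)[of b B \<beta>] x in_set_takeD[OF x]
      by (simp add: mult_ac)
  qed
  have 2: "vertical_bound (\<lambda>\<tau>. \<Prod>x\<leftarrow>take n us. (case x of (a, A, \<alpha>) \<Rightarrow> Gamma_power br (1 - a) (- A) \<alpha> (?s \<tau>)))
      (\<Sum>x\<leftarrow>take n us. (case x of (a, A, \<alpha>) \<Rightarrow> (1/2 - Re a) * \<alpha>))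
      (\<Sum>x\<leftarrow>take n us. (case x of (a, A, \<alpha>) \<Rightarrow> pi / 2 * (\<alpha> * A)))"
  proof (rule vertical_bound_prod_list, goal_cases)
    case x: (1 x)
    obtain a A \<alpha> where [simp]: "x = (a, A, \<alpha>)" by (cases x)
    show ?case
      using vertical_bound_Gamma_power(1)[OF br, of "- A" \<alpha> "1 - a"] P(1)[of a A \<alpha>] P(4)[of a A \<alpha>] x in_set_takeD[OF x]
      by (simp add: algebra_simps)
  qed
  have 3: "vertical_bound (\<lambda>\<tau>. \<Prod>x\<leftarrow>drop m ls. inverse (case x of (b, B, \<beta>) \<Rightarrow> Gamma_power br (1 - b) (- B) \<beta> (?s \<tau>)))
      (\<Sum>x\<leftarrow>drop m ls. (case x of (b, B, \<beta>) \<Rightarrow> \<beta> * (Re b - 1/2)))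
      (\<Sum>x\<leftarrow>drop m ls. - (case x of (b, B, \<beta>) \<Rightarrow> pi / 2 * (\<beta> * B)))"
  proof (rule vertical_bound_prod_list, goal_cases)
    case x: (1 x)
    obtain b B \<beta> where [simp]: "x = (b, B, \<beta>)" by (cases x)
    show ?case
      using vertical_bound_Gamma_power(2)[OF br, of "- B" \<beta> "1 - b"] P(2)[of b B \<beta>] in_set_dropD[OF x]
      by (simp add: algebra_simps)
  qed
  have 4: "vertical_bound (\<lambda>\<tau>. \<Prod>x\<leftarrow>drop n us. inverse (case x of (a, A, \<alpha>) \<Rightarrow> Gamma_power br a A \<alpha> (?s \<tau>)))
      (\<Sum>x\<leftarrow>drop n us. (case x of (a, A, \<alpha>) \<Rightarrow> (1/2 - Re a) * \<alpha>))
      (\<Sum>x\<leftarrow>drop n us. - (case x of (a, A, \<alpha>) \<Rightarrow> pi / 2 * (\<alpha> * A)))"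
  proof (rule vertical_bound_prod_list, goal_cases)
    case x: (1 x)
    obtain a A \<alpha> where [simp]: "x = (a, A, \<alpha>)" by (cases x)
    show ?case
      using vertical_bound_Gamma_power(2)[OF br, of A \<alpha> a] P(1)[of a A \<alpha>] in_set_dropD[OF x]
      by (simp add: algebra_simps)
  qed
  note all = vertical_bound_mult[OF vertical_bound_mult[OF 1 2] vertical_bound_mult[OF 3 4]]
  have eqf: "I_chi br m n us ls (?s \<tau>) =
      ((\<Prod>x\<leftarrow>take m ls. (case x of (b, B, \<beta>) \<Rightarrow> Gamma_power br b B \<beta> (?s \<tau>))) *
       (\<Prod>x\<leftarrow>take n us. (case x of (a, A, \<alpha>) \<Rightarrow> Gamma_power br (1 - a) (- A) \<alpha> (?s \<tau>)))) *
      ((\<Prod>x\<leftarrow>drop m ls. inverse (case x of (b, B, \<beta>) \<Rightarrow> Gamma_power br (1 - b) (- B) \<beta> (?s \<tau>))) *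
       (\<Prod>x\<leftarrow>drop n us. inverse (case x of (a, A, \<alpha>) \<Rightarrow> Gamma_power br a A \<alpha> (?s \<tau>))))" for \<tau>
    unfolding I_chi_def divide_inverse inverse_mult_distrib inverse_prod_list map_map o_def by simp
  have minus: "(\<Sum>x\<leftarrow>xs. - f x) = - (\<Sum>x\<leftarrow>xs. f x :: real)" for f :: "I_triple \<Rightarrow> real" and xs
    by (induction xs) auto
  have mult: "(\<Sum>x\<leftarrow>xs. case x of (b, B, \<beta>) \<Rightarrow> pi / 2 * (\<beta> * B)) = pi / 2 * (\<Sum>(b, B, \<beta>)\<leftarrow>xs. \<beta> * B)" for xs :: "I_triple list"
    by (induction xs) (auto simp: algebra_simps)
  have neg: "(\<Sum>x\<leftarrow>xs. case x of (b, B, \<beta>) \<Rightarrow> \<beta> * (Re b - 1/2)) = - (\<Sum>(b, B, \<beta>)\<leftarrow>xs. (1/2 - Re b) * \<beta>)" for xs :: "I_triple list"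
    by (induction xs) (auto simp: algebra_simps)
  have cong: "vertical_bound h e d \<Longrightarrow> e = e' \<Longrightarrow> d = d' \<Longrightarrow> vertical_bound h e' d'" for h e d e' d'
    by simp
  show ?thesis
    unfolding eqf
  proof (rule cong[OF all])
  qed (simp_all only: minus mult neg I_Delta_def I_Omega_def, simp_all add: algebra_simps flip: sum_list_take_drop[of _ m ls] sum_list_take_drop[of _ n us])
qed

section \<open>The Saigo kernel against a Mellin-Barnes integral\<close>

text \<open>
  Differentiation under the integral sign: the remainder of the linear approximation, divided by the
  increment, is at most \<open>2 * D\<close> by the mean value inequality, so dominated convergence applies.
\<close>

theorem has_vector_derivative_integral:
  fixes Q Q' :: "'a \<Rightarrow> real \<Rightarrow> 'b :: {banach, second_countable_topology}"
  assumes t0: "t0 \<in> {a<..<b}"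
    and int: "\<And>t. t \<in> {a<..<b} \<Longrightarrow> integrable M (\<lambda>\<tau>. Q \<tau> t)"
    and meas: "(\<lambda>\<tau>. Q' \<tau> t0) \<in> borel_measurable M"
    and der: "\<And>\<tau> t. t \<in> {a<..<b} \<Longrightarrow> (Q \<tau> has_vector_derivative Q' \<tau> t) (at t)"
    and bound: "\<And>\<tau> t. t \<in> {a<..<b} \<Longrightarrow> norm (Q' \<tau> t) \<le> D \<tau>"
    and D: "integrable M D"
  shows "((\<lambda>t. \<integral>\<tau>. Q \<tau> t \<partial>M) has_vector_derivative (\<integral>\<tau>. Q' \<tau> t0 \<partial>M)) (at t0)"
proof -
  have int': "integrable M (\<lambda>\<tau>. Q' \<tau> t0)"
    by (rule Bochner_Integration.integrable_bound[OF D meas]) (use bound[OF t0] in \<open>auto intro!: AE_I2 order_trans[OF _ abs_ge_self]\<close>)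
  let ?R = "\<lambda>y. (1 / norm (y - t0)) *\<^sub>R ((\<integral>\<tau>. Q \<tau> y \<partial>M) - ((\<integral>\<tau>. Q \<tau> t0 \<partial>M) + (y - t0) *\<^sub>R (\<integral>\<tau>. Q' \<tau> t0 \<partial>M)))"
  have "(?R \<longlongrightarrow> 0) (at t0 within {a<..<b})"
    unfolding tendsto_at_iff_sequentially
  proof (intro allI impI)
    fix X assume X: "\<forall>i. X i \<in> {a<..<b} - {t0}" "X \<longlonglongrightarrow> t0"
    define E where "E = (\<lambda>i \<tau>. (1 / norm (X i - t0)) *\<^sub>R (Q \<tau> (X i) - (Q \<tau> t0 + (X i - t0) *\<^sub>R Q' \<tau> t0)))"
    have Ei: "integrable M (E i)" for i
      unfolding E_def using X t0 by (intro integrable_scaleR_right Bochner_Integration.integrable_diff Bochner_Integration.integrable_add int int') auto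
    have "(\<lambda>i. \<integral>\<tau>. E i \<tau> \<partial>M) \<longlonglongrightarrow> (\<integral>\<tau>. 0 \<partial>M)"
    proof (rule integral_dominated_convergence[where w = "\<lambda>\<tau>. 2 * D \<tau>"])
      show "AE \<tau> in M. (\<lambda>i. E i \<tau>) \<longlonglongrightarrow> 0"
      proof (rule AE_I2)
        fix \<tau>
        have "(Q \<tau> has_derivative (\<lambda>h. h *\<^sub>R Q' \<tau> t0)) (at t0 within {a<..<b})"
          using der[OF t0, of \<tau>] unfolding has_vector_derivative_def by (rule has_derivative_at_withinI)
        then show "(\<lambda>i. E i \<tau>) \<longlonglongrightarrow> 0"
          using X unfolding has_derivative_within tendsto_at_iff_sequentially E_def by (auto simp: o_def)
      qed
      show "AE \<tau> in M. norm (E i \<tau>) \<le> 2 * D \<tau>" for i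
      proof (rule AE_I2)
        fix \<tau>
        have Xi: "X i \<in> {a<..<b}" "X i \<noteq> t0" using X by auto
        have "norm (Q \<tau> (X i) - Q \<tau> t0 - (X i - t0) *\<^sub>R Q' \<tau> t0) \<le> norm (X i - t0) * (2 * D \<tau>)"
        proof (rule vector_differentiable_bound_linearization[where S = "{a<..<b}"])
          show "closed_segment t0 (X i) \<subseteq> {a<..<b}"
            using t0 Xi by (intro closed_segment_subset) auto
          show "norm (Q' \<tau> x - Q' \<tau> t0) \<le> 2 * D \<tau>" if "x \<in> {a<..<b}" for x
            using norm_triangle_ineq4[of "Q' \<tau> x" "Q' \<tau> t0"] bound[OF that, of \<tau>] bound[OF t0, of \<tau>] by simp
        qed (use t0 der in \<open>auto intro: has_vector_derivative_at_within\<close>)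
        moreover have "\<bar>1 / n\<bar> * A \<le> B" if "A \<le> n * B" "n > 0" for n A B :: real
          using that by (simp add: field_simps)
        ultimately show "norm (E i \<tau>) \<le> 2 * D \<tau>"
          using Xi(2) unfolding E_def norm_scaleR diff_diff_eq[symmetric] real_norm_def by simp
      qed
    qed (use Ei D in auto)
    moreover have "(\<integral>\<tau>. E i \<tau> \<partial>M) =
       ?R (X i)" for i
      unfolding E_def using X t0 int int' by simp
    ultimately show "(?R \<circ> X) \<longlonglongrightarrow> 0"
      by (simp add: o_def)
  qed
  then have "((\<lambda>t. \<integral>\<tau>. Q \<tau> t \<partial>M) has_derivative (\<lambda>h. h *\<^sub>R (\<integral>\<tau>. Q' \<tau> t0 \<partial>M))) (at t0 within {a<..<b})"
    unfolding has_derivative_within by (auto intro: bounded_linear_intros)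
  then show ?thesis
    using t0 unfolding has_vector_derivative_def by (simp add: at_within_open[OF t0])
qed

text \<open>
  The kernel is the restriction of a function that is holomorphic on the intersection of the unit disc
  about \<open>1\<close> with the half plane \<open>Re z < 1\<close>; the half plane avoids the branch cut of \<open>(1 - z) powr (c - 1)\<close>.
\<close>

lemma saigo_kernel_C1:
  assumes "Re c > 0"
  obtains k' where "continuous_on {0<..<1} k'"
    "\<And>t. t \<in> {0<..<1} \<Longrightarrow> (saigo_kernel a b c has_vector_derivative k' t) (at t)"
proof -
  define U where "U = ball (1::complex) 1 \<inter> {z. Re z < 1}"
  define k where "k = (\<lambda>z. (1 - z) powr (c - 1) * hypergeom_2F1 a b c (1 - z))"
  have oU: "open U" unfolding U_def by (intro open_Int open_ball open_halfspace_Re_lt)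
  have c: "c \<notin> \<int>\<^sub>\<le>\<^sub>0" using assms by (rule Re_pos_notin_nonpos_Ints)
  have "(hypergeom_2F1 a b c \<circ> (\<lambda>z. 1 - z)) holomorphic_on U"
    by (intro holomorphic_on_compose_gen[OF _ hypergeom_2F1_holomorphic[OF c]] holomorphic_intros)
       (auto simp: U_def dist_norm norm_minus_commute)
  then have hol: "k holomorphic_on U"
    unfolding k_def by (intro holomorphic_intros) (auto simp: o_def U_def complex_nonpos_Reals_iff)
  have inU: "complex_of_real t \<in> U" if "t \<in> {0<..<1}" for t
  proof -
    have "dist 1 (complex_of_real t) = \<bar>1 - t\<bar>" by (metis dist_norm norm_of_real of_real_1 of_real_diff)
    then show ?thesis using that by (simp add: U_def)
  qed
  show ?thesis
  proof (rule that[of "\<lambda>t. deriv k (of_real t)"])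
    have "continuous_on U (deriv k)"
      by (intro holomorphic_on_imp_continuous_on holomorphic_deriv hol oU)
    then show "continuous_on {0<..<1} (\<lambda>t. deriv k (complex_of_real t))"
      by (rule continuous_on_compose2) (use inU in \<open>auto intro: continuous_intros\<close>)
    fix t :: real assume t: "t \<in> {0<..<1}"
    have "(k has_field_derivative deriv k (of_real t)) (at (of_real t))"
      by (rule holomorphic_derivI[OF hol oU inU[OF t]])
    from field_vector_diff_chain_at[OF has_vector_derivative_of_real[OF DERIV_ident] this]
    have "(k \<circ> complex_of_real has_vector_derivative deriv k (of_real t)) (at t)" by simp
    moreover have "k \<circ> complex_of_real = saigo_kernel a b c"
      by (auto simp: k_def saigo_kernel_def)
    ultimately show "(saigo_kernel a b c has_vector_derivative deriv k (of_real t)) (at t)" by simp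
  qed
qed

text \<open>
  The bound on \<open>H\<close> is too weak to differentiate the integral defining \<open>g\<close> under the integral sign, as this would
  need the weight \<open>1 + \<bar>\<tau>\<bar>\<close> in place of its power with exponent \<open>\<delta>\<close>; the derivative \<open>g'\<close> is only assumed to exist. In \<open>\<Phi>\<close> the factor \<open>r \<tau>\<close> of
  that derivative is compensated by the oscillation estimate, and the difference \<open>\<Phi> - k g\<close> is the integral of
  \<open>Q\<close>, in whose derivative the factor \<open>r \<tau>\<close> has cancelled. The integral obtained is
  a Henstock-Kurzweil integral, since \<open>k g'\<close> need not be absolutely integrable.
\<close>

theorem saigo_kernel_mellin_integral:
  fixes H g' :: "real \<Rightarrow> complex" and r0 :: complex and \<mu> :: real
  defines "r \<equiv> \<lambda>\<tau>. r0 - \<i> * of_real (\<mu> * \<tau>)"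
  assumes R: "Re r0 > 0" and \<mu>: "\<mu> \<noteq> 0"
    and \<delta>: "0 < \<delta>" "\<delta> < 1" and c: "1 - \<delta> \<le> Re c"
    and s: "Re (r0 + c - a - b) > 0"
    and Hm [measurable]: "H \<in> borel_measurable borel"
    and Hi: "integrable lborel (\<lambda>\<tau>. norm (H \<tau>) * (1 + \<bar>\<tau>\<bar>) powr \<delta>)"
    and g': "\<And>t. t \<in> {0<..<1} \<Longrightarrow> ((\<lambda>t. \<integral>\<tau>. H \<tau> * of_real t powr r \<tau> \<partial>lborel) has_vector_derivative g' t) (at t)"
  shows "((\<lambda>t. saigo_kernel a b c t * g' t) has_integral
     (\<integral>\<tau>. H \<tau> * (r \<tau> * (Gamma c * Gamma (r \<tau>) * Gamma (r \<tau> + c - a - b) * rGamma (r \<tau> + c - a) * rGamma (r \<tau> + c - b))) \<partial>lborel)) {0..1}" (is "(_ has_integral ?V) _")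
proof -
  define k where "k = saigo_kernel a b c"
  define R where "R = Re r0"
  have R0: "R > 0" using R by (simp add: R_def)
  have c0: "Re c > 0" using c \<delta> by simp
  have rC: "r \<tau> = Complex R (Im r0 + (- \<mu>) * \<tau>)" for \<tau>
    by (simp add: r_def R_def complex_eq_iff)
  have Rer: "Re (r \<tau>) = R" for \<tau> by (simp add: rC)
  obtain k' where k': "continuous_on {0<..<1} k'"
    "\<And>t. t \<in> {0<..<1} \<Longrightarrow> (k has_vector_derivative k' t) (at t)"
    using saigo_kernel_C1[OF c0] unfolding k_def by blast
  have kc: "continuous_on {0<..<1} k"
    by (intro continuous_at_imp_continuous_on ballI) (rule has_vector_derivative_continuous[OF k'(2)])
  define L where "L = (\<lambda>\<tau> t. LINT s:{0<..<t}|lborel. k s * of_real s powr (r \<tau> - 1))"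
  define J where "J = (\<lambda>\<tau> t. r \<tau> * L \<tau> t)"
  let ?e = "\<lambda>\<tau> s. k s * of_real s powr (r \<tau> - 1)"
  have ii: "set_integrable lborel {0<..<1} (?e \<tau>)" for \<tau>
    unfolding k_def using s R by (intro saigo_kernel_termwise(1) c0) (auto simp: Rer R_def)
  have Lint: "L \<tau> t = integral {0..t} (?e \<tau>)" if "t \<in> {0..1}" for \<tau> t
  proof -
    have "set_integrable lborel {0<..<t} (?e \<tau>)"
      by (rule set_integrable_subset[OF ii]) (use that in auto)
    then show ?thesis unfolding L_def
      by (simp add: set_borel_integral_eq_integral(2) integral_open_interval_real)
  qed
  have io: "(?e \<tau>) integrable_on {0..1}" for \<tau>
    using set_borel_integral_eq_integral(1)[OF ii] by (simp add: integrable_on_Icc_iff_Ioo)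
  obtain CJ where CJ: "CJ \<ge> 0" "\<And>\<tau> t. t \<in> {0..1} \<Longrightarrow> norm (J \<tau> t) \<le> CJ * (1 + \<bar>\<tau>\<bar>) powr \<delta>"
  proof -
    obtain C where C: "C \<ge> 0" "\<And>v t. t \<in> {0..1} \<Longrightarrow>
     norm (Complex R v * (LINT s:{0<..<t}|lborel. saigo_kernel a b c s * of_real s powr (Complex R v - 1)))
       \<le> C * (1 + \<bar>v\<bar>) powr \<delta>"
      using saigo_kernel_oscillation[OF R0 \<delta> c, of a b] s by (auto simp: R_def add_ac)
    obtain D where D: "D \<ge> 0" "\<And>\<tau>. (1 + \<bar>Im r0 + (- \<mu>) * \<tau>\<bar>) powr \<delta> \<le> D * (1 + \<bar>\<tau>\<bar>) powr \<delta>"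
      using one_plus_abs_affine_powr[of "- \<mu>"] \<mu> by auto
    show ?thesis
    proof (rule that[of "C * D"])
      fix \<tau> t :: real assume "t \<in> {0..1}"
      from C(2)[OF this, of "Im r0 + (- \<mu>) * \<tau>"] 
      have "norm (J \<tau> t) \<le> C * (1 + \<bar>Im r0 + (- \<mu>) * \<tau>\<bar>) powr \<delta>"
        unfolding rC[symmetric] J_def L_def k_def .
      also have "\<dots> \<le> C * (D * (1 + \<bar>\<tau>\<bar>) powr \<delta>)" by (intro mult_left_mono D C)
      finally show "norm (J \<tau> t) \<le> C * D * (1 + \<bar>\<tau>\<bar>) powr \<delta>" by (simp add: mult.assoc)
    qed (use C D in simp)
  qed
  \<comment> \<open>Writing the power as an exponential exhibits the joint measurability in \<open>\<tau>\<close> and \<open>s\<close>.\<close>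
  have Lm: "(\<lambda>\<tau>. L \<tau> t) \<in> borel_measurable borel" if t: "t \<in> {0..1}" for t
  proof -
    define k0 where "k0 = (\<lambda>s. indicator {0<..<t} s *\<^sub>R k s)"
    have [measurable]: "k0 \<in> borel_measurable borel"
      unfolding k0_def
      by (intro borel_measurable_continuous_on_indicator continuous_on_subset[OF kc]) (use t in auto)
    have "L \<tau> t = (\<integral>s. k0 s * exp ((r \<tau> - 1) * of_real (ln s)) \<partial>lborel)" for \<tau>
      unfolding L_def set_lebesgue_integral_def k0_def
      by (intro Bochner_Integration.integral_cong) (auto simp: indicator_def powr_def Ln_of_real)
    moreover have "(\<lambda>\<tau>. \<integral>s. k0 s * exp ((r \<tau> - 1) * of_real (ln s)) \<partial>lborel) \<in> borel_measurable borel"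
      unfolding r_def by measurable
    ultimately show ?thesis by simp
  qed
  have rm [measurable]: "r \<in> borel_measurable borel" unfolding r_def by measurable
  have Jm: "(\<lambda>\<tau>. J \<tau> t) \<in> borel_measurable borel" if t: "t \<in> {0..1}" for t
    unfolding J_def using Lm[OF t] by measurable
  define w where "w = (\<lambda>\<tau>. CJ * (norm (H \<tau>) * (1 + \<bar>\<tau>\<bar>) powr \<delta>))"
  have w: "integrable lborel w" unfolding w_def by (intro integrable_mult_right Hi)
  have HJw: "norm (H \<tau> * J \<tau> t) \<le> w \<tau>" if "t \<in> {0..1}" for \<tau> t
    using mult_left_mono[OF CJ(2)[OF that, of \<tau>], of "norm (H \<tau>)"] by (simp add: w_def norm_mult mult_ac)
  have HJi: "integrable lborel (\<lambda>\<tau>. H \<tau> * J \<tau> t)" if t: "t \<in> {0..1}" for t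
    by (rule Bochner_Integration.integrable_bound[OF w])
       (use HJw[OF t] Jm[OF t] in \<open>auto intro!: AE_I2 order_trans[OF _ abs_ge_self]\<close>)
  have HiH: "integrable lborel H"
  proof (rule Bochner_Integration.integrable_bound[OF Hi])
    have "norm (H \<tau>) * 1 \<le> norm (H \<tau>) * (1 + \<bar>\<tau>\<bar>) powr \<delta>" for \<tau>
      using \<delta> by (intro mult_left_mono ge_one_powr_ge_zero) auto
    then show "AE \<tau> in lborel. norm (H \<tau>) \<le> norm (norm (H \<tau>) * (1 + \<bar>\<tau>\<bar>) powr \<delta>)" by auto
  qed simp
  have pw: "norm (of_real t powr r \<tau> :: complex) \<le> 1" if "t \<in> {0..1}" for t \<tau>
    using that R0 by (simp add: norm_of_real_powr Rer powr_le1)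
  have Hpi: "integrable lborel (\<lambda>\<tau>. H \<tau> * of_real t powr r \<tau>)" if t: "t \<in> {0<..<1}" for t
  proof (rule Bochner_Integration.integrable_bound[OF HiH])
    have "(\<lambda>\<tau>. H \<tau> * exp (r \<tau> * of_real (ln t))) \<in> borel_measurable borel" by measurable
    moreover have "of_real t powr r \<tau> = exp (r \<tau> * of_real (ln t))" for \<tau>
      using t by (auto simp: powr_def Ln_of_real)
    ultimately show "(\<lambda>\<tau>. H \<tau> * of_real t powr r \<tau>) \<in> borel_measurable lborel" by simp
    show "AE \<tau> in lborel. norm (H \<tau> * of_real t powr r \<tau>) \<le> norm (H \<tau>)"
      using pw[of t] t by (auto simp: norm_mult intro!: AE_I2 mult_left_le)
  qed
  define g where "g = (\<lambda>t. \<integral>\<tau>. H \<tau> * of_real t powr r \<tau> \<partial>lborel)"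
  define \<Phi> where "\<Phi> = (\<lambda>t. \<integral>\<tau>. H \<tau> * J \<tau> t \<partial>lborel)"
  have "((\<lambda>t. k t * g' t) has_integral \<Phi> 1 - \<Phi> 0) {0..1}"
  proof (rule fundamental_theorem_of_calculus_interior)
    show "continuous_on {0..1} \<Phi>"
      unfolding continuous_on_sequentially
    proof (intro allI ballI impI)
      fix X :: "nat \<Rightarrow> real" and t :: real
      assume t: "t \<in> {0..1}" and X: "(\<forall>n. X n \<in> {0..1}) \<and> X \<longlonglongrightarrow> t"
      have "(\<lambda>n. \<integral>\<tau>. H \<tau> * J \<tau> (X n) \<partial>lborel) \<longlonglongrightarrow> (\<integral>\<tau>. H \<tau> * J \<tau> t \<partial>lborel)"
      proof (rule integral_dominated_convergence[OF _ _ w])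
        show "AE \<tau> in lborel. (\<lambda>n. H \<tau> * J \<tau> (X n)) \<longlonglongrightarrow> H \<tau> * J \<tau> t"
        proof (rule AE_I2)
          fix \<tau>
          have "continuous_on {0..1} (L \<tau>)"
            using indefinite_integral_continuous_1[OF io[of \<tau>]] Lint by (subst continuous_on_cong[OF refl Lint]) auto
          then have "(\<lambda>n. L \<tau> (X n)) \<longlonglongrightarrow> L \<tau> t"
            using t X unfolding continuous_on_sequentially by (auto simp: o_def)
          then show "(\<lambda>n. H \<tau> * J \<tau> (X n)) \<longlonglongrightarrow> H \<tau> * J \<tau> t"
            unfolding J_def by (intro tendsto_intros)
        qed
      qed (use X t HJw HJi in \<open>auto\<close>)
      then show "(\<Phi> \<circ> X) \<longlonglongrightarrow> \<Phi> t" by (simp add: \<Phi>_def o_def)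
    qed
    fix t0 :: real assume t0: "t0 \<in> {0<..<1}"
    define \<alpha> \<beta> where "\<alpha> = t0 / 2" and "\<beta> = (1 + t0) / 2"
    have t0': "t0 \<in> {\<alpha><..<\<beta>}" and ab: "0 < \<alpha>" "\<beta> < 1" using t0 by (auto simp: \<alpha>_def \<beta>_def)
    have sub: "{\<alpha>..\<beta>} \<subseteq> {0<..<1}" using ab by auto
    have "bounded (k' ` {\<alpha>..\<beta>})"
      by (intro compact_imp_bounded compact_continuous_image continuous_on_subset[OF k'(1) sub]) simp
    then obtain M where M: "\<And>t. t \<in> {\<alpha>..\<beta>} \<Longrightarrow> norm (k' t) \<le> M"
      unfolding bounded_iff by blast
    define Q where "Q = (\<lambda>\<tau> t. H \<tau> * (J \<tau> t - k t * of_real t powr r \<tau>))"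
    define Q' where "Q' = (\<lambda>\<tau> t. - (k' t * (H \<tau> * of_real t powr r \<tau>)))"
    have Leib: "((\<lambda>t. \<integral>\<tau>. Q \<tau> t \<partial>lborel) has_vector_derivative (\<integral>\<tau>. Q' \<tau> t0 \<partial>lborel)) (at t0)"
    proof (rule has_vector_derivative_integral[OF t0'])
      show "integrable lborel (\<lambda>\<tau>. M * norm (H \<tau>))" using HiH by auto
      show "(\<lambda>\<tau>. Q' \<tau> t0) \<in> borel_measurable lborel"
        unfolding Q'_def using borel_measurable_integrable[OF Hpi[OF t0]] by measurable
      fix t assume t: "t \<in> {\<alpha><..<\<beta>}"
      then have t1: "t \<in> {0<..<1}" using ab by auto
      show "integrable lborel (\<lambda>\<tau>. Q \<tau> t)"
      proof -
        have "integrable lborel (\<lambda>\<tau>. H \<tau> * J \<tau> t - k t * (H \<tau> * of_real t powr r \<tau>))"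
          using t1 by (intro Bochner_Integration.integrable_diff HJi integrable_mult_right Hpi) auto
        then show ?thesis by (simp add: Q_def algebra_simps)
      qed
      fix \<tau>
      show "norm (Q' \<tau> t) \<le> M * norm (H \<tau>)"
      proof -
        have "norm (Q' \<tau> t) = norm (k' t) * (norm (H \<tau>) * norm (of_real t powr r \<tau> :: complex))"
          by (simp add: Q'_def norm_mult)
        also have "\<dots> \<le> M * (norm (H \<tau>) * 1)"
          using M[of t] order.trans[OF norm_ge_zero M[of t]] t t1 pw[of t \<tau>]
          by (intro mult_mono) auto
        finally show ?thesis by simp
      qed
      have "((\<lambda>u. integral {0..u} (?e \<tau>)) has_vector_derivative (k t * of_real t powr (r \<tau> - 1))) (at t within {0..1} - {})"
      proof (rule integral_has_vector_derivative_continuous_at[OF io])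
        have "continuous_on {0<..<1} (?e \<tau>)"
          by (intro continuous_intros kc) (auto simp: complex_nonpos_Reals_iff)
        then have "continuous (at t) (?e \<tau>)"
          using t1 by (simp add: continuous_on_eq_continuous_at)
        then show "continuous (at t within {0..1} - {}) (?e \<tau>)"
          by (rule continuous_at_imp_continuous_within)
      qed (use t1 in auto)
      moreover have "at t within {0..1} - {} = at t"
        using t1 by (simp add: at_within_Icc_at)
      ultimately have "((\<lambda>u. integral {0..u} (?e \<tau>)) has_vector_derivative (k t * of_real t powr (r \<tau> - 1))) (at t)"
        by simp
      then have "(L \<tau> has_vector_derivative (k t * of_real t powr (r \<tau> - 1))) (at t)"
        by (rule has_vector_derivative_transform_within_open[where S = "{0<..<1}"]) (use t1 Lint in auto)
      then have "((\<lambda>t. H \<tau> * (r \<tau> * L \<tau> t - k t * of_real t powr r \<tau>)) has_vector_derivative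
           (H \<tau> * (r \<tau> * (k t * of_real t powr (r \<tau> - 1)) - (k t * (r \<tau> * of_real t powr (r \<tau> - 1)) + k' t * of_real t powr r \<tau>)))) (at t)"
        using t1 by (intro has_vector_derivative_mult_right has_vector_derivative_diff has_vector_derivative_mult
            k'(2) has_vector_derivative_of_real_powr) auto
      then show "(Q \<tau> has_vector_derivative Q' \<tau> t) (at t)"
        by (simp add: Q_def Q'_def J_def algebra_simps)
    qed
    \<comment> \<open>The term \<open>k' g\<close> of the product rule cancels against the derivative of \<open>\<Phi> - k g\<close>.\<close>
    have Q'g: "(\<integral>\<tau>. Q' \<tau> t0 \<partial>lborel) = - (k' t0 * g t0)"
      unfolding Q'_def g_def by simp
    have \<Phi>Q: "\<Phi> t = (\<integral>\<tau>. Q \<tau> t \<partial>lborel) + k t * g t" if t: "t \<in> {0<..<1}" for t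
    proof -
      have "(\<integral>\<tau>. H \<tau> * J \<tau> t - k t * (H \<tau> * of_real t powr r \<tau>) \<partial>lborel) = \<Phi> t - k t * g t"
        unfolding \<Phi>_def g_def using HJi[of t] Hpi[OF t] t by simp
      then show ?thesis by (simp add: Q_def algebra_simps)
    qed
    have "((\<lambda>t. (\<integral>\<tau>. Q \<tau> t \<partial>lborel) + k t * g t) has_vector_derivative
        (- (k' t0 * g t0) + (k t0 * g' t0 + k' t0 * g t0))) (at t0)"
      using Leib g'[OF t0] unfolding Q'g
      by (intro has_vector_derivative_add has_vector_derivative_mult k'(2) t0) (simp_all add: g_def)
    then have "((\<lambda>t. (\<integral>\<tau>. Q \<tau> t \<partial>lborel) + k t * g t) has_vector_derivative (k t0 * g' t0)) (at t0)"
      by simp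
    then show "(\<Phi> has_vector_derivative k t0 * g' t0) (at t0)"
      by (rule has_vector_derivative_transform_within_open[where S = "{0<..<1}"]) (use t0 \<Phi>Q in auto)
  qed simp
  moreover have "\<Phi> 0 = 0" by (simp add: \<Phi>_def J_def L_def set_lebesgue_integral_def)
  moreover have "\<Phi> 1 = ?V"
  proof -
    have "L \<tau> 1 = Gamma c * Gamma (r \<tau>) * Gamma (r \<tau> + c - a - b) * rGamma (r \<tau> + c - a) * rGamma (r \<tau> + c - b)" for \<tau>
      unfolding L_def k_def using s R0 by (intro saigo_kernel_integral c0) (auto simp: Rer R_def)
    then show ?thesis by (simp add: \<Phi>_def J_def)
  qed
  ultimately show ?thesis by (simp add: k_def)
qed

section \<open>Derivatives of Mellin-Barnes integrals\<close>

lemma integrable_one_plus_abs_powr: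
  assumes "e < -1"
  shows "integrable lborel (\<lambda>\<tau>::real. (1 + \<bar>\<tau>\<bar>) powr e)"
proof -
  define f where "f = (\<lambda>x::real. indicator {1..} x *\<^sub>R x powr e)"
  have "(\<lambda>x. x powr e) integrable_on {1..}"
    using has_integral_powr_to_inf[OF assms, of 1] by auto
  then have "(\<lambda>x. x powr e) absolutely_integrable_on {1..}"
    by (subst absolutely_integrable_on_iff_nonneg) auto
  then have f: "integrable lborel f"
    unfolding set_integrable_def f_def by (subst (asm) integrable_completion) auto
  have "integrable lborel (\<lambda>\<tau>. f (1 + 1 * \<tau>) + f (1 + (-1) * \<tau>))"
    by (intro Bochner_Integration.integrable_add lborel_integrable_real_affine f) auto
  then show ?thesis
    by (rule Bochner_Integration.integrable_bound) (auto simp: f_def indicator_def abs_if)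
qed

lemma integrable_vertical_bound:
  assumes "vertical_bound h e 0" "h \<in> borel_measurable borel" "e + p < -1"
  shows "integrable lborel (\<lambda>\<tau>. norm (h \<tau>) * (1 + \<bar>\<tau>\<bar>) powr p)"
proof -
  from assms(1) obtain C where C: "C \<ge> 0" "\<And>\<tau>. norm (h \<tau>) \<le> C * (1 + \<bar>\<tau>\<bar>) powr e"
    unfolding vertical_bound_def by auto
  have [measurable]: "h \<in> borel_measurable borel" by fact
  have "integrable lborel (\<lambda>\<tau>::real. C * (1 + \<bar>\<tau>\<bar>) powr (e + p))"
    by (intro integrable_mult_right integrable_one_plus_abs_powr assms)
  then show ?thesis
  proof (rule Bochner_Integration.integrable_bound)
    have "norm (h \<tau>) * (1 + \<bar>\<tau>\<bar>) powr p \<le> (C * (1 + \<bar>\<tau>\<bar>) powr e) * (1 + \<bar>\<tau>\<bar>) powr p" for \<tau>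
      by (intro mult_right_mono C) auto
    then have "norm (norm (h \<tau>) * (1 + \<bar>\<tau>\<bar>) powr p) \<le> norm (C * (1 + \<bar>\<tau>\<bar>) powr (e + p))" for \<tau>
      using C(1) by (simp add: powr_add abs_mult mult.assoc)
    then show "AE \<tau> in lborel. norm (norm (h \<tau>) * (1 + \<bar>\<tau>\<bar>) powr p) \<le> norm (C * (1 + \<bar>\<tau>\<bar>) powr (e + p))"
      by auto
  qed measurable
qed

text \<open>
  Exponential decay beats every power: bound \<open>p * ln y - d * (y - 1)\<close> by the tangent inequality
  \<open>ln (d / p * y) \<le> d / p * y - 1\<close>.
\<close>

lemma vertical_bound_exp:
  assumes "vertical_bound h e d" "d > 0"
  shows "vertical_bound h e' 0"
proof -
  from assms(1) obtain C where C: "C \<ge> 0" "\<And>\<tau>. norm (h \<tau>) \<le> C * ((1 + \<bar>\<tau>\<bar>) powr e * exp (- (d * \<bar>\<tau>\<bar>)))"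
    unfolding vertical_bound_def by auto
  define p where "p = max 1 (e - e')"
  have p: "p > 0" "e - e' \<le> p" by (auto simp: p_def)
  define M where "M = exp (d - p - p * ln (d / p))"
  have M: "y powr p * exp (- (d * (y - 1))) \<le> M" if "y > 0" for y
  proof -
    have "ln (d / p * y) \<le> d / p * y - 1" using assms p that by (intro ln_le_minus_one) auto
    moreover have "ln (d / p * y) = ln (d / p) + ln y"
      using assms p that by (intro ln_mult_pos) auto
    ultimately have "p * (ln (d / p) + ln y) \<le> p * (d / p * y - 1)"
      using p by (intro mult_left_mono) auto
    then have "p * ln y + - (d * (y - 1)) \<le> d - p - p * ln (d / p)"
      using p by (simp add: algebra_simps)
    then have "exp (p * ln y + - (d * (y - 1))) \<le> M" unfolding M_def by (subst exp_le_cancel_iff)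
    moreover have "y powr p = exp (p * ln y)" using that by (simp add: powr_def)
    ultimately show ?thesis unfolding exp_add by simp
  qed
  show ?thesis unfolding vertical_bound_def
  proof (intro exI[of _ "C * M"] conjI allI)
    fix \<tau> :: real
    define y where "y = 1 + \<bar>\<tau>\<bar>"
    have y: "y \<ge> 1" by (simp add: y_def)
    have "y powr e * exp (- (d * \<bar>\<tau>\<bar>)) = y powr e' * (y powr (e - e') * exp (- (d * (y - 1))))"
      using y by (simp add: y_def powr_diff)
    also have "\<dots> \<le> y powr e' * (y powr p * exp (- (d * (y - 1))))"
      using y p by (intro mult_left_mono mult_right_mono powr_mono) auto
    also have "\<dots> \<le> y powr e' * M" using y by (intro mult_left_mono M) auto
    finally have "C * (y powr e * exp (- (d * \<bar>\<tau>\<bar>))) \<le> C * (y powr e' * M)" using C(1) by (intro mult_left_mono)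
    then show "norm (h \<tau>) \<le> C * M * ((1 + \<bar>\<tau>\<bar>) powr e' * exp (- (0 * \<bar>\<tau>\<bar>)))"
      using C(2)[of \<tau>] by (simp add: y_def mult_ac)
  qed (use C in \<open>auto simp: M_def\<close>)
qed

text \<open>
  The set of all \<open>\<tau>\<close> at which the argument is not a pole is open; on it the power is continuous, and elsewhere
  its value is \<open>0\<close>.
\<close>

lemma Gamma_power_measurable:
  assumes "is_log_Gamma_family br" "c \<noteq> 0"
  shows "(\<lambda>\<tau>. Gamma_power br w c \<kappa> (\<i> * of_real \<tau>)) \<in> borel_measurable borel"
proof -
  define A where "A = {\<tau>::real. w + of_real c * (\<i> * of_real \<tau>) \<notin> \<int>\<^sub>\<le>\<^sub>0}"
  have "A = (\<lambda>\<tau>::real. w + of_real c * (\<i> * of_real \<tau>)) -` (- \<int>\<^sub>\<le>\<^sub>0)" by (auto simp: A_def)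
  also have "open \<dots>" by (intro open_vimage continuous_intros) auto
  finally have A: "A \<in> sets borel" by simp
  have "continuous_on {s. Re s = 0 \<and> w + of_real c * s \<notin> \<int>\<^sub>\<le>\<^sub>0} (br w c \<kappa>)"
    using assms unfolding is_log_Gamma_family_def by blast
  then have "continuous_on A (\<lambda>\<tau>. br w c \<kappa> (\<i> * of_real \<tau>))"
    by (rule continuous_on_compose2) (auto simp: A_def intro!: continuous_intros)
  then have "continuous_on A (\<lambda>\<tau>. exp (of_real \<kappa> * br w c \<kappa> (\<i> * of_real \<tau>)))"
    by (intro continuous_intros)
  from borel_measurable_continuous_on_indicator[OF A this]
  show ?thesis
    by (rule measurable_cong[THEN iffD1, rotated]) (auto simp: A_def Gamma_power_def)
qed

lemma prod_list_measurable:
  fixes g :: "'a \<Rightarrow> real \<Rightarrow> complex"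
  assumes "\<And>x. x \<in> set xs \<Longrightarrow> g x \<in> borel_measurable borel"
  shows "(\<lambda>\<tau>. \<Prod>x\<leftarrow>xs. g x \<tau>) \<in> borel_measurable borel"
  using assms by (induction xs) (auto intro!: borel_measurable_times)

lemma I_chi_measurable:
  assumes br: "is_log_Gamma_family br" and par: "I_parameters m n us ls"
  shows "(\<lambda>\<tau>. I_chi br m n us ls (\<i> * of_real \<tau>)) \<in> borel_measurable borel"
proof -
  note P = I_parametersD[OF par]
  have nz: "fst (snd x) \<noteq> 0" if "x \<in> set us \<or> x \<in> set ls" for x
    using P(1)[of "fst x" "fst (snd x)" "snd (snd x)"] P(2)[of "fst x" "fst (snd x)" "snd (snd x)"] that by auto
  show ?thesis
    unfolding I_chi_def case_prod_unfold
    by (intro borel_measurable_divide borel_measurable_times prod_list_measurable Gamma_power_measurable[OF br])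
       (use nz in \<open>auto dest!: in_set_takeD in_set_dropD\<close>)
qed

lemma norm_pochhammer_le: "norm (pochhammer (z :: complex) k) \<le> (norm z + real k) ^ k"
proof -
  have "norm (\<Prod>i<k. z + of_nat i) \<le> (\<Prod>i<k. norm z + real k)"
    unfolding prod_norm[symmetric]
  proof (intro prod_mono conjI norm_ge_zero)
    fix i assume "i \<in> {..<k}"
    then show "norm (z + of_nat i) \<le> norm z + real k"
      using norm_triangle_ineq[of z "of_nat i"] by simp
  qed
  then show ?thesis by (simp add: pochhammer_prod atLeast0LessThan)
qed

lemma pochhammer_vertical_bound:
  fixes p :: complex and \<mu> :: real
  obtains C where "C \<ge> 0" "\<And>\<tau>. norm (pochhammer (p - \<i> * of_real (\<mu> * \<tau>)) k) \<le> C * (1 + \<bar>\<tau>\<bar>) ^ k"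
proof (rule that[of "(norm p + real k + \<bar>\<mu>\<bar>) ^ k"])
  fix \<tau>
  have "norm (p - \<i> * of_real (\<mu> * \<tau>)) \<le> norm p + \<bar>\<mu>\<bar> * \<bar>\<tau>\<bar>"
    using norm_triangle_ineq4[of p "\<i> * of_real (\<mu> * \<tau>)"] by (simp add: norm_mult abs_mult)
  moreover have "(norm p + real k + \<bar>\<mu>\<bar>) * (1 + \<bar>\<tau>\<bar>) =
      norm p + real k + \<bar>\<mu>\<bar> * \<bar>\<tau>\<bar> + (\<bar>\<mu>\<bar> + (norm p + real k) * \<bar>\<tau>\<bar>)" by (simp add: algebra_simps)
  moreover have "0 \<le> \<bar>\<mu>\<bar> + (norm p + real k) * \<bar>\<tau>\<bar>" by simp
  ultimately have "norm (p - \<i> * of_real (\<mu> * \<tau>)) + real k \<le> (norm p + real k + \<bar>\<mu>\<bar>) * (1 + \<bar>\<tau>\<bar>)"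
    by linarith
  then have "(norm (p - \<i> * of_real (\<mu> * \<tau>)) + real k) ^ k \<le> ((norm p + real k + \<bar>\<mu>\<bar>) * (1 + \<bar>\<tau>\<bar>)) ^ k"
    by (intro power_mono) auto
  then show "norm (pochhammer (p - \<i> * of_real (\<mu> * \<tau>)) k) \<le> (norm p + real k + \<bar>\<mu>\<bar>) ^ k * (1 + \<bar>\<tau>\<bar>) ^ k"
    using norm_pochhammer_le[of "p - \<i> * of_real (\<mu> * \<tau>)" k] by (simp add: power_mult_distrib)
qed simp

text \<open>
  The \<open>k\<close>-fold derivative of \<open>\<integral>\<tau>. h \<tau> * t powr (p - \<i> \<mu> \<tau>)\<close>, taken under the integral sign. The
  falling factorial of the exponent is written as the Pochhammer symbol of its smallest factor, so that
  one further differentiation is an instance of \<open>pochhammer_rec\<close>.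
\<close>

definition mellin_deriv :: "(real \<Rightarrow> complex) \<Rightarrow> complex \<Rightarrow> real \<Rightarrow> nat \<Rightarrow> real \<Rightarrow> complex" where
  "mellin_deriv h p \<mu> k t = (\<integral>\<tau>. h \<tau> * pochhammer (p - of_nat k + 1 - \<i> * of_real (\<mu> * \<tau>)) k *
      of_real t powr (p - of_nat k - \<i> * of_real (\<mu> * \<tau>)) \<partial>lborel)"

lemma of_real_powr_exp: "t > 0 \<Longrightarrow> of_real t powr z = exp (z * of_real (ln t) :: complex)"
  by (auto simp: powr_def Ln_of_real)

lemma mellin_deriv_measurable:
  assumes [measurable]: "h \<in> borel_measurable borel" and t: "t > 0"
  shows "(\<lambda>\<tau>. h \<tau> * pochhammer (z - \<i> * of_real (\<mu> * \<tau>)) k * of_real t powr (q - \<i> * of_real (\<mu> * \<tau>))) \<in> borel_measurable borel"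
proof -
  have "(\<lambda>\<tau>. pochhammer (z - \<i> * of_real (\<mu> * \<tau>)) k) \<in> borel_measurable borel"
    unfolding pochhammer_prod by measurable
  moreover have "(\<lambda>\<tau>. exp ((q - \<i> * of_real (\<mu> * \<tau>)) * of_real (ln t))) \<in> borel_measurable borel"
    by measurable
  ultimately show ?thesis unfolding of_real_powr_exp[OF t] by measurable
qed

lemma mellin_deriv_integrable:
  assumes h: "h \<in> borel_measurable borel" "integrable lborel (\<lambda>\<tau>. norm (h \<tau>) * (1 + \<bar>\<tau>\<bar>) ^ k)" and t: "t > 0"
  shows "integrable lborel (\<lambda>\<tau>. h \<tau> * pochhammer (z - \<i> * of_real (\<mu> * \<tau>)) k * of_real t powr (q - \<i> * of_real (\<mu> * \<tau>)))" (is "integrable lborel ?f")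
proof -
  obtain C where C: "C \<ge> 0" "\<And>\<tau>. norm (pochhammer (z - \<i> * of_real (\<mu> * \<tau>)) k) \<le> C * (1 + \<bar>\<tau>\<bar>) ^ k"
    using pochhammer_vertical_bound by blast
  let ?g = "\<lambda>\<tau>. C * t powr Re q * (norm (h \<tau>) * (1 + \<bar>\<tau>\<bar>) ^ k)"
  have "integrable lborel ?g"
    by (intro integrable_mult_right h)
  then show ?thesis
  proof (rule Bochner_Integration.integrable_bound)
    show "?f \<in> borel_measurable lborel"
      using mellin_deriv_measurable[OF h(1) t] by simp
    have "norm (?f \<tau>) \<le>
       norm (?g \<tau>)" for \<tau>
    proof -
      have "norm (of_real t powr (q - \<i> * of_real (\<mu> * \<tau>)) :: complex) = t powr Re q"
        using t by (simp add: norm_of_real_powr)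
      then have "norm (?f \<tau>)
        = norm (h \<tau>) * norm (pochhammer (z - \<i> * of_real (\<mu> * \<tau>)) k) * t powr Re q" by (simp add: norm_mult)
      also have "\<dots> \<le> norm (h \<tau>) * (C * (1 + \<bar>\<tau>\<bar>) ^ k) * t powr Re q"
        by (intro mult_left_mono mult_right_mono C) auto
      finally show ?thesis using C(1) by (simp add: abs_mult mult_ac)
    qed
    then show "AE \<tau> in lborel. norm (?f \<tau>) \<le>
       norm (?g \<tau>)" by auto
  qed
qed

lemma integrable_power_le:
  assumes h: "h \<in> borel_measurable borel" "integrable lborel (\<lambda>\<tau>. norm (h \<tau>) * (1 + \<bar>\<tau>\<bar>) ^ k)" and "j \<le> k"
  shows "integrable lborel (\<lambda>\<tau>. norm (h \<tau> :: complex) * (1 + \<bar>\<tau>\<bar>) ^ j)"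
proof (rule Bochner_Integration.integrable_bound[OF h(2)])
  have "norm (h \<tau>) * (1 + \<bar>\<tau>\<bar>) ^ j \<le> norm (h \<tau>) * (1 + \<bar>\<tau>\<bar>) ^ k" for \<tau>
    using assms(3) by (intro mult_left_mono power_increasing) auto
  then show "AE \<tau> in lborel. norm (norm (h \<tau>) * (1 + \<bar>\<tau>\<bar>) ^ j) \<le> norm (norm (h \<tau>) * (1 + \<bar>\<tau>\<bar>) ^ k)" by auto
  show "(\<lambda>\<tau>. norm (h \<tau>) * (1 + \<bar>\<tau>\<bar>) ^ j) \<in> borel_measurable lborel" using h(1) by measurable
qed

text \<open>
  The interval \<open>{t / 2<..<2 * t}\<close> keeps the power of the variable bounded, whatever the sign of its exponent.
\<close>

lemma mellin_deriv_has_vector_derivative: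
  assumes h: "h \<in> borel_measurable borel" "integrable lborel (\<lambda>\<tau>. norm (h \<tau>) * (1 + \<bar>\<tau>\<bar>) ^ Suc k)" and t: "t > 0"
  shows "(mellin_deriv h p \<mu> k has_vector_derivative mellin_deriv h p \<mu> (Suc k) t) (at t)"
proof -
  define q where "q = (\<lambda>\<tau>. p - of_nat k - \<i> * of_real (\<mu> * \<tau>))"
  have hk: "integrable lborel (\<lambda>\<tau>. norm (h \<tau>) * (1 + \<bar>\<tau>\<bar>) ^ k)"
    by (rule integrable_power_le[OF h]) simp
  have q0: "p - of_nat k - \<i> * of_real (\<mu> * \<tau>) = q \<tau>"
    and q1: "p - of_nat k + 1 - \<i> * of_real (\<mu> * \<tau>) = q \<tau> + 1"
    and q2: "p - of_nat (Suc k) + 1 - \<i> * of_real (\<mu> * \<tau>) = q \<tau>"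
    and q3: "p - of_nat (Suc k) - \<i> * of_real (\<mu> * \<tau>) = q \<tau> - 1" for \<tau>
    by (auto simp: q_def)
  define M where "M = max ((t / 2) powr (Re p - real k - 1)) ((2 * t) powr (Re p - real k - 1))"
  obtain C where C: "C \<ge> 0" "\<And>\<tau>. norm (pochhammer (q \<tau>) (Suc k)) \<le> C * (1 + \<bar>\<tau>\<bar>) ^ Suc k"
    using pochhammer_vertical_bound[of "p - of_nat k" \<mu> "Suc k"] unfolding q_def by blast
  have "((\<lambda>t. \<integral>\<tau>. h \<tau> * pochhammer (q \<tau> + 1) k * of_real t powr (q \<tau>) \<partial>lborel) has_vector_derivative
      (\<integral>\<tau>. h \<tau> * pochhammer (q \<tau>) (Suc k) * of_real t powr (q \<tau> - 1) \<partial>lborel)) (at t)"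
  proof (rule has_vector_derivative_integral[of t "t / 2" "2 * t"])
    show "t \<in> {t / 2<..<2 * t}" using t by auto
    show "(\<lambda>\<tau>. h \<tau> * pochhammer (q \<tau>) (Suc k) * of_real t powr (q \<tau> - 1)) \<in> borel_measurable lborel"
      using mellin_deriv_measurable[OF h(1) t, of "p - of_nat (Suc k) + 1" \<mu> "Suc k" "p - of_nat (Suc k)"]
      unfolding q2 q3 by simp
    show "integrable lborel (\<lambda>\<tau>. C * M * (norm (h \<tau>) * (1 + \<bar>\<tau>\<bar>) ^ Suc k))"
      by (intro integrable_mult_right h)
    fix u assume u: "u \<in> {t / 2<..<2 * t}"
    then have u0: "u > 0" using t by simp
    show "integrable lborel (\<lambda>\<tau>. h \<tau> * pochhammer (q \<tau> + 1) k * of_real u powr (q \<tau>))"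
      using mellin_deriv_integrable[OF h(1) hk u0, of "p - of_nat k + 1" \<mu> "p - of_nat k"] unfolding q1 q0 .
    fix \<tau>
    have "((\<lambda>t. h \<tau> * pochhammer (q \<tau> + 1) k * of_real t powr (q \<tau>)) has_vector_derivative
        (h \<tau> * pochhammer (q \<tau> + 1) k * (q \<tau> * of_real u powr (q \<tau> - 1)))) (at u)"
      by (intro has_vector_derivative_mult_right has_vector_derivative_of_real_powr u0)
    then show "((\<lambda>t. h \<tau> * pochhammer (q \<tau> + 1) k * of_real t powr (q \<tau>)) has_vector_derivative
        h \<tau> * pochhammer (q \<tau>) (Suc k) * of_real u powr (q \<tau> - 1)) (at u)"
      by (simp add: pochhammer_rec mult_ac)
    have "u powr (Re p - real k - 1) \<le> M"
    proof (cases "Re p - real k - 1 \<ge> 0")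
      case True
      then have "u powr (Re p - real k - 1) \<le> (2 * t) powr (Re p - real k - 1)" using u u0 by (intro powr_mono2) auto
      then show ?thesis by (simp add: M_def)
    next
      case False
      then have "u powr (Re p - real k - 1) \<le> (t / 2) powr (Re p - real k - 1)" using u u0 t by (intro powr_mono2') auto
      then show ?thesis by (simp add: M_def)
    qed
    moreover have "norm (of_real u powr (q \<tau> - 1) :: complex) = u powr (Re p - real k - 1)"
      using u0 by (simp add: norm_of_real_powr q_def)
    ultimately have "norm (h \<tau>) * norm (pochhammer (q \<tau>) (Suc k)) * norm (of_real u powr (q \<tau> - 1) :: complex) \<le>
        norm (h \<tau>) * (C * (1 + \<bar>\<tau>\<bar>) ^ Suc k) * M"
      using C by (intro mult_mono) auto
    then show "norm (h \<tau> * pochhammer (q \<tau>) (Suc k) * of_real u powr (q \<tau> - 1)) \<le> C * M * (norm (h \<tau>) * (1 + \<bar>\<tau>\<bar>) ^ Suc k)"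
      by (simp only: norm_mult mult_ac)
  qed
  then show ?thesis unfolding mellin_deriv_def q0 q1 q2 q3 .
qed

lemma nth_derivative_Suc: "nth_derivative (Suc k) f t = vector_derivative (nth_derivative k f) (at t)"
  by (simp add: nth_derivative_def)

lemma nth_derivative_mellin:
  assumes h: "h \<in> borel_measurable borel" "integrable lborel (\<lambda>\<tau>. norm (h \<tau>) * (1 + \<bar>\<tau>\<bar>) ^ k)"
    and f: "\<And>t. t > 0 \<Longrightarrow> f t = mellin_deriv h p \<mu> 0 t" and "j \<le> k" "t > 0"
  shows "nth_derivative j f t = mellin_deriv h p \<mu> j t"
  using assms(4,5)
proof (induction j arbitrary: t)
  case 0
  then show ?case using f by (simp add: nth_derivative_def)
next
  case (Suc j)
  have "(mellin_deriv h p \<mu> j has_vector_derivative mellin_deriv h p \<mu> (Suc j) t) (at t)"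
    using Suc.prems by (intro mellin_deriv_has_vector_derivative h(1) integrable_power_le[OF h]) auto
  then have "(nth_derivative j f has_vector_derivative mellin_deriv h p \<mu> (Suc j) t) (at t)"
    by (rule has_vector_derivative_transform_within_open[where S = "{0<..}"]) (use Suc in auto)
  then show ?case by (simp add: nth_derivative_Suc vector_derivative_at)
qed

lemma times_differentiable_mellin:
  assumes h: "h \<in> borel_measurable borel" "integrable lborel (\<lambda>\<tau>. norm (h \<tau>) * (1 + \<bar>\<tau>\<bar>) ^ k)"
    and f: "\<And>t. t > 0 \<Longrightarrow> f t = mellin_deriv h p \<mu> 0 t"
  shows "times_differentiable k f"
  unfolding times_differentiable_def
proof (intro allI impI)
  fix j and t :: real assume j: "j < k" and t: "t > 0"
  have "(mellin_deriv h p \<mu> j has_vector_derivative mellin_deriv h p \<mu> (Suc j) t) (at t)"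
    using j t by (intro mellin_deriv_has_vector_derivative h(1) integrable_power_le[OF h]) auto
  then have "(nth_derivative j f has_vector_derivative mellin_deriv h p \<mu> (Suc j) t) (at t)"
    by (rule has_vector_derivative_transform_within_open[where S = "{0<..}"])
       (use t j nth_derivative_mellin[OF h f] in auto)
  then show "nth_derivative j f differentiable at t" by (rule differentiableI_vector)
qed

section \<open>Caputo-type Erdelyi-Kober derivatives of the I-function\<close>

text \<open>
  The integrand of the Mellin-Barnes integral at \<open>z\<close>, including the constant in front of it. Replacing
  \<open>z\<close> by \<open>z * t powr \<mu>\<close> multiplies it by \<open>t powr (- \<i> \<mu> \<tau>)\<close>.
\<close>

definition I_density :: "log_Gamma_family \<Rightarrow> nat \<Rightarrow> nat \<Rightarrow> I_triple list \<Rightarrow> I_triple list \<Rightarrow>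
    complex \<Rightarrow> real \<Rightarrow> real \<Rightarrow> complex" where
  "I_density br m n us ls z \<theta> \<tau> = I_chi br m n us ls (\<i> * of_real \<tau>) *
     exp (- (\<i> * of_real \<tau>) * (of_real (ln (norm z)) + \<i> * of_real \<theta>)) / (2 * of_real pi)"

lemma powr_times_I_function:
  assumes t: "t > 0" and a: "a \<noteq> 0"
  shows "of_real t powr p * I_function br m n us ls (a * of_real (t powr \<mu>)) \<theta> =
     (\<integral>\<tau>. I_density br m n us ls a \<theta> \<tau> * of_real t powr (p - \<i> * of_real (\<mu> * \<tau>)) \<partial>lborel)" (is "?lhs = ?rhs")
proof -
  let ?E = "\<lambda>\<tau>. exp (- (\<i> * complex_of_real \<tau>) * (of_real (ln (norm a) + \<mu> * ln t) + \<i> * of_real \<theta>))"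
  let ?C = "of_real t powr p * (1 / (2 * of_real pi * \<i>))"
  have ln: "ln (norm (a * of_real (t powr \<mu>))) = ln (norm a) + \<mu> * ln t"
    using t a by (simp add: norm_mult ln_mult_pos ln_powr)
  have pt: "of_real t powr (p - \<i> * of_real (\<mu> * \<tau>)) = of_real t powr p * exp (- (\<i> * of_real \<tau>) * of_real (\<mu> * ln t))" for \<tau>
    unfolding of_real_powr_exp[OF t] mult_exp_exp by (simp add: algebra_simps)
  have "?lhs = ?C * (\<integral>\<tau>. I_chi br m n us ls (\<i> * of_real \<tau>) *
        ?E \<tau> * \<i> \<partial>lborel)"
    unfolding I_function_def ln by (simp only: mult.assoc)
  also have "\<dots> = (\<integral>\<tau>. ?C * (I_chi br m n us ls (\<i> * of_real \<tau>) *
        ?E \<tau> * \<i>) \<partial>lborel)"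
    by (rule integral_mult_right_zero[symmetric])
  also have "\<dots> = ?rhs"
  proof (rule Bochner_Integration.integral_cong[OF refl])
    fix \<tau>
    define X where "X = exp (- (\<i> * complex_of_real \<tau>) * (of_real (ln (norm a)) + \<i> * of_real \<theta>))"
    define Y where "Y = exp (- (\<i> * complex_of_real \<tau>) * of_real (\<mu> * ln t))"
    have "?E \<tau> = X * Y"
      unfolding X_def Y_def mult_exp_exp by (simp add: algebra_simps)
    then show "?C * (I_chi br m n us ls (\<i> * of_real \<tau>) *
        ?E \<tau> * \<i>) =
        I_density br m n us ls a \<theta> \<tau> * of_real t powr (p - \<i> * of_real (\<mu> * \<tau>))"
      unfolding pt I_density_def X_def[symmetric] Y_def[symmetric] by simp
  qed
  finally show ?thesis .
qed

lemma I_density_measurable: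
  assumes "is_log_Gamma_family br" "I_parameters m n us ls"
  shows "I_density br m n us ls z \<theta> \<in> borel_measurable borel"
proof -
  note [measurable] = I_chi_measurable[OF assms]
  show ?thesis unfolding I_density_def[abs_def] by measurable
qed

lemma I_density_vertical_bound:
  assumes "is_log_Gamma_family br" "I_parameters m n us ls"
  shows "vertical_bound (I_density br m n us ls z \<theta>) (I_Omega us ls) (pi / 2 * I_Delta m n us ls - \<bar>\<theta>\<bar>)"
proof -
  let ?e = "\<lambda>\<tau>. exp (- (\<i> * of_real \<tau>) * (of_real (ln (norm z)) + \<i> * of_real \<theta>)) / (2 * complex_of_real pi)"
  have "vertical_bound ?e 0 (- \<bar>\<theta>\<bar>)"
    unfolding vertical_bound_def
  proof (intro exI[of _ 1] conjI allI)
    fix \<tau> :: real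
    have "norm (?e \<tau>) = exp (\<tau> * \<theta>) / (2 * pi)"
      by (simp add: norm_divide norm_mult)
    also have "\<dots> \<le> exp (\<bar>\<theta>\<bar> * \<bar>\<tau>\<bar>) / 1"
    proof (rule frac_le)
      have "\<tau> * \<theta> \<le> \<bar>\<theta>\<bar> * \<bar>\<tau>\<bar>" by (metis abs_ge_self abs_mult mult.commute)
      then show "exp (\<tau> * \<theta>) \<le> exp (\<bar>\<theta>\<bar> * \<bar>\<tau>\<bar>)" by simp
    qed (use pi_ge_two in auto)
    finally show "norm (?e \<tau>)
        \<le> 1 * ((1 + \<bar>\<tau>\<bar>) powr 0 * exp (- (- \<bar>\<theta>\<bar> * \<bar>\<tau>\<bar>)))" by simp
  qed simp
  from vertical_bound_mult[OF I_chi_vertical_bound[OF assms] this]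
  show ?thesis unfolding I_density_def[abs_def] by simp
qed

lemma Gamma_power_1:
  assumes "is_log_Gamma_family br" "c \<noteq> 0" "Re s = 0"
  shows "Gamma_power br w c 1 s = Gamma (w + of_real c * s)"
proof (cases "w + of_real c * s \<in> \<int>\<^sub>\<le>\<^sub>0")
  case True
  then show ?thesis by (simp add: Gamma_power_def Gamma_eq_zero_iff)
next
  case False
  then have "exp (br w c 1 s) = Gamma (w + of_real c * s)"
    using assms unfolding is_log_Gamma_family_def by blast
  then show ?thesis using False by (simp add: Gamma_power_def)
qed

lemma I_chi_extend:
  assumes "is_log_Gamma_family br" "m \<le> length ls" "\<mu> \<noteq> 0" "Re s = 0"
  shows "I_chi br m (n + 1) ((1 - u, \<mu>, 1) # us) (ls @ [(1 - v, \<mu>, 1)]) s =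
     I_chi br m n us ls s * Gamma (u - of_real \<mu> * s) * rGamma (v - of_real \<mu> * s)"
proof -
  have 1: "Gamma_power br w (- \<mu>) 1 s = Gamma (w - of_real \<mu> * s)" for w
    using assms by (simp add: Gamma_power_1)
  show ?thesis
    using assms(2) by (simp add: I_chi_def 1 rGamma_inverse_Gamma divide_inverse)
qed

lemma I_Delta_extend:
  assumes "m \<le> length ls"
  shows "I_Delta m (n + 1) ((u, \<mu>, 1) # us) (ls @ [(v, \<mu>, 1)]) = I_Delta m n us ls"
  using assms by (simp add: I_Delta_def)

lemma I_Omega_extend:
  "I_Omega ((u, \<mu>, 1) # us) (ls @ [(v, \<mu>, 1)]) = I_Omega us ls + Re v - Re u"
  by (simp add: I_Omega_def)

lemma caputo_order_bounds:
  assumes "Re \<alpha> > 0"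
  shows "0 < real (caputo_order \<alpha>) - Re \<alpha>" "real (caputo_order \<alpha>) - Re \<alpha> \<le> 1"
  using assms unfolding caputo_order_def by linarith+

lemma saigo_integrand_scaled:
  assumes x: "x > 0" and u: "u \<in> {0..1}"
  shows "saigo_integrand \<alpha> \<beta> \<gamma> F x (x * u) =
    of_real x powr (\<alpha> - 1) * (saigo_kernel (\<alpha> + \<beta>) (- \<gamma>) \<alpha> u * F (x * u))"
proof -
  have "complex_of_real (x - x * u) powr (\<alpha> - 1) = (of_real x * of_real (1 - u)) powr (\<alpha> - 1)"
    by (simp add: algebra_simps)
  also have "\<dots> = of_real x powr (\<alpha> - 1) * of_real (1 - u) powr (\<alpha> - 1)"
    using x u by (intro powr_times_real) auto
  finally show ?thesis using x by (simp add: saigo_integrand_def saigo_kernel_def)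
qed

text \<open>
  Substituting \<open>t = x u\<close> moves the operator to the unit interval and multiplies the density \<open>H\<close> by
  \<open>x powr r \<tau>\<close>.
\<close>

theorem saigo_integral_mellin:
  fixes H F :: "real \<Rightarrow> complex" and r0 :: complex and \<mu> :: real
  defines "r \<equiv> \<lambda>\<tau>. r0 - \<i> * of_real (\<mu> * \<tau>)"
  assumes x: "x > 0" and R: "Re r0 > 0" and \<mu>: "\<mu> \<noteq> 0"
    and \<delta>: "0 < \<delta>" "\<delta> < 1" and c: "1 - \<delta> \<le> Re c"
    and s: "Re (r0 + \<gamma> - \<beta>) > 0"
    and Hm: "H \<in> borel_measurable borel"
    and Hi: "integrable lborel (\<lambda>\<tau>. norm (H \<tau>) * (1 + \<bar>\<tau>\<bar>) powr \<delta>)"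
    and F: "\<And>t. t > 0 \<Longrightarrow> ((\<lambda>t. \<integral>\<tau>. H \<tau> * of_real t powr r \<tau> \<partial>lborel) has_vector_derivative F t) (at t)"
  shows "saigo_integrand c \<beta> \<gamma> F x integrable_on {0<..<x}"
    and "saigo_integral c \<beta> \<gamma> F x =
     (\<integral>\<tau>. H \<tau> * (r \<tau> * (Gamma (r \<tau>) * Gamma (r \<tau> + \<gamma> - \<beta>) * rGamma (r \<tau> - \<beta>) * rGamma (r \<tau> + c + \<gamma>)))
        * of_real x powr (r \<tau> - \<beta> - 1) \<partial>lborel)" (is "_ = ?rhs")
proof -
  have c0: "Re c > 0" using c \<delta> by simp
  have Rer: "Re (r \<tau>) = Re r0" for \<tau> by (simp add: r_def)
  define Hx where "Hx = (\<lambda>\<tau>. H \<tau> * of_real x powr r \<tau>)"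
  have rm: "r \<in> borel_measurable borel" unfolding r_def by measurable
  have Hxm: "Hx \<in> borel_measurable borel"
    unfolding Hx_def of_real_powr_exp[OF x] using Hm rm by measurable
  have nHx: "norm (Hx \<tau>) = norm (H \<tau>) * x powr Re r0" for \<tau>
    using x by (simp add: Hx_def norm_mult norm_of_real_powr Rer)
  have Hxi: "integrable lborel (\<lambda>\<tau>. norm (Hx \<tau>) * (1 + \<bar>\<tau>\<bar>) powr \<delta>)"
  proof -
    have "integrable lborel (\<lambda>\<tau>. x powr Re r0 * (norm (H \<tau>) * (1 + \<bar>\<tau>\<bar>) powr \<delta>))"
      by (intro integrable_mult_right Hi)
    then show ?thesis by (simp add: nHx mult_ac)
  qed
  have xt: "of_real (x * t) powr r \<tau> = of_real x powr r \<tau> * (of_real t powr r \<tau> :: complex)" if "t > 0" for t \<tau>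
    using x that by (simp add: powr_times_real)
  have g': "((\<lambda>t. \<integral>\<tau>. Hx \<tau> * of_real t powr r \<tau> \<partial>lborel) has_vector_derivative (x *\<^sub>R F (x * t))) (at t)" if t: "t \<in> {0<..<1}" for t
  proof -
    have "((\<lambda>t. x * t) has_vector_derivative (x * 1)) (at t)"
      by (intro derivative_intros)
    from vector_diff_chain_at[OF this F[of "x * t"]] x t
    have "((\<lambda>t. \<integral>\<tau>. H \<tau> * of_real (x * t) powr r \<tau> \<partial>lborel) has_vector_derivative (x *\<^sub>R F (x * t))) (at t)"
      by (simp add: o_def)
    then show ?thesis
      by (rule has_vector_derivative_transform_within_open[where S = "{0<..}"])
         (use t xt in \<open>auto simp: Hx_def mult_ac\<close>)
  qed
  let ?G = "\<lambda>\<tau>. r \<tau> * (Gamma c * Gamma (r \<tau>) * Gamma (r \<tau> + c - (c + \<beta>) - (- \<gamma>)) *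
      rGamma (r \<tau> + c - (c + \<beta>)) * rGamma (r \<tau> + c - (- \<gamma>)))"
  define V where "V = (\<integral>\<tau>. Hx \<tau> * ?G \<tau> \<partial>lborel)"
  have "((\<lambda>t. saigo_kernel (c + \<beta>) (- \<gamma>) c t * (x *\<^sub>R F (x * t))) has_integral V) {0..1}"
    unfolding V_def r_def
    by (rule saigo_kernel_mellin_integral[OF R \<mu> \<delta> c _ Hxm Hxi]) (use s g' in \<open>auto simp: r_def\<close>)
  then have "((\<lambda>t. of_real x powr (c - 1) / of_real x * (saigo_kernel (c + \<beta>) (- \<gamma>) c t * (x *\<^sub>R F (x * t)))) has_integral
      (of_real x powr (c - 1) / of_real x * V)) {0..1}"
    by (rule has_integral_mult_right)
  then have "((\<lambda>u. saigo_integrand c \<beta> \<gamma> F x (x * u)) has_integral (of_real x powr (c - 1) / of_real x * V)) {0..1}"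
    by (rule has_integral_eq[rotated]) (use x in \<open>simp add: saigo_integrand_scaled scaleR_conv_of_real\<close>)
  from has_integral_stretch_real[OF this, of "1 / x"]
  have "((\<lambda>t. saigo_integrand c \<beta> \<gamma> F x (x * (1 / x * t))) has_integral x *\<^sub>R (of_real x powr (c - 1) / of_real x * V)) ((\<lambda>t. t / (1 / x)) ` {0..1})"
    using x by simp
  moreover have "(\<lambda>t. t / (1 / x)) ` {0..1} = {0..x}"
    using x image_mult_atLeastAtMost[of x 0 1] by (simp add: mult.commute)
  ultimately have hi: "(saigo_integrand c \<beta> \<gamma> F x has_integral (of_real x powr (c - 1) * V)) {0<..<x}"
    using x by (simp add: has_integral_Icc_iff_Ioo scaleR_conv_of_real)
  then show "saigo_integrand c \<beta> \<gamma> F x integrable_on {0<..<x}" by blast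
  have "Gamma c \<noteq> 0" using Re_pos_notin_nonpos_Ints[OF c0] by (simp add: Gamma_eq_zero_iff)
  have px: "of_real x powr (- c - \<beta>) * of_real x powr (c - 1) * of_real x powr r \<tau> = (of_real x powr (r \<tau> - \<beta> - 1) :: complex)" for \<tau>
    by (simp add: powr_add[symmetric] algebra_simps)
  have "saigo_integral c \<beta> \<gamma> F x = of_real x powr (- c - \<beta>) / Gamma c * (of_real x powr (c - 1) * V)"
    unfolding saigo_integral_def using hi by (simp add: integral_unique)
  also have "\<dots> = (of_real x powr (- c - \<beta>) * of_real x powr (c - 1) / Gamma c) * V" by simp
  also have "\<dots> = (\<integral>\<tau>. (of_real x powr (- c - \<beta>) * of_real x powr (c - 1) / Gamma c) *
     (Hx \<tau> * ?G \<tau>) \<partial>lborel)"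
    unfolding V_def by (rule integral_mult_right_zero[symmetric])
  also have "\<dots> = ?rhs"
  proof (rule Bochner_Integration.integral_cong[OF refl])
    fix \<tau>
    have e: "r \<tau> - \<beta> - (- \<gamma>) = r \<tau> + \<gamma> - \<beta>" "r \<tau> + c - (c + \<beta>) = r \<tau> - \<beta>" "r \<tau> + c - (- \<gamma>) = r \<tau> + c + \<gamma>"
      by (simp_all add: algebra_simps)
    show "(of_real x powr (- c - \<beta>) * of_real x powr (c - 1) / Gamma c) *
     (Hx \<tau> * ?G \<tau>) =
      H \<tau> * (r \<tau> * (Gamma (r \<tau>) * Gamma (r \<tau> + \<gamma> - \<beta>) * rGamma (r \<tau> - \<beta>) * rGamma (r \<tau> + c + \<gamma>)))
        * of_real x powr (r \<tau> - \<beta> - 1)"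
    proof -
      have "P * Q / G * (h * X * (z * (G * A * B * C * D))) = h * (z * (A * B * C * D)) * (P * Q * X)"
        if "G \<noteq> 0" for P Q G h X z A B C D :: complex
        using that by simp
      from this[OF \<open>Gamma c \<noteq> 0\<close>] show ?thesis unfolding e px[symmetric] Hx_def .
    qed
  qed
  finally show "saigo_integral c \<beta> \<gamma> F x = ?rhs" .
qed

lemma nth_derivative_has_vector_derivative:
  assumes "times_differentiable N f" "k < N" "t > 0"
  shows "(nth_derivative k f has_vector_derivative nth_derivative (Suc k) f t) (at t)"
  using assms unfolding nth_derivative_Suc times_differentiable_def by (simp add: vector_derivative_works)

theorem corollary5p2:
  fixes \<alpha> \<gamma> \<rho> a :: complex and \<mu> \<theta> x :: real and N m n :: nat
    and us ls us' ls' :: "I_triple list" and br :: log_Gamma_family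
    and f :: "real \<Rightarrow> complex"
  assumes branch: "is_log_Gamma_family br"
    and params: "I_parameters m n us ls"
    and \<alpha>: "Re \<alpha> > 0"
    and a: "a \<noteq> 0" "is_Arg a \<theta>"
    and N: "N = caputo_order \<alpha>"
    and \<mu>: "\<mu> > 0"
    and \<rho>: "Re \<rho> - real N > max 0 (Re (- \<alpha> - \<gamma>))"
    and us': "us' = (1 - \<alpha> - \<gamma> - \<rho> + of_nat N, \<mu>, 1) # us"
    and ls': "ls' = ls @ [(1 - \<gamma> - \<rho> + of_nat N, \<mu>, 1)]"
    and conv: "I_convergent m n us ls \<theta>"
    and conv': "I_convergent m (n + 1) us' ls' \<theta>"
    and f: "f = (\<lambda>t. of_real t powr (\<rho> - 1) *
                  I_function br m n us ls (a * of_real (t powr \<mu>)) \<theta>)"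
    and diff: "\<bar>\<theta>\<bar> = pi / 2 * I_Delta m n us ls \<Longrightarrow> times_differentiable N f"
    and x: "x > 0"
  shows "caputo_EK_defined \<gamma> \<alpha> f x \<and>
         caputo_EK \<gamma> \<alpha> f x =
           of_real x powr (\<rho> - 1) *
           I_function br m (n + 1) us' ls' (a * of_real (x powr \<mu>)) \<theta>"
proof -
  define h where "h = I_density br m n us ls a \<theta>"
  define r0 where "r0 = \<rho> - of_nat N"
  define r where "r = (\<lambda>\<tau>. r0 - \<i> * of_real (\<mu> * \<tau>))"
  define c where "c = - \<alpha> + of_nat N"
  obtain N1 where N1: "N = Suc N1" using N by (simp add: caputo_order_def)
  have m: "m \<le> length ls" using params by (simp add: I_parameters_def)
  have c0: "0 < Re c" "Re c \<le> 1" using caputo_order_bounds[OF \<alpha>] by (auto simp: c_def N)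
  have R: "Re r0 > 0" "Re (r0 + \<alpha> + \<gamma>) > 0" using \<rho> by (auto simp: r0_def)
  have hm: "h \<in> borel_measurable borel" unfolding h_def by (rule I_density_measurable[OF branch params])
  have hb: "vertical_bound h (I_Omega us ls) (pi / 2 * I_Delta m n us ls - \<bar>\<theta>\<bar>)"
    unfolding h_def by (rule I_density_vertical_bound[OF branch params])
  have fm: "f t = mellin_deriv h (\<rho> - 1) \<mu> 0 t" if "t > 0" for t
    using that powr_times_I_function[OF that a(1)] by (simp add: f mellin_deriv_def h_def)
  have int_nat: "integrable lborel (\<lambda>\<tau>. norm (h \<tau>) * (1 + \<bar>\<tau>\<bar>) ^ k)"
    if "integrable lborel (\<lambda>\<tau>. norm (h \<tau>) * (1 + \<bar>\<tau>\<bar>) powr (real k))" for k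
  proof -
    have "(1 + \<bar>\<tau>\<bar>) powr (real k) = (1 + \<bar>\<tau>\<bar>) ^ k" for \<tau> :: real by (rule powr_realpow) simp
    then show ?thesis using that by simp
  qed
  \<comment> \<open>
    The order \<open>N1 + \<delta>\<close> is what the previous estimates require: \<open>N1 = N - 1\<close> differentiations and the
    oscillation bound of order \<open>\<delta> \<ge> 1 - Re c = Re \<alpha> - N1\<close>.
  \<close>
  have "\<exists>\<delta>. 0 < \<delta> \<and> \<delta> < 1 \<and> 1 - \<delta> \<le> Re c \<and> integrable lborel (\<lambda>\<tau>. norm (h \<tau>) * (1 + \<bar>\<tau>\<bar>) powr (real N1 + \<delta>))
      \<and> times_differentiable N f"
  proof (cases "\<bar>\<theta>\<bar> = pi / 2 * I_Delta m n us ls")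
    case False
    then have "pi / 2 * I_Delta m n us ls - \<bar>\<theta>\<bar> > 0"
      using conv by (auto simp: I_convergent_def Let_def)
    note hb' = vertical_bound_exp[OF hb this]
    have i: "integrable lborel (\<lambda>\<tau>. norm (h \<tau>) * (1 + \<bar>\<tau>\<bar>) powr p)" for p
      by (rule integrable_vertical_bound[OF hb'[of "- 2 - p"] hm]) simp
    have "times_differentiable N f"
      by (rule times_differentiable_mellin[OF hm int_nat[OF i] fm])
    then show ?thesis using c0 i by (intro exI[of _ "1 - Re c / 2"]) auto
  next
    case True
    have D: "I_Delta m (n + 1) us' ls' = I_Delta m n us ls"
      unfolding us' ls' by (rule I_Delta_extend[OF m])
    have O: "I_Omega us' ls' = I_Omega us ls + Re \<alpha>"
      unfolding us' ls' I_Omega_extend by simp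
    have \<Omega>: "I_Omega us ls + Re \<alpha> < -1"
      using conv' True unfolding I_convergent_def Let_def D O by auto
    \<comment> \<open>
      The conditions leave \<open>1 - Re c \<le> \<delta>\<close>, \<open>\<delta> < 1\<close> and \<open>\<delta> < - \<Omega> - N\<close>, consistent because of
      \<open>\<Omega> + Re \<alpha> < -1\<close>; the midpoint is strictly positive even if \<open>Re c = 1\<close>.
    \<close>
    define \<delta> where "\<delta> = (1 - Re c + min 1 (- I_Omega us ls - real N)) / 2"
    have Rec: "Re c = real N - Re \<alpha>" by (simp add: c_def)
    have \<delta>: "0 < \<delta>" "\<delta> < 1" "1 - \<delta> \<le> Re c" "I_Omega us ls + (real N1 + \<delta>) < -1"
      using c0 \<Omega> Rec by (auto simp: \<delta>_def N1 min_def field_simps)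
    have hb0: "vertical_bound h (I_Omega us ls) 0" using hb True by simp
    have "integrable lborel (\<lambda>\<tau>. norm (h \<tau>) * (1 + \<bar>\<tau>\<bar>) powr (real N1 + \<delta>))"
      by (rule integrable_vertical_bound[OF hb0 hm \<delta>(4)])
    then show ?thesis using \<delta> diff[OF True] by blast
  qed
  then obtain \<delta> where \<delta>: "0 < \<delta>" "\<delta> < 1" "1 - \<delta> \<le> Re c"
    and hi: "integrable lborel (\<lambda>\<tau>. norm (h \<tau>) * (1 + \<bar>\<tau>\<bar>) powr (real N1 + \<delta>))"
    and td: "times_differentiable N f" by blast
  have hiN1: "integrable lborel (\<lambda>\<tau>. norm (h \<tau>) * (1 + \<bar>\<tau>\<bar>) ^ N1)"
  proof (rule int_nat, rule Bochner_Integration.integrable_bound[OF hi])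
    have "norm (h \<tau>) * (1 + \<bar>\<tau>\<bar>) powr real N1 \<le> norm (h \<tau>) * (1 + \<bar>\<tau>\<bar>) powr (real N1 + \<delta>)" for \<tau>
      using \<delta> by (intro mult_left_mono powr_mono) auto
    then show "AE \<tau> in lborel. norm (norm (h \<tau>) * (1 + \<bar>\<tau>\<bar>) powr real N1) \<le> norm (norm (h \<tau>) * (1 + \<bar>\<tau>\<bar>) powr (real N1 + \<delta>))"
      by auto
  qed (use hm in measurable)
  define H where "H = (\<lambda>\<tau>. h \<tau> * pochhammer (r \<tau> + 1) N1)"
  have r0': "r0 = \<rho> - 1 - of_nat N1" by (simp add: r0_def N1)
  have Hm: "H \<in> borel_measurable borel"
    unfolding H_def r_def pochhammer_prod using hm by measurable
  obtain C where C: "C \<ge> 0" "\<And>\<tau>. norm (pochhammer (r0 + 1 - \<i> * of_real (\<mu> * \<tau>)) N1) \<le> C * (1 + \<bar>\<tau>\<bar>) ^ N1"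
    using pochhammer_vertical_bound by blast
  have rC: "r \<tau> + 1 = r0 + 1 - \<i> * of_real (\<mu> * \<tau>)" for \<tau> by (simp add: r_def)
  have Hi: "integrable lborel (\<lambda>\<tau>. norm (H \<tau>) * (1 + \<bar>\<tau>\<bar>) powr \<delta>)"
  proof (rule Bochner_Integration.integrable_bound[OF integrable_mult_right[OF hi, of C]])
    have "norm (H \<tau>) * (1 + \<bar>\<tau>\<bar>) powr \<delta> \<le> C * (norm (h \<tau>) * (1 + \<bar>\<tau>\<bar>) powr (real N1 + \<delta>))" for \<tau>
    proof -
      have "norm (H \<tau>) \<le> norm (h \<tau>) * (C * (1 + \<bar>\<tau>\<bar>) ^ N1)"
        unfolding H_def norm_mult rC by (intro mult_left_mono C) simp
      then have "norm (H \<tau>) * (1 + \<bar>\<tau>\<bar>) powr \<delta> \<le> norm (h \<tau>) * (C * (1 + \<bar>\<tau>\<bar>) ^ N1) * (1 + \<bar>\<tau>\<bar>) powr \<delta>"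
        by (rule mult_right_mono) simp
      also have "\<dots> = C * (norm (h \<tau>) * ((1 + \<bar>\<tau>\<bar>) powr (real N1) * (1 + \<bar>\<tau>\<bar>) powr \<delta>))"
        by (subst powr_realpow) (auto simp: mult_ac)
      finally show ?thesis unfolding powr_add .
    qed
    then show "AE \<tau> in lborel. norm (norm (H \<tau>) * (1 + \<bar>\<tau>\<bar>) powr \<delta>) \<le> norm (C * (norm (h \<tau>) * (1 + \<bar>\<tau>\<bar>) powr (real N1 + \<delta>)))"
      by (auto intro!: AE_I2 order_trans[OF _ abs_ge_self])
  qed (use Hm in measurable)
  define F where "F = nth_derivative N f"
  have F: "((\<lambda>t. \<integral>\<tau>. H \<tau> * of_real t powr (r0 - \<i> * of_real (\<mu> * \<tau>)) \<partial>lborel) has_vector_derivative F t) (at t)" if t: "t > 0" for t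
  proof -
    have "(nth_derivative N1 f has_vector_derivative F t) (at t)"
      unfolding F_def N1 using td t N1 by (intro nth_derivative_has_vector_derivative) auto
    then show ?thesis
    proof (rule has_vector_derivative_transform_within_open[where S = "{0<..}"])
      fix u :: real assume "u \<in> {0<..}"
      then have "nth_derivative N1 f u = mellin_deriv h (\<rho> - 1) \<mu> N1 u"
        by (intro nth_derivative_mellin[OF hm hiN1 fm]) auto
      then show "nth_derivative N1 f u = (\<integral>\<tau>. H \<tau> * of_real u powr (r0 - \<i> * of_real (\<mu> * \<tau>)) \<partial>lborel)"
        by (simp add: mellin_deriv_def H_def rC r0')
    qed (use t in auto)
  qed
  have s: "Re (r0 + (\<alpha> + \<gamma> - of_nat N) - (- 0 - of_nat N)) > 0" using R(2) by simp
  have \<mu>0: "\<mu> \<noteq> 0" using \<mu> by simp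
  note S = saigo_integral_mellin[OF x R(1) \<mu>0 \<delta>(1,2,3) s Hm Hi F]
  let ?l = "\<lambda>\<tau>. H \<tau> * (r \<tau> * (Gamma (r \<tau>) * Gamma (r \<tau> + (\<alpha> + \<gamma> - of_nat N) - (- 0 - of_nat N)) *
          rGamma (r \<tau> - (- 0 - of_nat N)) * rGamma (r \<tau> + c + (\<alpha> + \<gamma> - of_nat N))))
        * of_real x powr (r \<tau> - (- 0 - of_nat N) - 1)"
  let ?r = "\<lambda>\<tau>. I_density br m (n + 1) us' ls' a \<theta> \<tau> * of_real x powr (\<rho> - 1 - \<i> * of_real (\<mu> * \<tau>))"
  have "caputo_EK_defined \<gamma> \<alpha> f x"
    using td S(1) by (simp add: caputo_defined_def Let_def N[symmetric] F_def c_def)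
  moreover have "caputo_EK \<gamma> \<alpha> f x = (\<integral>\<tau>. ?r \<tau> \<partial>lborel)"
  proof -
    have "caputo_EK \<gamma> \<alpha> f x = saigo_integral c (- 0 - of_nat N) (\<alpha> + \<gamma> - of_nat N) F x"
      by (simp add: caputo_derivative_def Let_def N[symmetric] F_def c_def)
    also have "\<dots> = (\<integral>\<tau>. ?l \<tau> \<partial>lborel)"
      unfolding r_def by (rule S(2))
    also have "\<dots> = (\<integral>\<tau>. ?r \<tau> \<partial>lborel)"
    proof (rule Bochner_Integration.integral_cong[OF refl])
      fix \<tau>
      have e: "r \<tau> + (\<alpha> + \<gamma> - of_nat N) - (- 0 - of_nat N) = r \<tau> + (\<alpha> + \<gamma>)"
        "r \<tau> - (- 0 - of_nat N) = r \<tau> + of_nat N"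
        "r \<tau> + c + (\<alpha> + \<gamma> - of_nat N) = r \<tau> + \<gamma>"
        by (simp_all add: c_def)
      have e2: "r \<tau> + of_nat N - 1 = \<rho> - 1 - \<i> * of_real (\<mu> * \<tau>)"
        by (simp add: r_def r0_def)
      have "r \<tau> \<notin> \<int>\<^sub>\<le>\<^sub>0" using R by (intro Re_pos_notin_nonpos_Ints) (simp add: r_def)
      then have "Gamma (r \<tau>) * rGamma (r \<tau>) = 1" by (simp add: Gamma_def rGamma_eq_zero_iff)
      then have G: "pochhammer (r \<tau> + 1) N1 * r \<tau> * Gamma (r \<tau>) * rGamma (r \<tau> + of_nat N) = 1"
        using pochhammer_rGamma[of "r \<tau>" N] by (simp add: N1 pochhammer_rec mult_ac)
      have "I_chi br m (n + 1) us' ls' (\<i> * of_real \<tau>) =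
         I_chi br m n us ls (\<i> * of_real \<tau>) * Gamma (r \<tau> + (\<alpha> + \<gamma>)) * rGamma (r \<tau> + \<gamma>)"
      proof -
        have us2: "us' = (1 - (\<alpha> + \<gamma> + r0), \<mu>, 1) # us" by (simp add: us' r0_def)
        have ls2: "ls' = ls @ [(1 - (\<gamma> + r0), \<mu>, 1)]" by (simp add: ls' r0_def)
        have q: "\<alpha> + \<gamma> + r0 - of_real \<mu> * (\<i> * of_real \<tau>) = r \<tau> + (\<alpha> + \<gamma>)"
          "\<gamma> + r0 - of_real \<mu> * (\<i> * of_real \<tau>) = r \<tau> + \<gamma>" by (simp_all add: r_def)
        have "Re (\<i> * complex_of_real \<tau>) = 0" by simp
        from I_chi_extend[OF branch m \<mu>0 this] show ?thesis unfolding us2 ls2 q[symmetric] .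
      qed
      then have I: "I_density br m (n + 1) us' ls' a \<theta> \<tau> = h \<tau> * (Gamma (r \<tau> + (\<alpha> + \<gamma>)) * rGamma (r \<tau> + \<gamma>))"
        by (simp add: h_def I_density_def)
      show "?l \<tau> =
        ?r \<tau>"
      proof -
        have "H \<tau> * (r \<tau> * (Gamma (r \<tau>) * Gamma (r \<tau> + (\<alpha> + \<gamma>)) * rGamma (r \<tau> + of_nat N) * rGamma (r \<tau> + \<gamma>))) =
           h \<tau> * (Gamma (r \<tau> + (\<alpha> + \<gamma>)) * rGamma (r \<tau> + \<gamma>)) *
           (pochhammer (r \<tau> + 1) N1 * r \<tau> * Gamma (r \<tau>) * rGamma (r \<tau> + of_nat N))"
          unfolding H_def by (simp only: mult_ac)
        then show ?thesis unfolding e e2 I G by simp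
      qed
    qed
    finally show ?thesis .
  qed
  moreover have "\<dots> = of_real x powr (\<rho> - 1) * I_function br m (n + 1) us' ls' (a * of_real (x powr \<mu>)) \<theta>"
    by (rule powr_times_I_function[OF x a(1), symmetric])
  ultimately show ?thesis by metis
qed

end
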